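(* Let $\omega(x)=|x|^{\gamma}$, $v(x)=|x|^{\beta}$, and $\omega_i(x)=|x|^{\gamma_i}$, $v_i(x)=|x|^{\beta_i}$ for $i=1,\dots,m$, where $\beta,\gamma,\beta_i,\gamma_i>-n$. Let $1\le p,q<\infty$ and $1\le p_i,q_i<\infty$ with $\sum_{i=1}^m\frac1{p_i}=\frac1p$ and $\sum_{i=1}^m\frac1{q_i}=\frac1q$, and let $\alpha,\alpha_1,\dots,\alpha_m\in\mathbb{R}$. Suppose $$\sum_{i=1}^m \frac{\gamma_i}{q_i}=\frac{\gamma}{q},\qquad \sum_{i=1}^m \Big(1+\frac{\beta_i}{n}\Big)\alpha_i=\Big(1+\frac{\beta}{n}\Big)\alpha .$$ Let $\Phi$ and $A_1,\dots,A_m$ be as in the context; in particular $$\rho_{\vec A}:=\operatorname*{ess\,sup}_{t\in\mathbb{R}^n,\ i=1,\dots,m}\|A_i(t)\|\,\|A_i^{-1}(t)\|<\infty .$$ Put $$\mathcal{C}_{2}=\int_{\mathbb{R}^n}\frac{|\Phi(y)|}{|y|^n}\prod_{i=1}^m\|A^{-1}_i(y)\|^{\left(1+\frac{\beta_i}{n}\right)\alpha_i+\frac{n+\gamma_i}{q_i}}\,dy .$$ (i) If $\mathcal{C}_2<\infty$, then $\mathcal{H}_{\Phi,\vec{A}}$ is bounded from $\prod_{i=1}^m\dot{K}^{\alpha_i,p_i,q_i}_{v_i,\omega_i}(\mathbb{R}^n)$ to $\dot{K}^{\alpha,p,q}_{v,\omega}(\mathbb{R}^n)$, and $$\|\mathcal{H}_{\Phi,\vec{A}}\|_{\prod_{i=1}^m\dot{K}^{\alpha_i,p_i,q_i}_{v_i,\omega_i}(\mathbb{R}^n)\to\dot{K}^{\alpha,p,q}_{v,\omega}(\mathbb{R}^n)}\lesssim\mathcal{C}_2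 .$$ (ii) Conversely, suppose $\Phi$ is a real function with a constant sign in $\mathbb{R}^n$. If $\mathcal{H}_{\Phi,\vec{A}}$ is bounded from $\prod_{i=1}^m\dot{K}^{\alpha_i,p_i,q_i}_{v_i,\omega_i}(\mathbb{R}^n)$ to $\dot{K}^{\alpha,p,q}_{v,\omega}(\mathbb{R}^n)$, then $\mathcal{C}_2<\infty$, and $$\|\mathcal{H}_{\Phi,\vec{A}}\|_{\prod_{i=1}^m\dot{K}^{\alpha_i,p_i,q_i}_{v_i,\omega_i}(\mathbb{R}^n)\to\dot{K}^{\alpha,p,q}_{v,\omega}(\mathbb{R}^n)}\gtrsim\mathcal{C}_2 .$$
   Context: $n,m\ge 1$ are integers. $\Phi$ is a locally integrable function on $\mathbb{R}^n$; $A_1,\dots,A_m$ are measurable functions on $\mathbb{R}^n$ with values in the $n\times n$ real matrices, invertible almost everywhere. For a matrix $A=(a_{ij})$, $\|A\|=\big(\sum_{i,j=1}^n|a_{ij}|^2\big)^{1/2}$, and $A_i^{-1}(y)$ denotes the inverse of $A_i(y)$. The multilinear Hausdorff operator is, for $\vec f=(f_1,\dots,f_m)$ with $f_i$ complex-valued measurable functions on $\mathbb{R}^n$, $$\mathcal{H}_{\Phi,\vec{A}}(\vec{f})(x)=\int_{\mathbb{R}^n}\frac{\Phi(y)}{|y|^n}\prod_{i=1}^m f_i(A_i(y)x)\,dy,\qquad x\in\mathbb{R}^n.$$ For $k\in\mathbb{Z}$ let $B_k=\{x\in\mathbb{R}^n:|x|\le 2^k\}$, $C_k=B_k\setminus B_{k-1}$,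 $\chi_k=\chi_{C_k}$ (characteristic function). For a weight $v$ (nonnegative locally integrable function), $v(E)=\int_E v(x)\,dx$, and $\|f\|_{L^q_\omega(\mathbb{R}^n)}=\big(\int_{\mathbb{R}^n}|f|^q\omega\,dx\big)^{1/q}$. Two weighted homogeneous Herz space: for weights $v,\omega$, $0<p<\infty$, $1\le q<\infty$, $\alpha\in\mathbb{R}$, $\dot{K}^{\alpha,p,q}_{v,\omega}(\mathbb{R}^n)$ is the set of measurable $f$ with $\int_K|f|^q\omega\,dx<\infty$ for all compact $K\subset\mathbb{R}^n\setminus\{0\}$ and $$\|f\|_{\dot{K}^{\alpha,p,q}_{v,\omega}(\mathbb{R}^n)}=\Big(\sum_{k=-\infty}^{\infty}v(B_k)^{\frac{\alpha p}{n}}\|f\chi_k\|^p_{L^q_\omega(\mathbb{R}^n)}\Big)^{1/p}<\infty .$$ Boundedness of an $m$-linear operator $T$ from $\prod X_i$ to $Y$ means $\|T(\vec f)\|_Y\le C\prod_i\|f_i\|_{X_i}$ for all $f_i\in X_i$, with $T(\vec f)$ well defined almost everywhere; the operator norm is the least such $C$. $a\lesssim b$ (equivalently $b\gtrsim a$) means $a\le Cb$ with $C>0$ independent of $\vec f$ and $\Phi$; $C$ may depend on $n$, $m$, the exponents and $\rho_{\vec A}$. *)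

theory Defs
  imports "HOL-Analysis.Analysis" "HOL-Probability.Essential_Supremum"
begin

text \<open>
  ``Measurable'' and ``almost everywhere'' refer to Lebesgue measure throughout. The norm of the type
  \<^typ>\<open>real^'n^'n\<close> is the Frobenius norm \<open>(\<Sum>i j. \<bar>a i j\<bar>\<^sup>2)\<^sup>1\<^sup>/\<^sup>2\<close>. Families indexed by \<open>i = 1, \<dots>, m\<close>
  are functions on \<^typ>\<open>nat\<close> of which only the values on \<open>{1..m}\<close> matter.
\<close>

definition locally_integrable :: "('a::euclidean_space \<Rightarrow> 'b::{banach,second_countable_topology}) \<Rightarrow> bool"
  where "locally_integrable f \<longleftrightarrow> (\<forall>K. compact K \<longrightarrow> set_integrable lebesgue K f)"

definition power_weight :: "real \<Rightarrow> 'a::real_normed_vector \<Rightarrow> real"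
  where "power_weight \<gamma> x = norm x powr \<gamma>"


subsection \<open>Two weighted homogeneous Herz spaces\<close>

definition dyadic_ball :: "int \<Rightarrow> 'a::real_normed_vector set"
  where "dyadic_ball k = {x. norm x \<le> 2 powi k}"

definition dyadic_shell :: "int \<Rightarrow> 'a::real_normed_vector set"
  where "dyadic_shell k = dyadic_ball k - dyadic_ball (k - 1)"

definition weight_of :: "('a::euclidean_space \<Rightarrow> real) \<Rightarrow> 'a set \<Rightarrow> real"
  where "weight_of v E = set_lebesgue_integral lebesgue E v"

text \<open>
  The integral below is a Bochner integral, so the value is meaningful only if the integrand is
  integrable. In \<open>herz_term\<close> this is guaranteed for the members of \<open>herz_set\<close>, because each shell
  is contained in a compact set that avoids the origin.
\<close>

definition weighted_Lq_norm :: "real \<Rightarrow> ('a::euclidean_space \<Rightarrow> real) \<Rightarrow> ('a \<Rightarrow> complex) \<Rightarrow> real"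
  where "weighted_Lq_norm q \<omega> f = (\<integral>x. norm (f x) powr q * \<omega> x \<partial>lebesgue) powr (1 / q)"

definition herz_term ::
  "('a::euclidean_space \<Rightarrow> real) \<Rightarrow> ('a \<Rightarrow> real) \<Rightarrow> real \<Rightarrow> real \<Rightarrow> real \<Rightarrow> ('a \<Rightarrow> complex) \<Rightarrow> int \<Rightarrow> real"
  where "herz_term v \<omega> \<alpha> p q f k =
    weight_of v (dyadic_ball k) powr (\<alpha> * p / real DIM('a)) *
    weighted_Lq_norm q \<omega> (\<lambda>x. f x * indicator (dyadic_shell k) x) powr p"

definition herz_norm ::
  "('a::euclidean_space \<Rightarrow> real) \<Rightarrow> ('a \<Rightarrow> real) \<Rightarrow> real \<Rightarrow> real \<Rightarrow> real \<Rightarrow> ('a \<Rightarrow> complex) \<Rightarrow> real"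
  where "herz_norm v \<omega> \<alpha> p q f = (\<Sum>\<^sub>\<infinity>k\<in>UNIV. herz_term v \<omega> \<alpha> p q f k) powr (1 / p)"

text \<open>The terms are nonnegative, so summability expresses that the norm is finite.\<close>

definition herz_set ::
  "('a::euclidean_space \<Rightarrow> real) \<Rightarrow> ('a \<Rightarrow> real) \<Rightarrow> real \<Rightarrow> real \<Rightarrow> real \<Rightarrow> ('a \<Rightarrow> complex) set"
  where "herz_set v \<omega> \<alpha> p q =
    {f. f \<in> borel_measurable lebesgue \<and>
        (\<forall>K. compact K \<and> K \<subseteq> UNIV - {0} \<longrightarrow>
             set_integrable lebesgue K (\<lambda>x. norm (f x) powr q * \<omega> x)) \<and>
        herz_term v \<omega> \<alpha> p q f summable_on UNIV}"

type_synonym 'a fun_space = "('a \<Rightarrow> complex) set \<times> (('a \<Rightarrow> complex) \<Rightarrow> real)"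

definition herz_space ::
  "('a::euclidean_space \<Rightarrow> real) \<Rightarrow> ('a \<Rightarrow> real) \<Rightarrow> real \<Rightarrow> real \<Rightarrow> real \<Rightarrow> 'a fun_space"
  where "herz_space v \<omega> \<alpha> p q = (herz_set v \<omega> \<alpha> p q, herz_norm v \<omega> \<alpha> p q)"


subsection \<open>Bounded multilinear operators\<close>

text \<open>
  An operator \<open>T\<close> is given together with a predicate \<open>def_at\<close>: \<open>def_at f x\<close> says that
  \<open>T f x\<close> is well defined.
\<close>

definition multilinear_bound ::
  "nat \<Rightarrow> ((nat \<Rightarrow> 'a \<Rightarrow> complex) \<Rightarrow> 'a \<Rightarrow> bool) \<Rightarrow> ((nat \<Rightarrow> 'a \<Rightarrow> complex) \<Rightarrow> 'a \<Rightarrow> complex) \<Rightarrow>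
   (nat \<Rightarrow> 'a::euclidean_space fun_space) \<Rightarrow> 'a fun_space \<Rightarrow> real \<Rightarrow> bool"
  where "multilinear_bound m def_at T X Y C \<longleftrightarrow>
    0 \<le> C \<and>
    (\<forall>f. (\<forall>i\<in>{1..m}. f i \<in> fst (X i)) \<longrightarrow>
         (AE x in lebesgue. def_at f x) \<and>
         T f \<in> fst Y \<and>
         snd Y (T f) \<le> C * (\<Prod>i=1..m. snd (X i) (f i)))"

definition multilinear_bounded ::
  "nat \<Rightarrow> ((nat \<Rightarrow> 'a \<Rightarrow> complex) \<Rightarrow> 'a \<Rightarrow> bool) \<Rightarrow> ((nat \<Rightarrow> 'a \<Rightarrow> complex) \<Rightarrow> 'a \<Rightarrow> complex) \<Rightarrow>
   (nat \<Rightarrow> 'a::euclidean_space fun_space) \<Rightarrow> 'a fun_space \<Rightarrow> bool"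
  where "multilinear_bounded m def_at T X Y \<longleftrightarrow> (\<exists>C. multilinear_bound m def_at T X Y C)"

definition multilinear_norm ::
  "nat \<Rightarrow> ((nat \<Rightarrow> 'a \<Rightarrow> complex) \<Rightarrow> 'a \<Rightarrow> bool) \<Rightarrow> ((nat \<Rightarrow> 'a \<Rightarrow> complex) \<Rightarrow> 'a \<Rightarrow> complex) \<Rightarrow>
   (nat \<Rightarrow> 'a::euclidean_space fun_space) \<Rightarrow> 'a fun_space \<Rightarrow> real"
  where "multilinear_norm m def_at T X Y = Inf {C. multilinear_bound m def_at T X Y C}"


subsection \<open>The multilinear Hausdorff operator\<close>

definition hausdorff_integrand ::
  "nat \<Rightarrow> (real^'n \<Rightarrow> complex) \<Rightarrow> (nat \<Rightarrow> real^'n \<Rightarrow> real^'n^'n) \<Rightarrow>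
   (nat \<Rightarrow> real^'n \<Rightarrow> complex) \<Rightarrow> real^'n \<Rightarrow> real^'n \<Rightarrow> complex"
  where "hausdorff_integrand m \<Phi> A f x y =
    \<Phi> y / of_real (norm y ^ CARD('n)) * (\<Prod>i=1..m. f i (A i y *v x))"

definition hausdorff_def_at ::
  "nat \<Rightarrow> (real^'n \<Rightarrow> complex) \<Rightarrow> (nat \<Rightarrow> real^'n \<Rightarrow> real^'n^'n) \<Rightarrow>
   (nat \<Rightarrow> real^'n \<Rightarrow> complex) \<Rightarrow> real^'n \<Rightarrow> bool"
  where "hausdorff_def_at m \<Phi> A f x \<longleftrightarrow> integrable lebesgue (hausdorff_integrand m \<Phi> A f x)"

definition hausdorff_op ::
  "nat \<Rightarrow> (real^'n \<Rightarrow> complex) \<Rightarrow> (nat \<Rightarrow> real^'n \<Rightarrow> real^'n^'n) \<Rightarrow>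
   (nat \<Rightarrow> real^'n \<Rightarrow> complex) \<Rightarrow> real^'n \<Rightarrow> complex"
  where "hausdorff_op m \<Phi> A f x = (\<integral>y. hausdorff_integrand m \<Phi> A f x y \<partial>lebesgue)"

definition ae_invertible_family :: "nat \<Rightarrow> (nat \<Rightarrow> real^'n \<Rightarrow> real^'n^'n) \<Rightarrow> bool"
  where "ae_invertible_family m A \<longleftrightarrow>
    (\<forall>i\<in>{1..m}. A i \<in> borel_measurable lebesgue \<and> (AE y in lebesgue. invertible (A i y)))"

definition rho :: "nat \<Rightarrow> (nat \<Rightarrow> real^'n \<Rightarrow> real^'n^'n) \<Rightarrow> ennreal"
  where "rho m A =
    (SUP i\<in>{1..m}. esssup lebesgue (\<lambda>t. ennreal (norm (A i t) * norm (matrix_inv (A i t)))))"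

definition hausdorff_const ::
  "nat \<Rightarrow> (real^'n \<Rightarrow> complex) \<Rightarrow> (nat \<Rightarrow> real^'n \<Rightarrow> real^'n^'n) \<Rightarrow>
   (nat \<Rightarrow> real) \<Rightarrow> (nat \<Rightarrow> real) \<Rightarrow> (nat \<Rightarrow> real) \<Rightarrow> (nat \<Rightarrow> real) \<Rightarrow> ennreal"
  where "hausdorff_const m \<Phi> A \<beta> \<gamma> \<alpha> q =
    (\<integral>\<^sup>+y. ennreal (cmod (\<Phi> y) / norm y ^ CARD('n) *
        (\<Prod>i=1..m. norm (matrix_inv (A i y))
           powr ((1 + \<beta> i / real CARD('n)) * \<alpha> i + (real CARD('n) + \<gamma> i) / q i))) \<partial>lebesgue)"

definition real_of_constant_sign :: "('a \<Rightarrow> complex) \<Rightarrow> bool"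
  where "real_of_constant_sign \<Phi> \<longleftrightarrow>
    (\<forall>y. \<Phi> y \<in> \<real> \<and> 0 \<le> Re (\<Phi> y)) \<or> (\<forall>y. \<Phi> y \<in> \<real> \<and> Re (\<Phi> y) \<le> 0)"

end

(* Put s_i = (1 + beta_i / n) alpha_i and e_i = s_i + (n + gamma_i) / q_i, so that C_2 is the integral of
   |Phi(y)| |y|^(-n) prod_i ||A_i^(-1)(y)||^(e_i).

   Sufficiency. If ||M|| ||M^(-1)|| <= rho, then |M x| is comparable with |x| / ||M^(-1)||, so M maps a
   dyadic shell into boundedly many consecutive ones and g |-> g o M is bounded on the Herz space with
   norm at most a constant times ||M^(-1)||^e. Under the conditions on the exponents, Hoelder's inequality
   bounds the Herz norm of a product by the product of the Herz norms, and Minkowski's integral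
   inequality, applied first in L^q on a shell and then in l^p over the shells, moves the norm
   inside the integral over y.

   Necessity. Test on f_i(x) = |x|^(-e_i) for 1 < |x| <= 2^N and 0 elsewhere, whose Herz norm is a
   constant times N^(1/p_i). If the integral over y is restricted to the set where all ||A_i^(-1)(y)||
   lie in [2^(-L), 2^L], then the image is at least a constant times |x|^(-e_1 - ... - e_m) times the
   restricted integral on all but O(L) of the N shells. Choosing N proportional to L, the powers of N
   cancel up to a constant, and monotone convergence in L gives the claim. *)

theory Submission
  imports Defs
begin

text \<open>Three obstacles shape the development. Bochner integrals and infinite sums default to 0
  when they diverge, so every inequality is proved for \<open>herz_sum\<close>, an extended
  nonnegative p-th power of the norm stripped of a constant, and translated back only once
  finiteness is known. The weights v survive there only in the exponent \<sigma> = (1 + \<beta>/n)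
  \<alpha>, because v(B_k) is a constant times 2^(k (n + \<beta>)). Second, f_i and A_i are merely
  Lebesgue measurable, so f_i(A_i(y) x) is handled through Borel representatives; that this changes
  nothing for almost every x rests on invertible matrices pulling null sets back to null sets. Even
  the measurability of ||A_i^(-1)|| has to be extracted, from the finiteness of \<open>rho\<close>.
  Third, the implied constants must be fixed before \<Phi> and A: all comparisons use one real bound
  for \<open>rho\<close> and a natural R with that bound at most 2^R, so a shell spreads over at
  most R + 2 shells. In the necessity part the truncated integral is not known to be finite, so the
  estimate is made for an arbitrary real number below it.\<close>

section \<open>Powers, Hoelder and Minkowski for extended nonnegative functions\<close>

text \<open>Meaningful only for positive exponents: otherwise \<open>0\<close> and \<open>top\<close> are still sent to themselves.\<close>

definition epow :: "ennreal \<Rightarrow> real \<Rightarrow> ennreal"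
  where "epow x a = (if x = top then top else ennreal (enn2real x powr a))"

lemma epow_ennreal [simp]: "0 \<le> r \<Longrightarrow> epow (ennreal r) a = ennreal (r powr a)"
  by (simp add: epow_def)

lemma epow_top [simp]: "epow top a = top"
  by (simp add: epow_def)

lemma epow_zero [simp]: "epow 0 a = 0"
  by (simp add: epow_def)

lemma epow_one [simp]: "epow 1 a = 1"
  by (simp add: epow_def)

lemma epow_exponent_one [simp]: "epow x 1 = x"
  by (cases x) (auto simp: epow_def)

lemma epow_eq_top_iff [simp]: "epow x a = top \<longleftrightarrow> x = top"
  by (simp add: epow_def)

lemma epow_less_top_iff [simp]: "epow x a < top \<longleftrightarrow> x < top"
  by (simp add: less_top[symmetric])

lemma epow_eq_zero_iff [simp]: "epow x a = 0 \<longleftrightarrow> x = 0"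
  by (cases x) (auto simp: epow_def)

lemma epow_mono: "0 \<le> a \<Longrightarrow> x \<le> y \<Longrightarrow> epow x a \<le> epow y a"
  by (auto simp: epow_def top_unique intro!: ennreal_leI powr_mono2 enn2real_mono simp: less_top)

lemma epow_mult: "epow (x * y) a = epow x a * epow y a"
  by (cases x; cases y)
     (auto simp: powr_mult ennreal_mult'[symmetric] ennreal_top_mult ennreal_mult_top)

lemma epow_prod: "epow (\<Prod>i\<in>I. f i) a = (\<Prod>i\<in>I. epow (f i) a)"
  by (induction I rule: infinite_finite_induct) (auto simp: epow_mult)

lemma epow_epow: "epow (epow x a) b = epow x (a * b)"
  by (cases x) (auto simp: powr_powr)

lemma epow_add: "epow x (a + b) = epow x a * epow x b"
  by (cases x) (auto simp: powr_add ennreal_mult'')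

lemma epow_measurable [measurable]: "f \<in> borel_measurable M \<Longrightarrow> (\<lambda>x. epow (f x) a) \<in> borel_measurable M"
proof -
  have "(\<lambda>x. epow x a) \<in> borel_measurable borel"
    unfolding epow_def by (intro measurable_If) auto
  then show "f \<in> borel_measurable M \<Longrightarrow> (\<lambda>x. epow (f x) a) \<in> borel_measurable M"
    by (rule measurable_compose[rotated])
qed

text \<open>Jensen's inequality for the concave function \<open>ln\<close> on the positive reals,
  exponentiated. A vanishing factor is split off beforehand, since it makes the left side 0.\<close>

lemma weighted_arith_geom_mean:
  fixes x w :: "'a \<Rightarrow> real"
  assumes "finite S" and w: "\<And>i. i \<in> S \<Longrightarrow> 0 < w i" "sum w S = 1"
    and x: "\<And>i. i \<in> S \<Longrightarrow> 0 \<le> x i"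
  shows "(\<Prod>i\<in>S. x i powr w i) \<le> (\<Sum>i\<in>S. w i * x i)"
proof (cases "\<exists>i\<in>S. x i = 0")
  case True
  then have "(\<Prod>i\<in>S. x i powr w i) = 0" using \<open>finite S\<close> by auto
  then show ?thesis using w(1) x by (simp add: sum_nonneg less_imp_le)
next
  case False
  then have pos: "x i > 0" if "i \<in> S" for i using x that by force
  have ne: "S \<noteq> {}" using w(2) by auto
  have "(\<Sum>i\<in>S. w i * ln (x i)) \<le> ln (\<Sum>i\<in>S. w i *\<^sub>R x i)"
    by (rule concave_on_sum[where C="{0<..}" and f=ln])
       (use assms pos ne in \<open>auto simp: ln_concave less_imp_le\<close>)
  moreover have spos: "(\<Sum>i\<in>S. w i * x i) > 0"
    using pos w(1) ne \<open>finite S\<close> by (intro sum_pos) auto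
  ultimately have "exp (\<Sum>i\<in>S. w i * ln (x i)) \<le> (\<Sum>i\<in>S. w i * x i)"
    by (simp add: ln_ge_iff)
  moreover have "exp (\<Sum>i\<in>S. w i * ln (x i)) = (\<Prod>i\<in>S. x i powr w i)"
    using \<open>finite S\<close> by (auto simp: exp_sum powr_def intro!: prod.cong dest: pos)
  ultimately show ?thesis by simp
qed

lemma prod_epow_le_sum:
  assumes "finite S" and w: "\<And>i. i \<in> S \<Longrightarrow> 0 < w i" "sum w S = 1"
  shows "(\<Prod>i\<in>S. epow (x i) (w i)) \<le> (\<Sum>i\<in>S. ennreal (w i) * x i)"
proof (cases "\<exists>i\<in>S. x i = top")
  case True
  then obtain i where i: "i \<in> S" "x i = top" by auto
  have "ennreal (w i) * x i = top" using w(1)[OF i(1)] i(2) by (simp add: ennreal_mult_top)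
  then have "(\<Sum>i\<in>S. ennreal (w i) * x i) = top" using i(1) \<open>finite S\<close>
    by (subst sum.remove[of S i]) auto
  then show ?thesis by simp
next
  case False
  then have fin: "x i = ennreal (enn2real (x i))" if "i \<in> S" for i using that by (auto simp: less_top)
  have "(\<Prod>i\<in>S. epow (x i) (w i)) = (\<Prod>i\<in>S. ennreal (enn2real (x i) powr w i))"
    using False by (intro prod.cong) (auto simp: epow_def)
  also have "\<dots> = ennreal (\<Prod>i\<in>S. enn2real (x i) powr w i)" by (simp add: prod_ennreal)
  also have "\<dots> \<le> ennreal (\<Sum>i\<in>S. w i * enn2real (x i))"
    using assms by (intro ennreal_leI weighted_arith_geom_mean) auto
  also have "\<dots> = (\<Sum>i\<in>S. ennreal (w i * enn2real (x i)))"
    using w(1) by (intro sum_ennreal[symmetric]) (auto simp: less_imp_le)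
  also have "\<dots> = (\<Sum>i\<in>S. ennreal (w i) * x i)"
  proof (intro sum.cong refl)
    fix i assume "i \<in> S"
    have "ennreal (w i * enn2real (x i)) = ennreal (w i) * ennreal (enn2real (x i))"
      using w(1)[OF \<open>i \<in> S\<close>] by (intro ennreal_mult) auto
    then show "ennreal (w i * enn2real (x i)) = ennreal (w i) * x i"
      using fin[OF \<open>i \<in> S\<close>] by simp
  qed
  finally show ?thesis .
qed

text \<open>After division of each \<open>f i\<close> by its integral, the pointwise
  arithmetic-geometric mean inequality integrates to at most the sum of the weights, which is
  1.\<close>

lemma nn_integral_Holder:
  assumes "finite S" and w: "\<And>i. i \<in> S \<Longrightarrow> 0 < w i" "sum w S = 1"
    and [measurable]: "\<And>i. i \<in> S \<Longrightarrow> f i \<in> borel_measurable M"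
  shows "(\<integral>\<^sup>+x. (\<Prod>i\<in>S. epow (f i x) (w i)) \<partial>M) \<le> (\<Prod>i\<in>S. epow (\<integral>\<^sup>+x. f i x \<partial>M) (w i))"
proof -
  define N where "N i = (\<integral>\<^sup>+x. f i x \<partial>M)" for i
  \<comment> \<open>A zero integral is treated before an infinite one: the product on the right may
    then be 0 even though another factor is \<open>top\<close>.\<close>
  consider (zero) i where "i \<in> S" "N i = 0"
    | (top) j where "\<And>i. i \<in> S \<Longrightarrow> N i \<noteq> 0" "j \<in> S" "N j = top"
    | (fin) "\<And>i. i \<in> S \<Longrightarrow> N i \<noteq> 0" "\<And>i. i \<in> S \<Longrightarrow> N i < top"
    by (metis less_top)
  then show ?thesis
  proof cases
    case zero
    then have "AE x in M. f i x = 0" by (simp add: N_def nn_integral_0_iff_AE)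
    then have "AE x in M. (\<Prod>i\<in>S. epow (f i x) (w i)) = 0"
      by eventually_elim (use zero \<open>finite S\<close> in \<open>auto intro!: prod_zero bexI[of _ i]\<close>)
    then have "(\<integral>\<^sup>+x. (\<Prod>i\<in>S. epow (f i x) (w i)) \<partial>M) = (\<integral>\<^sup>+x. 0 \<partial>M)"
      by (intro nn_integral_cong_AE)
    then show ?thesis by simp
  next
    case top
    have "(\<Prod>i\<in>S. epow (N i) (w i)) = epow (N j) (w j) * (\<Prod>i\<in>S - {j}. epow (N i) (w i))"
      using top \<open>finite S\<close> by (subst prod.remove) auto
    also have "\<dots> = top" using top \<open>finite S\<close> by (auto simp: ennreal_top_mult)
    finally show ?thesis by (simp add: N_def)
  next
    case fin
    define P where "P = (\<Prod>i\<in>S. epow (N i) (w i))"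
    have "(\<integral>\<^sup>+x. (\<Prod>i\<in>S. epow (f i x) (w i)) \<partial>M) =
        (\<integral>\<^sup>+x. P * (\<Prod>i\<in>S. epow (f i x / N i) (w i)) \<partial>M)"
    proof (intro nn_integral_cong)
      fix x
      have "P * (\<Prod>i\<in>S. epow (f i x / N i) (w i)) = (\<Prod>i\<in>S. epow (N i * (f i x / N i)) (w i))"
        by (simp add: P_def epow_mult prod.distrib)
      also have "\<dots> = (\<Prod>i\<in>S. epow (f i x) (w i))"
        using fin by (intro prod.cong refl arg_cong2[where f=epow])
          (metis ennreal_times_divide ennreal_mult_divide_eq less_top mult.commute)
      finally show "(\<Prod>i\<in>S. epow (f i x) (w i)) = P * (\<Prod>i\<in>S. epow (f i x / N i) (w i))" ..
    qed
    also have "\<dots> = P * (\<integral>\<^sup>+x. (\<Prod>i\<in>S. epow (f i x / N i) (w i)) \<partial>M)"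
      by (intro nn_integral_cmult) measurable
    also have "\<dots> \<le> P * (\<integral>\<^sup>+x. (\<Sum>i\<in>S. ennreal (w i) * (f i x / N i)) \<partial>M)"
      by (intro mult_left_mono nn_integral_mono prod_epow_le_sum w \<open>finite S\<close>) auto
    also have "(\<integral>\<^sup>+x. (\<Sum>i\<in>S. ennreal (w i) * (f i x / N i)) \<partial>M) = (\<Sum>i\<in>S. ennreal (w i) * (N i / N i))"
      by (subst nn_integral_sum) (auto simp: nn_integral_cmult nn_integral_divide N_def)
    also have "\<dots> = (\<Sum>i\<in>S. ennreal (w i))"
      using fin by (intro sum.cong) (auto simp: ennreal_divide_self)
    also have "\<dots> = 1" using w by (subst sum_ennreal) (auto simp: less_imp_le)
    finally show ?thesis by (simp add: P_def N_def)
  qed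
qed

text \<open>A direct argument without duality. With S the integral of H, Hoelder in y against the
  weight H^(1-q) bounds (\<integral>F)^q by S^(q-1) times the integral of F^q H^(1-q); Tonelli and
  the slice bound then leave S^(q-1) S. Majorising the slices by H, rather than speaking of their
  norms, allows any measurable bound that holds for almost every y to be plugged in.\<close>

lemma nn_integral_Minkowski:
  fixes F :: "'a \<Rightarrow> 'b \<Rightarrow> ennreal"
  assumes "sigma_finite_measure M" "sigma_finite_measure N"
    and F [measurable]: "(\<lambda>(x, y). F x y) \<in> borel_measurable (M \<Otimes>\<^sub>M N)"
    and H [measurable]: "H \<in> borel_measurable N"
    and "1 \<le> q"
    and le: "AE y in N. (\<integral>\<^sup>+x. epow (F x y) q \<partial>M) \<le> epow (H y) q"
  shows "(\<integral>\<^sup>+x. epow (\<integral>\<^sup>+y. F x y \<partial>N) q \<partial>M) \<le> epow (\<integral>\<^sup>+y. H y \<partial>N) q"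
proof -
  interpret M: sigma_finite_measure M by fact
  interpret N: sigma_finite_measure N by fact
  interpret pair_sigma_finite M N ..
  define S where "S = (\<integral>\<^sup>+y. H y \<partial>N)"
  show ?thesis
  proof (cases "S = top \<or> q = 1")
    case True
    then show ?thesis
    proof
      assume "q = 1"
      have "(\<integral>\<^sup>+x. \<integral>\<^sup>+y. F x y \<partial>N \<partial>M) = (\<integral>\<^sup>+y. \<integral>\<^sup>+x. F x y \<partial>M \<partial>N)"
        using Fubini[OF F] by simp
      also have "\<dots> \<le> S"
        unfolding S_def using le \<open>q = 1\<close> by (intro nn_integral_mono_AE) auto
      finally show ?thesis using \<open>q = 1\<close> by (simp add: S_def)
    qed (simp add: S_def)
  next
    case False
    then have q: "q > 1" and S: "S < top" using \<open>1 \<le> q\<close> by (auto simp: less_top)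
    \<comment> \<open>W is H^(1-q), so that F = (F^q W)^(1/q) H^(1-1/q) wherever 0 < H <
      \<open>top\<close>.\<close>
    define W where "W y = inverse (epow (H y) (q - 1))" for y
    have [measurable]: "W \<in> borel_measurable N" unfolding W_def by measurable
    have fin: "AE y in N. H y < top"
      using nn_integral_PInf_AE[OF H] S by (auto simp: S_def less_top)
    \<comment> \<open>Where H vanishes, W is \<open>top\<close>, so F has to vanish there as well.
      The slice bound yields this for almost every y and then almost every x; the exchange of
      quantifiers makes it available for a fixed x.\<close>
    have "AE y in N. AE x in M. H y = 0 \<longrightarrow> F x y = 0"
      using le AE_space
    proof eventually_elim
      case (elim y)
      note [measurable] = \<open>y \<in> space N\<close>
      show ?case
      proof (cases "H y = 0")
        case True
        then have "(\<integral>\<^sup>+x. epow (F x y) q \<partial>M) = 0" using elim by simp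
        then show ?thesis by (simp add: nn_integral_0_iff_AE)
      qed simp
    qed
    then have "AE x in M. AE y in N. H y = 0 \<longrightarrow> F x y = 0"
      by (subst AE_commute) measurable
    then have G: "AE x in M. epow (\<integral>\<^sup>+y. F x y \<partial>N) q \<le> epow S (q - 1) * (\<integral>\<^sup>+y. epow (F x y) q * W y \<partial>N)"
      using AE_space
    proof eventually_elim
      case (elim x)
      note [measurable] = \<open>x \<in> space M\<close>
      define f where "f i y = (if i = (0::nat) then epow (F x y) q * W y else H y)" for i y
      define w where "w i = (if i = (0::nat) then 1 / q else 1 - 1 / q)" for i
      have [measurable]: "f i \<in> borel_measurable N" for i
        unfolding f_def by (cases "i = 0") simp_all
      have "(\<integral>\<^sup>+y. F x y \<partial>N) = (\<integral>\<^sup>+y. (\<Prod>i\<in>{0,1}. epow (f i y) (w i)) \<partial>N)"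
      proof (intro nn_integral_cong_AE)
        show "AE y in N. F x y = (\<Prod>i\<in>{0,1}. epow (f i y) (w i))"
          using elim(1) fin
        proof eventually_elim
          case (elim y)
          show ?case
          proof (cases "H y = 0")
            case True
            then show ?thesis using elim by (simp add: f_def)
          next
            case False
            obtain h where h: "H y = ennreal h" "h > 0" using False elim(2)
              by (cases "H y") (auto simp: order_le_less)
            have "epow (W y) (1 / q) * epow (H y) (1 - 1 / q) = 1"
              using h q unfolding W_def
              by (simp add: inverse_ennreal ennreal_mult'[symmetric] powr_powr powr_minus[symmetric] powr_add[symmetric]
                  diff_divide_distrib)
            then have "F x y * (epow (W y) (1 / q) * epow (H y) (1 - 1 / q)) = F x y" by simp
            then show ?thesis using q by (simp add: f_def w_def epow_mult epow_epow mult.assoc)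
          qed
        qed
      qed
      also have "\<dots> \<le> (\<Prod>i\<in>{0,1}. epow (\<integral>\<^sup>+y. f i y \<partial>N) (w i))"
        using q by (intro nn_integral_Holder) (auto simp: w_def)
      also have "\<dots> = epow (\<integral>\<^sup>+y. epow (F x y) q * W y \<partial>N) (1 / q) * epow S (1 - 1 / q)"
        by (simp add: f_def w_def S_def)
      finally have "epow (\<integral>\<^sup>+y. F x y \<partial>N) q \<le>
          epow (epow (\<integral>\<^sup>+y. epow (F x y) q * W y \<partial>N) (1 / q) * epow S (1 - 1 / q)) q"
        using q by (intro epow_mono) auto
      also have "\<dots> = epow S (q - 1) * (\<integral>\<^sup>+y. epow (F x y) q * W y \<partial>N)"
        using q by (simp add: epow_mult epow_epow mult.commute left_diff_distrib right_diff_distrib)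
      finally show ?case .
    qed
    have "(\<integral>\<^sup>+x. epow (\<integral>\<^sup>+y. F x y \<partial>N) q \<partial>M) \<le> (\<integral>\<^sup>+x. epow S (q - 1) * (\<integral>\<^sup>+y. epow (F x y) q * W y \<partial>N) \<partial>M)"
      using G by (rule nn_integral_mono_AE)
    also have "\<dots> = epow S (q - 1) * (\<integral>\<^sup>+x. \<integral>\<^sup>+y. epow (F x y) q * W y \<partial>N \<partial>M)"
      by (intro nn_integral_cmult) measurable
    also have "(\<integral>\<^sup>+x. \<integral>\<^sup>+y. epow (F x y) q * W y \<partial>N \<partial>M) = (\<integral>\<^sup>+y. \<integral>\<^sup>+x. epow (F x y) q * W y \<partial>M \<partial>N)"
      by (rule Fubini'[symmetric]) measurable
    also have "\<dots> = (\<integral>\<^sup>+y. (\<integral>\<^sup>+x. epow (F x y) q \<partial>M) * W y \<partial>N)"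
      by (intro nn_integral_cong nn_integral_multc) measurable
    also have "\<dots> \<le> (\<integral>\<^sup>+y. H y \<partial>N)"
    proof (rule nn_integral_mono_AE)
      show "AE y in N. (\<integral>\<^sup>+x. epow (F x y) q \<partial>M) * W y \<le> H y"
        using le fin
      proof eventually_elim
        case (elim y)
        have "(\<integral>\<^sup>+x. epow (F x y) q \<partial>M) * W y \<le> epow (H y) q * W y"
          using elim by (intro mult_right_mono) auto
        also have "\<dots> \<le> H y"
        proof (cases "H y = 0")
          case False
          obtain h where h: "H y = ennreal h" "h > 0" using False elim(2)
            by (cases "H y") (auto simp: order_le_less)
          then show ?thesis using q unfolding W_def
            by (simp add: inverse_ennreal ennreal_mult'[symmetric] powr_minus[symmetric] powr_add[symmetric])
        qed simp
        finally show ?case .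
      qed
    qed
    also have "epow S (q - 1) * (\<integral>\<^sup>+y. H y \<partial>N) = epow S q"
      using epow_add[of S "q - 1" 1] by (simp add: S_def)
    finally show ?thesis by (simp add: S_def mult_left_mono)
  qed
qed

section \<open>Dyadic shells, linear substitutions and power weights\<close>

lemma mem_dyadic_shell:
  "x \<in> dyadic_shell k \<longleftrightarrow> 2 powr (real_of_int k - 1) < norm x \<and> norm x \<le> 2 powr real_of_int k"
  using powr_real_of_int'[of 2 k] powr_real_of_int'[of 2 "k - 1"]
  by (auto simp: dyadic_shell_def dyadic_ball_def)

lemma mem_dyadic_ball: "x \<in> dyadic_ball k \<longleftrightarrow> norm x \<le> 2 powr real_of_int k"
  using powr_real_of_int'[of 2 k] by (auto simp: dyadic_ball_def)

text \<open>Each nonzero point lies in exactly one shell, and its index is explicit; counting shells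
  becomes arithmetic with ceilings.\<close>

lemma mem_dyadic_shell_iff_log: "x \<in> dyadic_shell k \<longleftrightarrow> x \<noteq> 0 \<and> \<lceil>log 2 (norm x)\<rceil> = k"
proof (cases "x = 0")
  case False
  then have "2 powr (real_of_int k - 1) < norm x \<longleftrightarrow> real_of_int k - 1 < log 2 (norm x)"
    "norm x \<le> 2 powr real_of_int k \<longleftrightarrow> log 2 (norm x) \<le> real_of_int k"
    by (simp_all add: less_log_iff log_le_iff)
  then show ?thesis using False by (auto simp: mem_dyadic_shell ceiling_eq_iff)
qed (auto simp: mem_dyadic_shell)

lemma dyadic_ball_borel [measurable]: "dyadic_ball k \<in> sets borel"
  unfolding dyadic_ball_def by measurable

lemma dyadic_shell_borel [measurable]: "dyadic_shell k \<in> sets borel"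
  unfolding dyadic_shell_def by measurable

section \<open>Substitutions in Lebesgue integrals\<close>

lemma nn_integral_lborel_translate:
  fixes g :: "'a::euclidean_space \<Rightarrow> ennreal"
  assumes [measurable]: "g \<in> borel_measurable borel"
  shows "(\<integral>\<^sup>+x. g (c + x) \<partial>lborel) = (\<integral>\<^sup>+x. g x \<partial>lborel)"
  by (subst lborel_distr_plus[symmetric, of c], subst nn_integral_distr) auto

lemma nn_integral_lborel_scale:
  fixes g :: "'a::euclidean_space \<Rightarrow> ennreal"
  assumes [measurable]: "g \<in> borel_measurable borel" and "0 < c"
  shows "(\<integral>\<^sup>+x. g x \<partial>lborel) = ennreal (c ^ DIM('a)) * (\<integral>\<^sup>+x. g (c *\<^sub>R x) \<partial>lborel)"
  using \<open>0 < c\<close>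
  by (subst lborel_affine[of c 0]) (simp_all add: nn_integral_density nn_integral_distr nn_integral_cmult)

text \<open>
  Comparing with convolution against the indicator of the unit ball gives the bound with no determinant
  involved: after an exchange of integrals the inner one is the volume of an image of the ball
  under the inverse map.
\<close>

lemma nn_integral_linear_le:
  fixes L L' :: "'a::euclidean_space \<Rightarrow> 'a" and g :: "'a \<Rightarrow> ennreal"
  assumes g [measurable]: "g \<in> borel_measurable borel"
    and L: "linear L" and inv: "\<And>x. L' (L x) = x" "\<And>x. L (L' x) = x"
    and B: "\<And>x. norm (L' x) \<le> B * norm x" "0 \<le> B"
  shows "(\<integral>\<^sup>+x. g (L x) \<partial>lborel) \<le> ennreal (B ^ DIM('a)) * (\<integral>\<^sup>+x. g x \<partial>lborel)"
proof -
  define U :: "'a set" where "U = cball 0 1"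
  define V where "V = unit_ball_vol (real DIM('a))"
  have V: "V > 0" by (simp add: V_def)
  have U: "emeasure lborel U = ennreal V" by (simp add: U_def V_def emeasure_cball)
  have [measurable]: "U \<in> sets borel" by (simp add: U_def)
  have "linear L'" using L inv by (metis inj_on_inverseI left_inverse_linear linear_injective_left_inverse
        linear_inverse_left ext o_apply id_apply)
  have Lm [measurable]: "L \<in> borel_measurable borel"
    using L by (intro borel_measurable_continuous_onI linear_continuous_on) (simp add: linear_conv_bounded_linear)
  have "ennreal V * (\<integral>\<^sup>+x. g (L x) \<partial>lborel) = (\<integral>\<^sup>+y. indicator U y * (\<integral>\<^sup>+x. g (L x) \<partial>lborel) \<partial>lborel)"
    using U by (simp add: nn_integral_multc)
  also have "\<dots> = (\<integral>\<^sup>+y. \<integral>\<^sup>+x. indicator U y * g (y + L x) \<partial>lborel \<partial>lborel)"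
  proof (intro nn_integral_cong)
    fix y :: 'a
    have "(\<integral>\<^sup>+x. g (L x) \<partial>lborel) = (\<integral>\<^sup>+x. g (L (L' y + x)) \<partial>lborel)"
      by (rule nn_integral_lborel_translate[symmetric]) measurable
    also have "\<dots> = (\<integral>\<^sup>+x. g (y + L x) \<partial>lborel)"
      using inv by (simp add: linear_add[OF L])
    finally show "indicator U y * (\<integral>\<^sup>+x. g (L x) \<partial>lborel) = (\<integral>\<^sup>+x. indicator U y * g (y + L x) \<partial>lborel)"
      by (simp add: nn_integral_cmult)
  qed
  also have "\<dots> = (\<integral>\<^sup>+x. \<integral>\<^sup>+y. indicator U y * g (y + L x) \<partial>lborel \<partial>lborel)"
    by (rule lborel_pair.Fubini') measurable
  also have "\<dots> = (\<integral>\<^sup>+x. \<integral>\<^sup>+y. indicator U (y - L x) * g y \<partial>lborel \<partial>lborel)"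
  proof (rule nn_integral_cong)
    fix x :: 'a
    have "(\<integral>\<^sup>+y. indicator U (y - L x) * g y \<partial>lborel) = (\<integral>\<^sup>+y. indicator U (L x + y - L x) * g (L x + y) \<partial>lborel)"
      by (rule nn_integral_lborel_translate[symmetric]) measurable
    then show "(\<integral>\<^sup>+y. indicator U y * g (y + L x) \<partial>lborel) = (\<integral>\<^sup>+y. indicator U (y - L x) * g y \<partial>lborel)"
      by (simp add: add.commute)
  qed
  also have "\<dots> = (\<integral>\<^sup>+y. \<integral>\<^sup>+x. indicator U (y - L x) * g y \<partial>lborel \<partial>lborel)"
    by (rule lborel_pair.Fubini') measurable
  also have "\<dots> \<le> (\<integral>\<^sup>+y. ennreal (V * B ^ DIM('a)) * g y \<partial>lborel)"
  proof (intro nn_integral_mono)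
    fix y :: 'a
    have "(\<integral>\<^sup>+x. indicator U (y - L x) * g y \<partial>lborel) = (\<integral>\<^sup>+x. indicator U (y - L x) \<partial>lborel) * g y"
      by (simp add: nn_integral_multc)
    also have "(\<integral>\<^sup>+x. indicator U (y - L x) \<partial>lborel) \<le> (\<integral>\<^sup>+x. indicator (cball (L' y) B) x \<partial>lborel)"
    proof (intro nn_integral_mono)
      fix x
      have "dist (L' y) x \<le> B" if "norm (y - L x) \<le> 1"
      proof -
        have "dist (L' y) x = norm (L' (y - L x))"
          using linear_diff[OF \<open>linear L'\<close>, of y "L x"] inv by (simp add: dist_norm)
        also have "\<dots> \<le> B * norm (y - L x)" by (rule B)
        also have "\<dots> \<le> B" using that B(2) by (simp add: mult_left_le)
        finally show ?thesis .
      qed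
      then show "indicator U (y - L x) \<le> (indicator (cball (L' y) B) x :: ennreal)"
        by (auto simp: U_def split: split_indicator)
    qed
    also have "\<dots> = ennreal (V * B ^ DIM('a))"
      using B(2) by (simp add: emeasure_cball V_def)
    finally show "(\<integral>\<^sup>+x. indicator U (y - L x) * g y \<partial>lborel) \<le> ennreal (V * B ^ DIM('a)) * g y"
      by (simp add: mult_right_mono)
  qed
  also have "\<dots> = ennreal V * (ennreal (B ^ DIM('a)) * (\<integral>\<^sup>+y. g y \<partial>lborel))"
    using V B(2) by (simp add: nn_integral_cmult ennreal_mult mult.assoc)
  finally show ?thesis using V by (simp add: ennreal_mult_le_mult_iff)
qed

text \<open>The dummy type argument carries the dimension. \<open>enn2real\<close> loses nothing,
  since the shell is bounded and stays away from the origin, which makes the integral finite for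
  every real \<open>a\<close>.\<close>

definition shell_integral :: "'a::euclidean_space itself \<Rightarrow> real \<Rightarrow> real"
  where "shell_integral _ a = enn2real (\<integral>\<^sup>+x. indicator (dyadic_shell 0) (x::'a) * ennreal (norm x powr a) \<partial>lborel)"

lemma emeasure_dyadic_shell_pos: "emeasure lborel (dyadic_shell 0 :: 'a::euclidean_space set) > 0"
proof -
  obtain b :: 'a where b: "b \<in> Basis" using nonempty_Basis by blast
  \<comment> \<open>Points of this ball have norm strictly between 1/2 and 1, the radii of shell
    0.\<close>
  have "ball ((3/4) *\<^sub>R b) (1/4) \<subseteq> (dyadic_shell 0 :: 'a set)"
  proof
    fix x assume "x \<in> ball ((3/4) *\<^sub>R b) (1/4)"
    then have d: "norm ((3/4) *\<^sub>R b - x) < 1/4" by (simp add: dist_norm)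
    have "norm ((3/4) *\<^sub>R b) = 3/4" using b by simp
    then show "x \<in> dyadic_shell 0"
      using d norm_triangle_ineq2[of "(3/4) *\<^sub>R b" x] norm_triangle_ineq3[of "(3/4) *\<^sub>R b" x]
      by (auto simp: mem_dyadic_shell powr_minus)
  qed
  then have "emeasure lborel (ball ((3/4) *\<^sub>R b) (1/4)) \<le> emeasure lborel (dyadic_shell 0 :: 'a set)"
    by (intro emeasure_mono) auto
  moreover have "emeasure lborel (ball ((3/4) *\<^sub>R b) (1/4)) > 0"
    by (simp add: emeasure_ball)
  ultimately show ?thesis by (rule less_le_trans[rotated])
qed

lemma nn_integral_shell_finite:
  "(\<integral>\<^sup>+x. indicator (dyadic_shell k) (x::'a::euclidean_space) * ennreal (norm x powr a) \<partial>lborel) < top"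
proof -
  \<comment> \<open>t^a is monotone or antitone in t according to the sign of a, so on the shell it
    is bounded by the larger of its values at the two radii.\<close>
  define C where "C = max ((2 powr (real_of_int k - 1)) powr a) ((2 powr real_of_int k) powr a)"
  have "(\<integral>\<^sup>+x. indicator (dyadic_shell k) (x::'a) * ennreal (norm x powr a) \<partial>lborel)
    \<le> (\<integral>\<^sup>+x. ennreal C * indicator (cball 0 (2 powr real_of_int k)) (x::'a) \<partial>lborel)"
  proof (intro nn_integral_mono)
    fix x :: 'a
    have "norm x powr a \<le> C" if "x \<in> dyadic_shell k"
    proof (cases "0 \<le> a")
      case True
      then show ?thesis using that unfolding C_def mem_dyadic_shell by (intro max.coboundedI2 powr_mono2) auto
    next
      case False
      then show ?thesis using that unfolding C_def mem_dyadic_shell by (intro max.coboundedI1 powr_mono2') auto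
    qed
    then show "indicator (dyadic_shell k) x * ennreal (norm x powr a) \<le> ennreal C * indicator (cball 0 (2 powr real_of_int k)) x"
      by (auto simp: mem_dyadic_shell ennreal_leI split: split_indicator)
  qed
  also have "\<dots> < top"
    using emeasure_lborel_cball_finite[of "0::'a" "2 powr real_of_int k"]
    by (subst nn_integral_cmult_indicator) (auto simp: ennreal_mult_less_top)
  finally show ?thesis .
qed

lemma shell_integral_pos: "shell_integral TYPE('a::euclidean_space) a > 0"
proof -
  let ?I = "\<integral>\<^sup>+x. indicator (dyadic_shell 0) (x::'a) * ennreal (norm x powr a) \<partial>lborel"
  have "?I \<noteq> 0"
  proof
    assume "?I = 0"
    then have "AE x in lborel. indicator (dyadic_shell 0) (x::'a) * ennreal (norm x powr a) = 0"
      by (simp add: nn_integral_0_iff_AE)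
    then have "AE x in lborel. x \<notin> (dyadic_shell 0 :: 'a set)"
      by eventually_elim (auto simp: mem_dyadic_shell_iff_log split: split_indicator_asm)
    then have "emeasure lborel (dyadic_shell 0 :: 'a set) = 0"
      by (subst (asm) AE_iff_measurable[of "dyadic_shell 0"]) auto
    then show False using emeasure_dyadic_shell_pos[where 'a='a] by simp
  qed
  then show ?thesis
    using nn_integral_shell_finite[of 0 a, where 'a='a]
    by (auto simp: shell_integral_def enn2real_positive_iff zero_less_iff_neq_zero)
qed

text \<open>The dilation by 2^k carries shell 0 onto shell k. For the test functions of the
  necessity part the resulting power of 2 balances the Herz weight exactly.\<close>

lemma nn_integral_shell:
  "(\<integral>\<^sup>+x. indicator (dyadic_shell k) (x::'a::euclidean_space) * ennreal (norm x powr a) \<partial>lborel) =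
     ennreal (2 powr (real_of_int k * (real DIM('a) + a)) * shell_integral TYPE('a) a)"
proof -
  let ?c = "2 powr real_of_int k :: real"
  have "(\<integral>\<^sup>+x. indicator (dyadic_shell k) (x::'a) * ennreal (norm x powr a) \<partial>lborel) =
    ennreal (?c ^ DIM('a)) * (\<integral>\<^sup>+x. indicator (dyadic_shell k) (?c *\<^sub>R x :: 'a) * ennreal (norm (?c *\<^sub>R x) powr a) \<partial>lborel)"
    by (rule nn_integral_lborel_scale) auto
  also have "(\<integral>\<^sup>+x. indicator (dyadic_shell k) (?c *\<^sub>R x :: 'a) * ennreal (norm (?c *\<^sub>R x) powr a) \<partial>lborel) =
      (\<integral>\<^sup>+x. ennreal (?c powr a) * (indicator (dyadic_shell 0) (x::'a) * ennreal (norm x powr a)) \<partial>lborel)"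
  proof (intro nn_integral_cong)
    fix x :: 'a
    have "?c *\<^sub>R x \<in> dyadic_shell k \<longleftrightarrow> x \<in> dyadic_shell 0"
      by (auto simp: mem_dyadic_shell powr_diff powr_minus field_simps)
    then show "indicator (dyadic_shell k) (?c *\<^sub>R x) * ennreal (norm (?c *\<^sub>R x) powr a) =
      ennreal (?c powr a) * (indicator (dyadic_shell 0) x * ennreal (norm x powr a))"
      by (auto simp: powr_mult ennreal_mult split: split_indicator)
  qed
  also have "\<dots> = ennreal (?c powr a) * ennreal (shell_integral TYPE('a) a)"
    using nn_integral_shell_finite[of 0 a, where 'a='a] by (simp add: nn_integral_cmult shell_integral_def)
  also have "ennreal (?c ^ DIM('a)) * \<dots> = ennreal (?c ^ DIM('a) * (?c powr a * shell_integral TYPE('a) a))"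
    using shell_integral_pos[of a, where 'a='a] by (simp add: ennreal_mult)
  also have "?c ^ DIM('a) * (?c powr a * shell_integral TYPE('a) a) =
     2 powr (real_of_int k * (real DIM('a) + a)) * shell_integral TYPE('a) a"
    by (simp add: powr_powr powr_realpow[symmetric] powr_add distrib_left)
  finally show ?thesis .
qed

section \<open>Power weights of dyadic balls\<close>

definition ball_integral :: "'a::euclidean_space itself \<Rightarrow> real \<Rightarrow> real"
  where "ball_integral _ b = weight_of (power_weight b) (dyadic_ball 0 :: 'a set)"

lemma weight_of_power_weight:
  "weight_of (power_weight b) (E::'a::euclidean_space set) =
     enn2real (\<integral>\<^sup>+x. indicator E x * ennreal (norm x powr b) \<partial>lborel)" if [measurable]: "E \<in> sets borel"
proof -
  have "weight_of (power_weight b) E = enn2real (\<integral>\<^sup>+x. ennreal (indicator E x *\<^sub>R (norm x powr b)) \<partial>lebesgue)"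
    unfolding weight_of_def set_lebesgue_integral_def power_weight_def
    by (rule integral_eq_nn_integral) (auto intro!: measurable_completion)
  also have "(\<integral>\<^sup>+x. ennreal (indicator E x *\<^sub>R (norm x powr b)) \<partial>lebesgue) =
     (\<integral>\<^sup>+x. indicator E x * ennreal (norm x powr b) \<partial>lborel)"
    by (auto simp: nn_integral_completion intro!: nn_integral_cong split: split_indicator)
  finally show ?thesis .
qed

text \<open>Positivity contains finiteness here, because a divergent integral would be read as 0.
  Splitting the ball into the shells of index 0, -1, -2, ... gives a geometric series with ratio
  2^(-(n+b)), which is below 1 by the hypothesis on b.\<close>

lemma ball_integral_pos:
  assumes "b > - real DIM('a)"
  shows "ball_integral TYPE('a::euclidean_space) b > 0"
proof -
  let ?f = "\<lambda>x::'a. ennreal (norm x powr b)"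
  let ?I = "\<integral>\<^sup>+x. indicator (dyadic_ball 0) x * ?f x \<partial>lborel"
  let ?r = "2 powr (- (real DIM('a) + b)) :: real"
  have "?I \<le> (\<integral>\<^sup>+x. (\<Sum>j. indicator (dyadic_shell (- int j)) x * ?f x) \<partial>lborel)"
  proof (intro nn_integral_mono)
    fix x :: 'a
    \<comment> \<open>The origin lies in no shell, but \<open>0 powr b = 0\<close> makes the left
      side vanish there.\<close>
    show "indicator (dyadic_ball 0) x * ?f x \<le> (\<Sum>j. indicator (dyadic_shell (- int j)) x * ?f x)"
    proof (cases "x \<in> dyadic_ball 0 \<and> x \<noteq> 0")
      case True
      then have "norm x \<le> 1" "norm x > 0" by (auto simp: mem_dyadic_ball)
      then have "\<lceil>log 2 (norm x)\<rceil> \<le> 0" by (simp add: log_le_zero_cancel_iff)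
      then have "x \<in> dyadic_shell (- int (nat (- \<lceil>log 2 (norm x)\<rceil>)))"
        using True by (simp add: mem_dyadic_shell_iff_log)
      then have "indicator (dyadic_ball 0) x * ?f x \<le>
          (\<Sum>j\<in>{nat (- \<lceil>log 2 (norm x)\<rceil>)}. indicator (dyadic_shell (- int j)) x * ?f x)"
        using True by simp
      also have "\<dots> \<le> (\<Sum>j. indicator (dyadic_shell (- int j)) x * ?f x)"
        by (rule sum_le_suminf) auto
      finally show ?thesis .
    qed (auto split: split_indicator)
  qed
  also have "\<dots> = (\<Sum>j. \<integral>\<^sup>+x. indicator (dyadic_shell (- int j)) x * ?f x \<partial>lborel)"
    by (rule nn_integral_suminf) auto
  also have "\<dots> = (\<Sum>j. ennreal (?r ^ j * shell_integral TYPE('a) b))"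
    by (intro suminf_cong, subst nn_integral_shell) (simp add: powr_realpow[symmetric] powr_powr algebra_simps)
  also have "\<dots> < top"
  proof -
    have "?r < 1" using assms by (simp add: powr_less_one)
    then have "summable (\<lambda>j. ?r ^ j * shell_integral TYPE('a) b)"
      by (intro summable_mult2 summable_geometric) auto
    then show ?thesis
      using shell_integral_pos[of b, where 'a='a]
      by (subst suminf_ennreal2) auto
  qed
  finally have fin: "?I < top" .
  have "(\<integral>\<^sup>+x. indicator (dyadic_shell 0) (x::'a) * ?f x \<partial>lborel) \<le> ?I"
    by (intro nn_integral_mono) (auto simp: dyadic_shell_def split: split_indicator)
  then have "?I > 0"
    using shell_integral_pos[of b, where 'a='a] nn_integral_shell[of 0 b, where 'a='a]
    by (auto intro: less_le_trans[rotated])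
  then show ?thesis using fin
    by (simp add: ball_integral_def weight_of_power_weight enn2real_positive_iff)
qed

text \<open>Scaling makes v(B_k) explicit: v(B_k)^(\<alpha> p / n) becomes a constant times 2^(k
  \<sigma> p) with \<sigma> = (1 + \<beta>/n) \<alpha>, and this is the only trace that v leaves in
  the Herz norm.\<close>

lemma weight_of_dyadic_ball:
  "weight_of (power_weight b) (dyadic_ball k :: 'a::euclidean_space set) =
     2 powr (real_of_int k * (real DIM('a) + b)) * ball_integral TYPE('a) b"
proof -
  let ?c = "2 powr real_of_int k :: real"
  have "(\<integral>\<^sup>+x. indicator (dyadic_ball k) (x::'a) * ennreal (norm x powr b) \<partial>lborel) =
    ennreal (?c ^ DIM('a)) * (\<integral>\<^sup>+x. indicator (dyadic_ball k) (?c *\<^sub>R x :: 'a) * ennreal (norm (?c *\<^sub>R x) powr b) \<partial>lborel)"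
    by (rule nn_integral_lborel_scale) auto
  also have "(\<integral>\<^sup>+x. indicator (dyadic_ball k) (?c *\<^sub>R x :: 'a) * ennreal (norm (?c *\<^sub>R x) powr b) \<partial>lborel) =
      (\<integral>\<^sup>+x. ennreal (?c powr b) * (indicator (dyadic_ball 0) (x::'a) * ennreal (norm x powr b)) \<partial>lborel)"
  proof (intro nn_integral_cong)
    fix x :: 'a
    have "?c *\<^sub>R x \<in> dyadic_ball k \<longleftrightarrow> x \<in> dyadic_ball 0"
      by (auto simp: mem_dyadic_ball)
    then show "indicator (dyadic_ball k) (?c *\<^sub>R x) * ennreal (norm (?c *\<^sub>R x) powr b) =
      ennreal (?c powr b) * (indicator (dyadic_ball 0) x * ennreal (norm x powr b))"
      by (auto simp: powr_mult ennreal_mult split: split_indicator)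
  qed
  finally have "weight_of (power_weight b) (dyadic_ball k :: 'a set) =
      ?c ^ DIM('a) * ?c powr b * ball_integral TYPE('a) b"
    by (simp add: weight_of_power_weight ball_integral_def nn_integral_cmult enn2real_mult)
  also have "?c ^ DIM('a) * ?c powr b = 2 powr (real_of_int k * (real DIM('a) + b))"
    by (simp add: powr_powr powr_realpow[symmetric] powr_add distrib_left)
  finally show ?thesis .
qed

section \<open>Herz norms as sums of nonnegative integrals\<close>

text \<open>Translates sums over shells into integrals for the counting measure, so that Hoelder and
  Minkowski apply to them. In the divergent case both sides of the second claim take the value
  0.\<close>

lemma summable_on_iff_nn_integral:
  fixes f :: "'a \<Rightarrow> real"
  assumes "\<And>x. 0 \<le> f x"
  shows "f summable_on UNIV \<longleftrightarrow> (\<integral>\<^sup>+x. ennreal (f x) \<partial>count_space UNIV) < top"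
    and "infsum f UNIV = enn2real (\<integral>\<^sup>+x. ennreal (f x) \<partial>count_space UNIV)"
proof -
  have "f summable_on UNIV \<longleftrightarrow> Infinite_Set_Sum.abs_summable_on f UNIV"
    using summable_on_iff_abs_summable_on_real[of f UNIV] abs_summable_equivalent[of f UNIV] by blast
  also have "\<dots> \<longleftrightarrow> integrable (count_space UNIV) f" by (simp add: Infinite_Set_Sum.abs_summable_on_def)
  also have "\<dots> \<longleftrightarrow> (\<integral>\<^sup>+x. ennreal (f x) \<partial>count_space UNIV) < top"
    using assms by (simp add: integrable_iff_bounded)
  finally show *: "f summable_on UNIV \<longleftrightarrow> (\<integral>\<^sup>+x. ennreal (f x) \<partial>count_space UNIV) < top" .
  show "infsum f UNIV = enn2real (\<integral>\<^sup>+x. ennreal (f x) \<partial>count_space UNIV)"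
  proof (cases "f summable_on UNIV")
    case True
    then have a: "Infinite_Set_Sum.abs_summable_on f UNIV"
      using summable_on_iff_abs_summable_on_real[of f UNIV] abs_summable_equivalent[of f UNIV] by blast
    then have "infsum f UNIV = infsetsum f UNIV" by (rule infsetsum_infsum[symmetric])
    then show ?thesis
      using nn_integral_conv_infsetsum[OF a] assms by (simp add: infsetsum_nonneg)
  next
    case False
    then show ?thesis using * by (simp add: infsum_not_exists less_top[symmetric])
  qed
qed

definition shell_power :: "real \<Rightarrow> real \<Rightarrow> ('a::euclidean_space \<Rightarrow> ennreal) \<Rightarrow> int \<Rightarrow> ennreal"
  where "shell_power \<gamma> q f k =
    (\<integral>\<^sup>+x. indicator (dyadic_shell k) x * (epow (f x) q * ennreal (norm x powr \<gamma>)) \<partial>lborel)"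

text \<open>The p-th power of the Herz norm without the constant factor coming from v(B_0); \<sigma>
  stands for (1 + \<beta>/n) \<alpha>. Extended values let inequalities be stated before anything is
  known to be finite.\<close>

definition herz_sum :: "real \<Rightarrow> real \<Rightarrow> real \<Rightarrow> real \<Rightarrow> ('a::euclidean_space \<Rightarrow> ennreal) \<Rightarrow> ennreal"
  where "herz_sum \<sigma> \<gamma> p q f =
    (\<integral>\<^sup>+k. ennreal (2 powr (real_of_int k * \<sigma> * p)) * epow (shell_power \<gamma> q f k) (p / q) \<partial>count_space UNIV)"

lemma shell_power_cong_AE:
  assumes "AE x in lborel. f x = g x"
  shows "shell_power \<gamma> q f k = shell_power \<gamma> q g k"
  unfolding shell_power_def using assms by (intro nn_integral_cong_AE) auto

lemma herz_sum_cong_AE: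
  assumes "AE x in lborel. f x = g x"
  shows "herz_sum \<sigma> \<gamma> p q f = herz_sum \<sigma> \<gamma> p q g"
  unfolding herz_sum_def by (simp add: shell_power_cong_AE[OF assms])

lemma shell_power_finite:
  assumes "herz_sum \<sigma> \<gamma> p q f < top"
  shows "shell_power \<gamma> q f k < top"
proof -
  let ?t = "\<lambda>k. ennreal (2 powr (real_of_int k * \<sigma> * p)) * epow (shell_power \<gamma> q f k) (p / q)"
  have "?t k = (\<integral>\<^sup>+j. ?t j * indicator {k} j \<partial>count_space UNIV)"
    by (subst nn_integral_count_space'[of "{k}"]) auto
  also have "\<dots> \<le> herz_sum \<sigma> \<gamma> p q f"
    unfolding herz_sum_def by (intro nn_integral_mono) (auto split: split_indicator)
  finally have "?t k < top" using assms by (rule le_less_trans)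
  then show ?thesis by (auto simp: ennreal_mult_less_top)
qed

abbreviation nrm :: "('a \<Rightarrow> complex) \<Rightarrow> 'a \<Rightarrow> ennreal"
  where "nrm f \<equiv> \<lambda>x. ennreal (cmod (f x))"

context
  fixes f :: "'a::euclidean_space \<Rightarrow> complex" and p q \<alpha> \<beta> \<gamma> :: real
  assumes f [measurable]: "f \<in> borel_measurable lebesgue"
    and p: "p > 0" and q: "q > 0" and \<beta>: "\<beta> > - real DIM('a)"
begin

text \<open>If the integral over the shell diverges, the Bochner integral and
  \<open>enn2real\<close> both return 0, so the two sides still agree.\<close>

lemma weighted_Lq_norm_shell:
  "weighted_Lq_norm q (power_weight \<gamma>) (\<lambda>x. f x * indicator (dyadic_shell k) x) =
     enn2real (shell_power \<gamma> q (nrm f) k) powr (1 / q)"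
proof -
  have [measurable]: "dyadic_shell k \<in> sets lebesgue" "norm \<in> borel_measurable lebesgue"
    by (auto intro: measurable_completion)
  have "(\<integral>x. norm (f x * indicator (dyadic_shell k) x) powr q * power_weight \<gamma> x \<partial>lebesgue) =
     enn2real (\<integral>\<^sup>+x. ennreal (norm (f x * indicator (dyadic_shell k) x) powr q * power_weight \<gamma> x) \<partial>lebesgue)"
    unfolding power_weight_def by (rule integral_eq_nn_integral) auto
  also have "\<dots> = enn2real (shell_power \<gamma> q (nrm f) k)"
    unfolding shell_power_def nn_integral_completion power_weight_def
    by (intro arg_cong[where f=enn2real] nn_integral_cong) (use q in \<open>auto simp: ennreal_mult split: split_indicator\<close>)
  finally show ?thesis by (simp add: weighted_Lq_norm_def)
qed

lemma herz_term_eq: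
  "herz_term (power_weight \<beta>) (power_weight \<gamma>) \<alpha> p q f k =
     ball_integral TYPE('a) \<beta> powr (\<alpha> * p / real DIM('a)) *
     (2 powr (real_of_int k * ((1 + \<beta> / real DIM('a)) * \<alpha>) * p) * enn2real (shell_power \<gamma> q (nrm f) k) powr (p / q))"
proof -
  have eq: "real_of_int k * (real DIM('a) + \<beta>) * (\<alpha> * p / real DIM('a)) =
     real_of_int k * ((1 + \<beta> / real DIM('a)) * \<alpha>) * p"
    by (simp add: field_simps)
  have "(2 powr (real_of_int k * (real DIM('a) + \<beta>)) * ball_integral TYPE('a) \<beta>) powr (\<alpha> * p / real DIM('a)) =
     2 powr (real_of_int k * ((1 + \<beta> / real DIM('a)) * \<alpha>) * p) * ball_integral TYPE('a) \<beta> powr (\<alpha> * p / real DIM('a))"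
    using ball_integral_pos[OF \<beta>] by (simp add: powr_mult powr_powr eq del: times_divide_eq_right)
  then show ?thesis
    unfolding herz_term_def weighted_Lq_norm_shell weight_of_dyadic_ball
    by (simp add: powr_powr mult_ac)
qed

text \<open>Finiteness on each shell is essential: a divergent shell would count as 0 in
  \<open>herz_term\<close> and as \<open>top\<close> in \<open>herz_sum\<close>.\<close>

lemma ennreal_herz_term:
  assumes "\<And>k. shell_power \<gamma> q (nrm f) k < top"
  shows "(\<integral>\<^sup>+k. ennreal (herz_term (power_weight \<beta>) (power_weight \<gamma>) \<alpha> p q f k) \<partial>count_space UNIV) =
     ennreal (ball_integral TYPE('a) \<beta> powr (\<alpha> * p / real DIM('a))) *
     herz_sum ((1 + \<beta> / real DIM('a)) * \<alpha>) \<gamma> p q (nrm f)"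
  unfolding herz_sum_def
proof (subst nn_integral_cmult[symmetric], simp, rule nn_integral_cong)
  fix k :: int
  obtain r where r: "shell_power \<gamma> q (nrm f) k = ennreal r" "r \<ge> 0"
    using assms[of k] by (cases "shell_power \<gamma> q (nrm f) k") auto
  show "ennreal (herz_term (power_weight \<beta>) (power_weight \<gamma>) \<alpha> p q f k) =
     ennreal (ball_integral TYPE('a) \<beta> powr (\<alpha> * p / real DIM('a))) *
     (ennreal (2 powr (real_of_int k * ((1 + \<beta> / real DIM('a)) * \<alpha>) * p)) * epow (shell_power \<gamma> q (nrm f) k) (p / q))"
    using r by (simp add: herz_term_eq ennreal_mult)
qed

lemma herz_norm_eq:
  assumes "herz_sum ((1 + \<beta> / real DIM('a)) * \<alpha>) \<gamma> p q (nrm f) < top"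
  shows "herz_norm (power_weight \<beta>) (power_weight \<gamma>) \<alpha> p q f =
     ball_integral TYPE('a) \<beta> powr (\<alpha> / real DIM('a)) *
     enn2real (herz_sum ((1 + \<beta> / real DIM('a)) * \<alpha>) \<gamma> p q (nrm f)) powr (1 / p)"
proof -
  have "(\<Sum>\<^sub>\<infinity>k. herz_term (power_weight \<beta>) (power_weight \<gamma>) \<alpha> p q f k) =
     ball_integral TYPE('a) \<beta> powr (\<alpha> * p / real DIM('a)) * enn2real (herz_sum ((1 + \<beta> / real DIM('a)) * \<alpha>) \<gamma> p q (nrm f))"
    by (subst summable_on_iff_nn_integral(2))
       (auto simp: ennreal_herz_term[OF shell_power_finite[OF assms]] enn2real_mult, simp add: herz_term_def)
  then show ?thesis using p by (simp add: herz_norm_def powr_mult powr_powr)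
qed

text \<open>Finiteness of \<open>herz_sum\<close> encodes both membership conditions at once. Each
  shell lies in a compact annulus, so local integrability makes all terms finite; conversely a
  compact set avoiding the origin meets only finitely many shells.\<close>

lemma herz_set_iff:
  "f \<in> herz_set (power_weight \<beta>) (power_weight \<gamma>) \<alpha> p q \<longleftrightarrow>
     herz_sum ((1 + \<beta> / real DIM('a)) * \<alpha>) \<gamma> p q (nrm f) < top"
proof
  let ?g = "\<lambda>x. cmod (f x) powr q * power_weight \<gamma> x"
  have [measurable]: "norm \<in> borel_measurable lebesgue"
    by (auto intro: measurable_completion)
  have setint: "set_integrable lebesgue K ?g \<longleftrightarrow> (\<integral>\<^sup>+x. indicator K x * ennreal (?g x) \<partial>lborel) < top"
    if [measurable]: "K \<in> sets lebesgue" for K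
  proof -
    have "set_integrable lebesgue K ?g \<longleftrightarrow> (\<integral>\<^sup>+x. ennreal (norm (indicator K x *\<^sub>R ?g x)) \<partial>lebesgue) < top"
      unfolding set_integrable_def integrable_iff_bounded by (auto simp: power_weight_def)
    also have "(\<integral>\<^sup>+x. ennreal (norm (indicator K x *\<^sub>R ?g x)) \<partial>lebesgue) = (\<integral>\<^sup>+x. indicator K x * ennreal (?g x) \<partial>lborel)"
      unfolding nn_integral_completion
      by (intro nn_integral_cong) (auto simp: power_weight_def split: split_indicator)
    finally show ?thesis .
  qed
  have W: "ball_integral TYPE('a) \<beta> powr (\<alpha> * p / real DIM('a)) > 0"
    using ball_integral_pos[OF \<beta>] by simp
  {
    assume L: "f \<in> herz_set (power_weight \<beta>) (power_weight \<gamma>) \<alpha> p q"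
    have "shell_power \<gamma> q (nrm f) k < top" for k
    proof -
      \<comment> \<open>The closed annulus: a closed ball minus an open one, hence compact, with the
        inner sphere added to the shell.\<close>
      let ?K = "cball 0 (2 powr real_of_int k) - ball 0 (2 powr (real_of_int k - 1)) :: 'a set"
      have "compact ?K" by (intro compact_diff) auto
      moreover have "?K \<subseteq> UNIV - {0}" by auto
      ultimately have "set_integrable lebesgue ?K ?g" using L by (auto simp: herz_set_def)
      then have "(\<integral>\<^sup>+x. indicator ?K x * ennreal (?g x) \<partial>lborel) < top"
        by (subst (asm) setint) auto
      moreover have "shell_power \<gamma> q (nrm f) k \<le> (\<integral>\<^sup>+x. indicator ?K x * ennreal (?g x) \<partial>lborel)"
        unfolding shell_power_def
        by (intro nn_integral_mono) (auto simp: power_weight_def mem_dyadic_shell ennreal_mult split: split_indicator)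
      ultimately show ?thesis by (rule le_less_trans[rotated])
    qed
    note eq = ennreal_herz_term[OF this]
    have "herz_term (power_weight \<beta>) (power_weight \<gamma>) \<alpha> p q f summable_on UNIV"
      using L by (simp add: herz_set_def)
    then have "(\<integral>\<^sup>+k. ennreal (herz_term (power_weight \<beta>) (power_weight \<gamma>) \<alpha> p q f k) \<partial>count_space UNIV) < top"
      by (subst (asm) summable_on_iff_nn_integral(1)) (auto simp: herz_term_def)
    then show "herz_sum ((1 + \<beta> / real DIM('a)) * \<alpha>) \<gamma> p q (nrm f) < top"
      using W unfolding eq by (auto simp: ennreal_mult_less_top)
  next
    assume R: "herz_sum ((1 + \<beta> / real DIM('a)) * \<alpha>) \<gamma> p q (nrm f) < top"
    note fin = shell_power_finite[OF R]
    have "set_integrable lebesgue K ?g" if K: "compact K" "K \<subseteq> UNIV - {0}" for K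
    proof (cases "K = {}")
      case False
      have "continuous_on K (norm :: 'a \<Rightarrow> real)" by (intro continuous_intros)
      from continuous_attains_inf[OF K(1) False this] continuous_attains_sup[OF K(1) False this]
      obtain a b where ab: "a \<in> K" "b \<in> K" "\<And>x. x \<in> K \<Longrightarrow> norm a \<le> norm x" "\<And>x. x \<in> K \<Longrightarrow> norm x \<le> norm b"
        by blast
      \<comment> \<open>The norm attains a positive minimum at \<open>a\<close> and a maximum at
        \<open>b\<close>, so the shells meeting K have indices in this finite range.\<close>
      let ?J = "{\<lceil>log 2 (norm a)\<rceil>..\<lceil>log 2 (norm b)\<rceil>}"
      have "(\<integral>\<^sup>+x. indicator K x * ennreal (?g x) \<partial>lborel) =
         (\<integral>\<^sup>+x. indicator K x * ennreal (?g x) \<partial>lebesgue)" by (simp add: nn_integral_completion)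
      also have "\<dots> \<le> (\<integral>\<^sup>+x. (\<Sum>k\<in>?J. indicator (dyadic_shell k) x * ennreal (?g x)) \<partial>lebesgue)"
      proof (intro nn_integral_mono)
        fix x
        show "indicator K x * ennreal (?g x) \<le> (\<Sum>k\<in>?J. indicator (dyadic_shell k) x * ennreal (?g x))"
        proof (cases "x \<in> K")
          case True
          then have nz: "x \<noteq> 0" "a \<noteq> 0" "b \<noteq> 0" using K ab by auto
          have "\<lceil>log 2 (norm x)\<rceil> \<in> ?J" using ab(3,4)[OF True] nz by (auto intro!: ceiling_mono)
          moreover have "x \<in> dyadic_shell \<lceil>log 2 (norm x)\<rceil>" using nz by (simp add: mem_dyadic_shell_iff_log)
          ultimately have "indicator K x * ennreal (?g x) \<le>
              (\<Sum>k\<in>{\<lceil>log 2 (norm x)\<rceil>}. indicator (dyadic_shell k) x * ennreal (?g x))"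
            using True by simp
          also have "\<dots> \<le> (\<Sum>k\<in>?J. indicator (dyadic_shell k) x * ennreal (?g x))"
            using \<open>\<lceil>log 2 (norm x)\<rceil> \<in> ?J\<close> by (intro sum_mono2) auto
          finally show ?thesis .
        qed simp
      qed
      also have "\<dots> = (\<Sum>k\<in>?J. \<integral>\<^sup>+x. indicator (dyadic_shell k) x * ennreal (?g x) \<partial>lebesgue)"
      proof (rule nn_integral_sum)
        fix k
        have [measurable]: "dyadic_shell k \<in> sets lebesgue" by (auto intro: measurable_completion)
        show "(\<lambda>x. indicator (dyadic_shell k) x * ennreal (?g x)) \<in> borel_measurable lebesgue"
          unfolding power_weight_def by measurable
      qed
      also have "\<dots> = (\<Sum>k\<in>?J. shell_power \<gamma> q (nrm f) k)"
        by (simp add: shell_power_def nn_integral_completion power_weight_def ennreal_mult)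
      also have "\<dots> < top" using fin by (simp add: less_top)
      finally show ?thesis using K by (subst setint) (auto intro: lmeasurable_compact fmeasurableD)
    qed (simp add: set_integrable_def)
    moreover have "herz_term (power_weight \<beta>) (power_weight \<gamma>) \<alpha> p q f summable_on UNIV"
    proof (subst summable_on_iff_nn_integral(1))
      show "(\<integral>\<^sup>+k. ennreal (herz_term (power_weight \<beta>) (power_weight \<gamma>) \<alpha> p q f k) \<partial>count_space UNIV) < top"
        unfolding ennreal_herz_term[OF fin] using R by (simp add: ennreal_mult_less_top)
    qed (simp add: herz_term_def)
    ultimately show "f \<in> herz_set (power_weight \<beta>) (power_weight \<gamma>) \<alpha> p q"
      by (simp add: herz_set_def)
  }
qed

end

section \<open>Minkowski, Hoelder and dilation estimates for Herz sums\<close>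

lemma shell_power_measurable_pair [measurable (raw)]:
  assumes [measurable]: "(\<lambda>(x, y). F x y) \<in> borel_measurable (borel \<Otimes>\<^sub>M N)"
  shows "(\<lambda>y. shell_power \<gamma> q (\<lambda>x. F x y) k) \<in> borel_measurable N"
  unfolding shell_power_def by measurable

lemma shell_power_mono:
  assumes "AE x in lborel. f x \<le> g x" "0 \<le> q"
  shows "shell_power \<gamma> q f k \<le> shell_power \<gamma> q g k"
  unfolding shell_power_def
  by (intro nn_integral_mono_AE eventually_mono[OF assms(1)] mult_left_mono mult_right_mono epow_mono assms(2)) auto

lemma herz_sum_mono:
  assumes "AE x in lborel. f x \<le> g x" "0 \<le> q" "0 \<le> p"
  shows "herz_sum \<sigma> \<gamma> p q f \<le> herz_sum \<sigma> \<gamma> p q g"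
  unfolding herz_sum_def
  by (intro nn_integral_mono mult_left_mono epow_mono shell_power_mono assms) (use assms in auto)

text \<open>Minkowski's inequality is used twice: for Lebesgue measure in x on a fixed shell with
  exponent q, then for the counting measure in k with exponent p. Between the two,
  \<open>h k y\<close> is the weighted L^q norm of the slice at y on shell k.\<close>

lemma herz_sum_Minkowski:
  fixes F :: "'a::euclidean_space \<Rightarrow> 'b \<Rightarrow> ennreal"
  assumes N: "sigma_finite_measure N"
    and F [measurable]: "(\<lambda>(x, y). F x y) \<in> borel_measurable (borel \<Otimes>\<^sub>M N)"
    and H [measurable]: "H \<in> borel_measurable N"
    and p: "1 \<le> p" and q: "1 \<le> q"
    and le: "AE y in N. herz_sum \<sigma> \<gamma> p q (\<lambda>x. F x y) \<le> epow (H y) p"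
  shows "herz_sum \<sigma> \<gamma> p q (\<lambda>x. \<integral>\<^sup>+y. F x y \<partial>N) \<le> epow (\<integral>\<^sup>+y. H y \<partial>N) p"
proof -
  interpret N: sigma_finite_measure N by fact
  define h where "h k y = epow (shell_power \<gamma> q (\<lambda>x. F x y) k) (1 / q)" for k y
  have [measurable]: "h k \<in> borel_measurable N" for k
    unfolding h_def by measurable
  have inner: "shell_power \<gamma> q (\<lambda>x. \<integral>\<^sup>+y. F x y \<partial>N) k \<le> epow (\<integral>\<^sup>+y. h k y \<partial>N) q" for k
  proof -
    \<comment> \<open>Indicator and weight are absorbed into the function as the factor u, whose
      q-th power they are; this reduces the weighted inequality to the unweighted one.\<close>
    define u :: "'a \<Rightarrow> ennreal" where "u x = epow (indicator (dyadic_shell k) x * ennreal (norm x powr \<gamma>)) (1 / q)" for x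
    have [measurable]: "u \<in> borel_measurable borel" unfolding u_def by measurable
    have u: "epow (u x) q = indicator (dyadic_shell k) x * ennreal (norm x powr \<gamma>)" for x
      using q by (simp add: u_def epow_epow)
    have eq: "shell_power \<gamma> q f k = (\<integral>\<^sup>+x. epow (u x * f x) q \<partial>lborel)" for f
      unfolding shell_power_def by (intro nn_integral_cong) (simp add: epow_mult u mult_ac)
    have "shell_power \<gamma> q (\<lambda>x. \<integral>\<^sup>+y. F x y \<partial>N) k = (\<integral>\<^sup>+x. epow (\<integral>\<^sup>+y. u x * F x y \<partial>N) q \<partial>lborel)"
      unfolding eq by (intro nn_integral_cong) (simp add: nn_integral_cmult)
    also have "\<dots> \<le> epow (\<integral>\<^sup>+y. h k y \<partial>N) q"
    proof (rule nn_integral_Minkowski)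
      show "AE y in N. (\<integral>\<^sup>+x. epow (u x * F x y) q \<partial>lborel) \<le> epow (h k y) q"
        using q by (simp add: h_def epow_epow eq)
    qed (use N q in \<open>auto intro: lborel.sigma_finite_measure_axioms\<close>)
    finally show ?thesis .
  qed
  have "herz_sum \<sigma> \<gamma> p q (\<lambda>x. \<integral>\<^sup>+y. F x y \<partial>N) \<le>
     (\<integral>\<^sup>+k. epow (\<integral>\<^sup>+y. ennreal (2 powr (real_of_int k * \<sigma>)) * h k y \<partial>N) p \<partial>count_space UNIV)"
    unfolding herz_sum_def
  proof (intro nn_integral_mono)
    fix k :: int
    have "epow (shell_power \<gamma> q (\<lambda>x. \<integral>\<^sup>+y. F x y \<partial>N) k) (p / q) \<le> epow (epow (\<integral>\<^sup>+y. h k y \<partial>N) q) (p / q)"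
      using p q by (intro epow_mono inner) auto
    then have "ennreal (2 powr (real_of_int k * \<sigma> * p)) * epow (shell_power \<gamma> q (\<lambda>x. \<integral>\<^sup>+y. F x y \<partial>N) k) (p / q)
        \<le> ennreal (2 powr (real_of_int k * \<sigma> * p)) * epow (\<integral>\<^sup>+y. h k y \<partial>N) p"
      using q by (intro mult_left_mono) (auto simp: epow_epow)
    also have "\<dots> = epow (\<integral>\<^sup>+y. ennreal (2 powr (real_of_int k * \<sigma>)) * h k y \<partial>N) p"
      by (simp add: nn_integral_cmult epow_mult powr_powr)
    finally show "ennreal (2 powr (real_of_int k * \<sigma> * p)) * epow (shell_power \<gamma> q (\<lambda>x. \<integral>\<^sup>+y. F x y \<partial>N) k) (p / q)
        \<le> epow (\<integral>\<^sup>+y. ennreal (2 powr (real_of_int k * \<sigma>)) * h k y \<partial>N) p" .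
  qed
  also have "\<dots> \<le> epow (\<integral>\<^sup>+y. H y \<partial>N) p"
  proof (rule nn_integral_Minkowski)
    show "AE y in N. (\<integral>\<^sup>+k. epow (ennreal (2 powr (real_of_int k * \<sigma>)) * h k y) p \<partial>count_space UNIV) \<le> epow (H y) p"
      using le by eventually_elim (use q in \<open>simp add: herz_sum_def h_def epow_mult epow_epow powr_powr\<close>)
    \<comment> \<open>Since there are only countably many shells, joint measurability follows from
      measurability in y for each k.\<close>
    show "(\<lambda>(k, y). ennreal (2 powr (real_of_int k * \<sigma>)) * h k y) \<in> borel_measurable (count_space UNIV \<Otimes>\<^sub>M N)"
      by (rule measurable_pair_measure_countable1) auto
  qed (use N p in \<open>auto intro: sigma_finite_measure_count_space\<close>)
  finally show ?thesis .
qed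

text \<open>Hoelder with weights q/q_i in x on each shell, then with weights p/p_i over the shells;
  both families sum to 1. The conditions on the \<gamma>s and \<sigma>s are exactly what distributes
  |x|^\<gamma> and 2^(k \<sigma> p) over the factors.\<close>

lemma herz_sum_Holder:
  fixes f :: "'i \<Rightarrow> 'a::euclidean_space \<Rightarrow> ennreal"
  assumes I: "finite I" "I \<noteq> {}" and p: "0 < p" and q: "0 < q"
    and ps: "\<And>i. i \<in> I \<Longrightarrow> 0 < ps i" "(\<Sum>i\<in>I. 1 / ps i) = 1 / p"
    and qs: "\<And>i. i \<in> I \<Longrightarrow> 0 < qs i" "(\<Sum>i\<in>I. 1 / qs i) = 1 / q"
    and \<gamma>: "(\<Sum>i\<in>I. \<gamma>s i / qs i) = \<gamma> / q" and \<sigma>: "(\<Sum>i\<in>I. \<sigma>s i) = \<sigma>"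
    and [measurable]: "\<And>i. i \<in> I \<Longrightarrow> f i \<in> borel_measurable borel"
  shows "herz_sum \<sigma> \<gamma> p q (\<lambda>x. \<Prod>i\<in>I. f i x) \<le> (\<Prod>i\<in>I. epow (herz_sum (\<sigma>s i) (\<gamma>s i) (ps i) (qs i) (f i)) (p / ps i))"
proof -
  have pw: "(\<Sum>i\<in>I. p / ps i) = 1" and qw: "(\<Sum>i\<in>I. q / qs i) = 1"
    using ps(2) qs(2) p q sum_distrib_left[of p "\<lambda>i. 1 / ps i" I] sum_distrib_left[of q "\<lambda>i. 1 / qs i" I]
    by auto
  have \<gamma>w: "(\<Sum>i\<in>I. \<gamma>s i * (q / qs i)) = \<gamma>"
    using \<gamma> q sum_distrib_left[of q "\<lambda>i. \<gamma>s i / qs i" I] by (simp add: mult_ac)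
  have inner: "shell_power \<gamma> q (\<lambda>x. \<Prod>i\<in>I. f i x) k \<le> (\<Prod>i\<in>I. epow (shell_power (\<gamma>s i) (qs i) (f i) k) (q / qs i))" for k
  proof -
    have "shell_power \<gamma> q (\<lambda>x. \<Prod>i\<in>I. f i x) k =
      (\<integral>\<^sup>+x. (\<Prod>i\<in>I. epow (indicator (dyadic_shell k) x * (epow (f i x) (qs i) * ennreal (norm x powr \<gamma>s i))) (q / qs i)) \<partial>lborel)"
      unfolding shell_power_def
    proof (intro nn_integral_cong)
      fix x :: 'a
      show "indicator (dyadic_shell k) x * (epow (\<Prod>i\<in>I. f i x) q * ennreal (norm x powr \<gamma>)) =
        (\<Prod>i\<in>I. epow (indicator (dyadic_shell k) x * (epow (f i x) (qs i) * ennreal (norm x powr \<gamma>s i))) (q / qs i))"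
      proof (cases "x \<in> dyadic_shell k")
        case True
        \<comment> \<open>The powers of |x| may be merged into one only for nonzero x, because
          \<open>0 powr 0 = 0\<close>.\<close>
        then have "x \<noteq> 0" by (simp add: mem_dyadic_shell_iff_log)
        have "(\<Prod>i\<in>I. epow (epow (f i x) (qs i) * ennreal (norm x powr \<gamma>s i)) (q / qs i)) =
           (\<Prod>i\<in>I. epow (f i x) q * ennreal (norm x powr (\<gamma>s i * (q / qs i))))"
          using qs(1) by (intro prod.cong refl) (auto simp: epow_mult epow_epow powr_powr less_imp_neq[symmetric])
        also have "\<dots> = epow (\<Prod>i\<in>I. f i x) q * ennreal (norm x powr \<gamma>)"
          using \<open>x \<noteq> 0\<close> I by (simp add: prod.distrib epow_prod prod_ennreal powr_sum[symmetric] \<gamma>w del: times_divide_eq_right)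
        finally show ?thesis using True by simp
      next
        case False
        then show ?thesis using I by (simp add: card_gt_0_iff)
      qed
    qed
    also have "\<dots> \<le> (\<Prod>i\<in>I. epow (shell_power (\<gamma>s i) (qs i) (f i) k) (q / qs i))"
      unfolding shell_power_def using I q qs(1) qw by (intro nn_integral_Holder) auto
    finally show ?thesis .
  qed
  have "herz_sum \<sigma> \<gamma> p q (\<lambda>x. \<Prod>i\<in>I. f i x) \<le>
    (\<integral>\<^sup>+k. (\<Prod>i\<in>I. epow (ennreal (2 powr (real_of_int k * \<sigma>s i * ps i)) * epow (shell_power (\<gamma>s i) (qs i) (f i) k) (ps i / qs i)) (p / ps i)) \<partial>count_space UNIV)"
    unfolding herz_sum_def
  proof (intro nn_integral_mono)
    fix k :: int
    have "epow (shell_power \<gamma> q (\<lambda>x. \<Prod>i\<in>I. f i x) k) (p / q) \<le>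
        epow (\<Prod>i\<in>I. epow (shell_power (\<gamma>s i) (qs i) (f i) k) (q / qs i)) (p / q)"
      using p q by (intro epow_mono inner) auto
    also have "\<dots> = (\<Prod>i\<in>I. epow (shell_power (\<gamma>s i) (qs i) (f i) k) (p / qs i))"
      using q by (simp add: epow_prod epow_epow)
    finally have "ennreal (2 powr (real_of_int k * \<sigma> * p)) * epow (shell_power \<gamma> q (\<lambda>x. \<Prod>i\<in>I. f i x) k) (p / q) \<le>
      ennreal (2 powr (real_of_int k * \<sigma> * p)) * (\<Prod>i\<in>I. epow (shell_power (\<gamma>s i) (qs i) (f i) k) (p / qs i))"
      by (rule mult_left_mono) auto
    moreover have "ennreal (2 powr (real_of_int k * \<sigma> * p)) = (\<Prod>i\<in>I. ennreal (2 powr (real_of_int k * \<sigma>s i * p)))"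
      using I by (simp add: prod_ennreal powr_sum[symmetric] \<sigma>[symmetric] sum_distrib_left sum_distrib_right)
    moreover have "(\<Prod>i\<in>I. ennreal (2 powr (real_of_int k * \<sigma>s i * p))) * (\<Prod>i\<in>I. epow (shell_power (\<gamma>s i) (qs i) (f i) k) (p / qs i)) =
       (\<Prod>i\<in>I. epow (ennreal (2 powr (real_of_int k * \<sigma>s i * ps i)) * epow (shell_power (\<gamma>s i) (qs i) (f i) k) (ps i / qs i)) (p / ps i))"
      unfolding prod.distrib[symmetric] using ps(1)
      by (intro prod.cong refl) (auto simp: epow_mult epow_epow powr_powr less_imp_neq[symmetric] mult.assoc)
    ultimately show "ennreal (2 powr (real_of_int k * \<sigma> * p)) * epow (shell_power \<gamma> q (\<lambda>x. \<Prod>i\<in>I. f i x) k) (p / q) \<le>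
      (\<Prod>i\<in>I. epow (ennreal (2 powr (real_of_int k * \<sigma>s i * ps i)) * epow (shell_power (\<gamma>s i) (qs i) (f i) k) (ps i / qs i)) (p / ps i))"
      by simp
  qed
  also have "\<dots> \<le> (\<Prod>i\<in>I. epow (herz_sum (\<sigma>s i) (\<gamma>s i) (ps i) (qs i) (f i)) (p / ps i))"
    unfolding herz_sum_def using I p ps(1) pw by (intro nn_integral_Holder) auto
  finally show ?thesis .
qed

text \<open>The factors record the losses in composing with one matrix: rounding its inverse norm to
  a power of 2, comparing the weights at x and M x, splitting a shell among R + 2 shells (exponent
  1/q from the power of a sum, 1/p from the number of shifted sums), and shifting the index by at
  most R + 1.\<close>

definition dilation_const :: "real \<Rightarrow> nat \<Rightarrow> real \<Rightarrow> real \<Rightarrow> real \<Rightarrow> real \<Rightarrow> real"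
  where "dilation_const \<rho> R \<sigma> \<gamma> p q = 2 powr \<bar>\<sigma>\<bar> * \<rho> powr (\<bar>\<gamma>\<bar> / q) *
    (real R + 2) powr (1 / q + 1 / p) * 2 powr ((real R + 2) * \<bar>\<sigma>\<bar>)"

lemma dilation_const_pos: "1 \<le> \<rho> \<Longrightarrow> dilation_const \<rho> R \<sigma> \<gamma> p q > 0"
  by (simp add: dilation_const_def)

text \<open>The sum is at most its largest term times the number of terms. This is crude but treats
  exponents on both sides of 1 alike, as needed for p/q.\<close>

lemma epow_sum_le:
  assumes "finite J" "0 \<le> a"
  shows "epow (\<Sum>j\<in>J. f j) a \<le> epow (of_nat (card J)) a * (\<Sum>j\<in>J. epow (f j) a)"
proof (cases "J = {}")
  case False
  define m where "m = Max (f ` J)"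
  have "m \<in> f ` J" unfolding m_def using False assms(1) by (intro Max_in) auto
  then obtain j where j: "j \<in> J" "f j = m" by auto
  have "(\<Sum>j\<in>J. f j) \<le> of_nat (card J) * m"
    using assms(1) by (intro sum_bounded_above) (auto simp: m_def)
  then have "epow (\<Sum>j\<in>J. f j) a \<le> epow (of_nat (card J) * m) a"
    using assms by (intro epow_mono)
  also have "\<dots> = epow (of_nat (card J)) a * epow (f j) a" using j by (simp add: epow_mult)
  also have "\<dots> \<le> epow (of_nat (card J)) a * (\<Sum>j\<in>J. epow (f j) a)"
    using j assms(1) by (intro mult_left_mono member_le_sum) auto
  finally show ?thesis .
qed simp

text \<open>Cauchy-Schwarz row by row: the Frobenius norm dominates the operator norm.\<close>

lemma norm_matrix_vector_mult_le: "norm (A *v x) \<le> norm A * norm (x :: real^'n)" for A :: "real^'n^'m"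
proof -
  have "norm (A *v x) = L2_set (\<lambda>i. \<bar>A $ i \<bullet> x\<bar>) UNIV"
    by (simp add: norm_vec_def matrix_vector_mul_component)
  also have "\<dots> \<le> L2_set (\<lambda>i. norm (A $ i) * norm x) UNIV"
    by (intro L2_set_mono Cauchy_Schwarz_ineq2) auto
  also have "\<dots> = norm A * norm x"
    by (simp add: norm_vec_def L2_set_left_distrib)
  finally show ?thesis .
qed

section \<open>Composition with one invertible matrix\<close>

context
  fixes M :: "real^'n^'n" and \<rho> :: real
  assumes inv: "invertible M" and \<rho>: "norm M * norm (matrix_inv M) \<le> \<rho>" "1 \<le> \<rho>"
begin

lemma matrix_inv_mult: "matrix_inv M *v (M *v x) = x" "M *v (matrix_inv M *v x) = x"
proof -
  have "M ** matrix_inv M = mat 1 \<and> matrix_inv M ** M = mat 1"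
    using inv unfolding invertible_def matrix_inv_def by (rule someI_ex)
  then show "matrix_inv M *v (M *v x) = x" "M *v (matrix_inv M *v x) = x"
    by (simp_all add: matrix_vector_mul_assoc)
qed

lemma norm_matrix_inv_pos: "norm (matrix_inv M) > 0"
proof -
  have "matrix_inv M \<noteq> 0"
    using matrix_inv_mult(1)[of "axis undefined 1"] by (auto simp: axis_eq_0_iff)
  then show ?thesis by simp
qed

lemma norm_le_norm_matrix_vector: "norm x \<le> norm (matrix_inv M) * norm (M *v x)"
  using norm_matrix_vector_mult_le[of "matrix_inv M" "M *v x"] by (simp add: matrix_inv_mult)

lemma norm_matrix_vector_le: "norm (matrix_inv M) * norm (M *v x) \<le> \<rho> * norm x"
proof -
  have "norm (matrix_inv M) * norm (M *v x) \<le> norm (matrix_inv M) * (norm M * norm x)"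
    by (intro mult_left_mono norm_matrix_vector_mult_le) auto
  also have "\<dots> \<le> \<rho> * norm x" using \<rho> by (metis mult.assoc mult.commute mult_right_mono norm_ge_zero)
  finally show ?thesis .
qed

text \<open>Both signs of the exponent are covered by the two comparisons of \<open>norm (M *v x)\<close> with \<open>norm x\<close>.\<close>

lemma norm_powr_matrix_vector:
  assumes "x \<noteq> 0"
  shows "norm x powr a \<le> \<rho> powr \<bar>a\<bar> * norm (matrix_inv M) powr a * norm (M *v x) powr a"
    and "norm (matrix_inv M) powr a * norm (M *v x) powr a \<le> \<rho> powr \<bar>a\<bar> * norm x powr a"
proof -
  let ?r = "norm (matrix_inv M)" and ?z = "norm (M *v x)"
  have pos: "?r * ?z > 0" "norm x > 0"
    using assms norm_le_norm_matrix_vector[of x] zero_less_norm_iff[of x] by linarith+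
  have "norm x powr a \<le> \<rho> powr \<bar>a\<bar> * (?r * ?z) powr a \<and> (?r * ?z) powr a \<le> \<rho> powr \<bar>a\<bar> * norm x powr a"
  proof (cases "0 \<le> a")
    case True
    have 1: "norm x powr a \<le> (?r * ?z) powr a"
      using True norm_le_norm_matrix_vector by (intro powr_mono2) auto
    have "1 \<le> \<rho> powr a" using \<rho> True by (simp add: ge_one_powr_ge_zero)
    then have "(?r * ?z) powr a \<le> \<rho> powr a * (?r * ?z) powr a" by (simp add: mult_le_cancel_right1)
    moreover have "(?r * ?z) powr a \<le> (\<rho> * norm x) powr a"
      using True pos norm_matrix_vector_le by (intro powr_mono2) auto
    ultimately show ?thesis using 1 True \<rho> by (auto simp: powr_mult)
  next
    case False
    have 1: "(?r * ?z) powr a \<le> norm x powr a"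
      using False pos norm_le_norm_matrix_vector by (intro powr_mono2') auto
    have "1 \<le> \<rho> powr (- a)" using \<rho> False by (simp add: ge_one_powr_ge_zero)
    then have 2: "norm x powr a \<le> \<rho> powr (- a) * norm x powr a" by (simp add: mult_le_cancel_right1)
    have "(\<rho> * norm x) powr a \<le> (?r * ?z) powr a"
      using False pos norm_matrix_vector_le by (intro powr_mono2') auto
    then have "\<rho> powr (- a) * (\<rho> powr a * norm x powr a) \<le> \<rho> powr (- a) * (?r * ?z) powr a"
      using \<rho> by (intro mult_left_mono) (auto simp: powr_mult)
    then have "norm x powr a \<le> \<rho> powr (- a) * (?r * ?z) powr a"
      using \<rho> by (simp add: mult.assoc[symmetric] powr_add[symmetric])
    then show ?thesis using 1 2 False by auto
  qed
  then show "norm x powr a \<le> \<rho> powr \<bar>a\<bar> * ?r powr a * ?z powr a"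
    "?r powr a * ?z powr a \<le> \<rho> powr \<bar>a\<bar> * norm x powr a"
    by (simp_all add: powr_mult mult.assoc)
qed

lemma nn_integral_matrix_le:
  assumes [measurable]: "g \<in> borel_measurable borel"
  shows "(\<integral>\<^sup>+x. g (M *v x) \<partial>lborel) \<le> ennreal (norm (matrix_inv M) ^ CARD('n)) * (\<integral>\<^sup>+x. g x \<partial>lborel)"
  using nn_integral_linear_le[of g "(*v) M" "(*v) (matrix_inv M)" "norm (matrix_inv M)"]
  by (simp add: matrix_inv_mult norm_matrix_vector_mult_le)

text \<open>With 2^l the power of 2 next above ||M^(-1)||, the image of shell k lies in the shells
  of index k - l to k - l + R + 1. Changing variables costs ||M^(-1)||^n, and comparing the weights
  at x and M x costs \<rho>^|\<gamma>| ||M^(-1)||^\<gamma>.\<close>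

lemma shell_power_dilation:
  assumes [measurable]: "g \<in> borel_measurable borel"
    and l: "l = \<lceil>log 2 (norm (matrix_inv M))\<rceil>" and R: "\<rho> \<le> 2 ^ R"
  shows "shell_power \<gamma> q (\<lambda>x. g (M *v x)) k \<le>
    ennreal (\<rho> powr \<bar>\<gamma>\<bar> * norm (matrix_inv M) powr (real CARD('n) + \<gamma>)) *
      (\<Sum>j\<in>{..Suc R}. shell_power \<gamma> q g (k - l + int j))"
proof -
  let ?r = "norm (matrix_inv M)"
  note rpos = norm_matrix_inv_pos
  have lr: "2 powr (real_of_int l - 1) < ?r" "?r \<le> 2 powr real_of_int l"
    using rpos l by (simp_all add: less_log_iff[symmetric] log_le_iff[symmetric]) linarith
  have mv [measurable]: "(*v) M \<in> borel_measurable borel"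
    by (intro borel_measurable_continuous_onI linear_continuous_on) (simp add: matrix_vector_mul_bounded_linear)
  define h where "h z = (\<Sum>j\<in>{..Suc R}. indicator (dyadic_shell (k - l + int j)) z * (epow (g z) q * ennreal (norm z powr \<gamma>)))" for z
  have [measurable]: "h \<in> borel_measurable borel" unfolding h_def by measurable
  have "shell_power \<gamma> q (\<lambda>x. g (M *v x)) k \<le> (\<integral>\<^sup>+x. ennreal (\<rho> powr \<bar>\<gamma>\<bar> * ?r powr \<gamma>) * h (M *v x) \<partial>lborel)"
    unfolding shell_power_def
  proof (intro nn_integral_mono)
    fix x :: "real^'n"
    let ?z = "M *v x"
    show "indicator (dyadic_shell k) x * (epow (g ?z) q * ennreal (norm x powr \<gamma>)) \<le> ennreal (\<rho> powr \<bar>\<gamma>\<bar> * ?r powr \<gamma>) * h ?z"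
    proof (cases "x \<in> dyadic_shell k")
      case True
      then have x: "x \<noteq> 0" "2 powr (real_of_int k - 1) < norm x" "norm x \<le> 2 powr real_of_int k"
        by (auto simp: mem_dyadic_shell_iff_log) (use True in \<open>auto simp: mem_dyadic_shell\<close>)
      have z: "norm ?z > 0" using x(1) matrix_inv_mult(1)[of x] by auto
      \<comment> \<open>Lower index: |x| <= ||M^(-1)|| |M x| and ||M^(-1)|| <= 2^l give |M x| >
        2^(k-l-1).\<close>
      have "2 powr (real_of_int k - 1) < 2 powr real_of_int l * norm ?z"
        using x(2) norm_le_norm_matrix_vector[of x] mult_right_mono[OF lr(2), of "norm ?z"] by auto
      also have "2 powr (real_of_int k - 1) = 2 powr real_of_int l * 2 powr (real_of_int (k - l) - 1)"
        by (simp add: powr_add[symmetric])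
      finally have lo: "2 powr (real_of_int (k - l) - 1) < norm ?z"
        by (simp add: mult_less_cancel_left_pos)
      \<comment> \<open>Upper index: ||M^(-1)|| |M x| <= \<rho> |x| and ||M^(-1)|| > 2^(l-1) give |M
        x| < 2^(k-l+R+1); the extra 1 is the rounding in l.\<close>
      have "2 powr (real_of_int l - 1) * norm ?z < ?r * norm ?z"
        using lr(1) z by simp
      also have "\<dots> \<le> \<rho> * norm x" by (rule norm_matrix_vector_le)
      also have "\<dots> \<le> 2 powr real R * 2 powr real_of_int k"
        using R x(3) \<rho> by (intro mult_mono) (auto simp: powr_realpow)
      also have "\<dots> = 2 powr (real_of_int l - 1) * 2 powr real_of_int (k - l + int (Suc R))"
        by (simp add: powr_add[symmetric] add.commute)
      finally have hi: "norm ?z < 2 powr real_of_int (k - l + int (Suc R))"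
        by (rule mult_left_less_imp_less) simp
      define j where "j = \<lceil>log 2 (norm ?z)\<rceil>"
      have "real_of_int (k - l) - 1 < log 2 (norm ?z)" "log 2 (norm ?z) < real_of_int (k - l + int (Suc R))"
        using lo hi z by (simp_all add: less_log_iff log_less_iff)
      then have "k - l \<le> j" "j \<le> k - l + int (Suc R)" unfolding j_def by linarith+
      then have j: "nat (j - (k - l)) \<in> {..Suc R}" "k - l + int (nat (j - (k - l))) = j" by auto
      have "?z \<in> dyadic_shell j" using z by (simp add: mem_dyadic_shell_iff_log j_def)
      then have "epow (g ?z) q * ennreal (norm ?z powr \<gamma>) =
         (\<Sum>i\<in>{nat (j - (k - l))}. indicator (dyadic_shell (k - l + int i)) ?z * (epow (g ?z) q * ennreal (norm ?z powr \<gamma>)))"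
        using j(2) by simp
      also have "\<dots> \<le> h ?z" unfolding h_def using j(1) by (intro sum_mono2) auto
      finally have h: "epow (g ?z) q * ennreal (norm ?z powr \<gamma>) \<le> h ?z" .
      have "indicator (dyadic_shell k) x * (epow (g ?z) q * ennreal (norm x powr \<gamma>)) \<le>
          epow (g ?z) q * ennreal (\<rho> powr \<bar>\<gamma>\<bar> * ?r powr \<gamma> * norm ?z powr \<gamma>)"
        using True by (simp add: mult_left_mono ennreal_leI norm_powr_matrix_vector(1)[OF x(1)])
      also have "\<dots> = ennreal (\<rho> powr \<bar>\<gamma>\<bar> * ?r powr \<gamma>) * (epow (g ?z) q * ennreal (norm ?z powr \<gamma>))"
        by (simp add: ennreal_mult mult_ac)
      also have "\<dots> \<le> ennreal (\<rho> powr \<bar>\<gamma>\<bar> * ?r powr \<gamma>) * h ?z"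
        using h by (rule mult_left_mono) auto
      finally show ?thesis .
    qed simp
  qed
  also have "\<dots> = ennreal (\<rho> powr \<bar>\<gamma>\<bar> * ?r powr \<gamma>) * (\<integral>\<^sup>+x. h (M *v x) \<partial>lborel)"
    by (rule nn_integral_cmult) measurable
  also have "\<dots> \<le> ennreal (\<rho> powr \<bar>\<gamma>\<bar> * ?r powr \<gamma>) * (ennreal (?r ^ CARD('n)) * (\<integral>\<^sup>+x. h x \<partial>lborel))"
    by (intro mult_left_mono nn_integral_matrix_le) auto
  also have "(\<integral>\<^sup>+x. h x \<partial>lborel) = (\<Sum>j\<in>{..Suc R}. shell_power \<gamma> q g (k - l + int j))"
    unfolding h_def shell_power_def by (rule nn_integral_sum) measurable
  also have "ennreal (\<rho> powr \<bar>\<gamma>\<bar> * ?r powr \<gamma>) * (ennreal (?r ^ CARD('n)) * \<dots>) =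
     ennreal (\<rho> powr \<bar>\<gamma>\<bar> * ?r powr (real CARD('n) + \<gamma>)) * \<dots>"
  proof -
    have "\<rho> powr \<bar>\<gamma>\<bar> * ?r powr (real CARD('n) + \<gamma>) = \<rho> powr \<bar>\<gamma>\<bar> * ?r powr \<gamma> * ?r ^ CARD('n)"
      using rpos by (simp add: powr_add powr_realpow)
    then show ?thesis by (simp only: ennreal_mult mult.assoc powr_ge_zero zero_le_power norm_ge_zero mult_nonneg_nonneg)
  qed
  finally show ?thesis .
qed

text \<open>Summing the shell estimate over k yields R + 2 shifted copies of the Herz sum of g. Each
  shift by l - j moves the weight by 2^((l-j) \<sigma> p), comparable with ||M^(-1)||^(\<sigma> p);
  together with the (n + \<gamma>)/q from each shell this produces the exponent in \<C>_2.\<close>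

lemma herz_sum_dilation:
  assumes [measurable]: "g \<in> borel_measurable borel" and R: "\<rho> \<le> 2 ^ R" and p: "0 < p" and q: "0 < q"
  shows "herz_sum \<sigma> \<gamma> p q (\<lambda>x. g (M *v x)) \<le>
    ennreal ((dilation_const \<rho> R \<sigma> \<gamma> p q *
      norm (matrix_inv M) powr (\<sigma> + (real CARD('n) + \<gamma>) / q)) powr p) * herz_sum \<sigma> \<gamma> p q g"
proof -
  let ?r = "norm (matrix_inv M)"
  define l where "l = \<lceil>log 2 ?r\<rceil>"
  define c where "c = \<rho> powr \<bar>\<gamma>\<bar> * ?r powr (real CARD('n) + \<gamma>)"
  define J where "J = real R + 2"
  let ?S = "shell_power \<gamma> q g"
  let ?t = "\<lambda>k. ennreal (2 powr (real_of_int k * \<sigma> * p)) * epow (?S k) (p / q)"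
  note rpos = norm_matrix_inv_pos
  have lr: "2 powr (real_of_int l - 1) < ?r" "?r \<le> 2 powr real_of_int l"
    using rpos by (simp_all add: l_def less_log_iff[symmetric] log_le_iff[symmetric]) linarith
  have cJ: "c \<ge> 0" "J > 0" using \<rho> by (auto simp: c_def J_def)
  \<comment> \<open>The sign of \<sigma> decides which half of 2^(l-1) < ||M^(-1)|| <= 2^l is used;
    only for nonnegative \<sigma> does the rounding cost the factor 2^|\<sigma>|.\<close>
  have l2: "2 powr (real_of_int l * \<sigma>) \<le> 2 powr \<bar>\<sigma>\<bar> * ?r powr \<sigma>"
  proof (cases "0 \<le> \<sigma>")
    case True
    have "(2 powr (real_of_int l - 1)) powr \<sigma> \<le> ?r powr \<sigma>"
      using True lr by (intro powr_mono2) auto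
    then have "2 powr \<sigma> * (2 powr (real_of_int l - 1)) powr \<sigma> \<le> 2 powr \<sigma> * ?r powr \<sigma>" by simp
    then show ?thesis using True by (simp add: powr_powr powr_add[symmetric] algebra_simps)
  next
    case False
    have "(2 powr real_of_int l) powr \<sigma> \<le> ?r powr \<sigma>"
      using False lr rpos by (intro powr_mono2') auto
    also have "\<dots> \<le> 2 powr \<bar>\<sigma>\<bar> * ?r powr \<sigma>"
      using ge_one_powr_ge_zero[of 2 "\<bar>\<sigma>\<bar>"] by (simp add: mult_le_cancel_right1)
    finally show ?thesis by (simp add: powr_powr)
  qed
  have shift: "2 powr ((real_of_int l - real j) * \<sigma> * p) \<le> (2 powr \<bar>\<sigma>\<bar> * ?r powr \<sigma> * 2 powr (J * \<bar>\<sigma>\<bar>)) powr p"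
    if "j \<in> {..Suc R}" for j
  proof -
    have "- real j * \<sigma> \<le> \<bar>real j * \<sigma>\<bar>" by simp
    also have "\<dots> \<le> J * \<bar>\<sigma>\<bar>" using that unfolding abs_mult by (intro mult_right_mono) (auto simp: J_def)
    finally have "2 powr (- real j * \<sigma>) \<le> 2 powr (J * \<bar>\<sigma>\<bar>)" by simp
    then have "2 powr (real_of_int l * \<sigma>) * 2 powr (- real j * \<sigma>) \<le> 2 powr \<bar>\<sigma>\<bar> * ?r powr \<sigma> * 2 powr (J * \<bar>\<sigma>\<bar>)"
      using l2 by (intro mult_mono) auto
    then have "(2 powr (real_of_int l * \<sigma>) * 2 powr (- real j * \<sigma>)) powr p \<le> (2 powr \<bar>\<sigma>\<bar> * ?r powr \<sigma> * 2 powr (J * \<bar>\<sigma>\<bar>)) powr p"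
      using p by (intro powr_mono2) auto
    then show ?thesis by (simp add: powr_powr powr_add[symmetric] algebra_simps)
  qed
  have "herz_sum \<sigma> \<gamma> p q (\<lambda>x. g (M *v x)) \<le>
    (\<integral>\<^sup>+k. ennreal (c powr (p / q) * J powr (p / q)) *
       (\<Sum>j\<in>{..Suc R}. ennreal (2 powr ((real_of_int l - real j) * \<sigma> * p)) * ?t (k - l + int j)) \<partial>count_space UNIV)"
    unfolding herz_sum_def
  proof (intro nn_integral_mono)
    fix k :: int
    have "epow (shell_power \<gamma> q (\<lambda>x. g (M *v x)) k) (p / q) \<le> epow (ennreal c * (\<Sum>j\<in>{..Suc R}. ?S (k - l + int j))) (p / q)"
      using p q unfolding c_def by (intro epow_mono shell_power_dilation R l_def) auto
    also have "\<dots> \<le> ennreal (c powr (p / q)) * (epow (of_nat (card {..Suc R})) (p / q) * (\<Sum>j\<in>{..Suc R}. epow (?S (k - l + int j)) (p / q)))"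
      using cJ p q by (simp only: epow_mult epow_ennreal) (intro mult_left_mono epow_sum_le, auto)
    also have "(of_nat (card {..Suc R}) :: ennreal) = ennreal J"
      by (simp only: ennreal_of_nat_eq_real_of_nat) (simp add: J_def)
    also have "ennreal (c powr (p / q)) * (epow (ennreal J) (p / q) * (\<Sum>j\<in>{..Suc R}. epow (?S (k - l + int j)) (p / q))) =
       ennreal (c powr (p / q) * J powr (p / q)) * (\<Sum>j\<in>{..Suc R}. epow (?S (k - l + int j)) (p / q))"
      using cJ by (simp add: ennreal_mult mult.assoc)
    finally have "ennreal (2 powr (real_of_int k * \<sigma> * p)) * epow (shell_power \<gamma> q (\<lambda>x. g (M *v x)) k) (p / q) \<le>
      ennreal (2 powr (real_of_int k * \<sigma> * p)) *
        (ennreal (c powr (p / q) * J powr (p / q)) * (\<Sum>j\<in>{..Suc R}. epow (?S (k - l + int j)) (p / q)))"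
      by (rule mult_left_mono) auto
    also have "\<dots> = ennreal (c powr (p / q) * J powr (p / q)) *
        (\<Sum>j\<in>{..Suc R}. ennreal (2 powr (real_of_int k * \<sigma> * p)) * epow (?S (k - l + int j)) (p / q))"
      unfolding sum_distrib_left by (simp only: mult_ac)
    also have "(\<Sum>j\<in>{..Suc R}. ennreal (2 powr (real_of_int k * \<sigma> * p)) * epow (?S (k - l + int j)) (p / q)) =
        (\<Sum>j\<in>{..Suc R}. ennreal (2 powr ((real_of_int l - real j) * \<sigma> * p)) * ?t (k - l + int j))"
    proof (intro sum.cong refl)
      fix j
      have "2 powr (real_of_int k * \<sigma> * p) =
          2 powr ((real_of_int l - real j) * \<sigma> * p) * 2 powr (real_of_int (k - l + int j) * \<sigma> * p)"
        by (simp add: powr_add[symmetric] algebra_simps)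
      then show "ennreal (2 powr (real_of_int k * \<sigma> * p)) * epow (?S (k - l + int j)) (p / q) =
          ennreal (2 powr ((real_of_int l - real j) * \<sigma> * p)) * ?t (k - l + int j)"
        by (simp add: ennreal_mult mult.assoc)
    qed
    finally show "ennreal (2 powr (real_of_int k * \<sigma> * p)) * epow (shell_power \<gamma> q (\<lambda>x. g (M *v x)) k) (p / q) \<le>
       ennreal (c powr (p / q) * J powr (p / q)) *
       (\<Sum>j\<in>{..Suc R}. ennreal (2 powr ((real_of_int l - real j) * \<sigma> * p)) * ?t (k - l + int j))" .
  qed
  also have "\<dots> = ennreal (c powr (p / q) * J powr (p / q)) *
      (\<Sum>j\<in>{..Suc R}. ennreal (2 powr ((real_of_int l - real j) * \<sigma> * p)) * (\<integral>\<^sup>+k. ?t (k - l + int j) \<partial>count_space UNIV))"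
    by (subst nn_integral_cmult, simp, subst nn_integral_sum, simp, subst nn_integral_cmult, simp_all)
  \<comment> \<open>A shift is a bijection of the integers, so every shifted sum equals the full
    Herz sum of g.\<close>
  also have "(\<lambda>j. \<integral>\<^sup>+k. ?t (k - l + int j) \<partial>count_space UNIV) = (\<lambda>j. herz_sum \<sigma> \<gamma> p q g)"
  proof
    fix j
    have "bij (\<lambda>k. k - l + int j)"
      by (rule bij_betw_byWitness[where f'="\<lambda>k. k + l - int j"]) auto
    from nn_integral_bij_count_space[OF this, of ?t]
    show "(\<integral>\<^sup>+k. ?t (k - l + int j) \<partial>count_space UNIV) = herz_sum \<sigma> \<gamma> p q g"
      by (simp add: herz_sum_def)
  qed
  also have "ennreal (c powr (p / q) * J powr (p / q)) *
      (\<Sum>j\<in>{..Suc R}. ennreal (2 powr ((real_of_int l - real j) * \<sigma> * p)) * herz_sum \<sigma> \<gamma> p q g) \<le>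
      ennreal (c powr (p / q) * J powr (p / q)) *
      (\<Sum>j\<in>{..Suc R}. ennreal ((2 powr \<bar>\<sigma>\<bar> * ?r powr \<sigma> * 2 powr (J * \<bar>\<sigma>\<bar>)) powr p) * herz_sum \<sigma> \<gamma> p q g)"
    by (intro mult_left_mono sum_mono mult_right_mono ennreal_leI shift) auto
  also have "\<dots> = ennreal (c powr (p / q) * J powr (p / q)) * (ennreal J *
      (ennreal ((2 powr \<bar>\<sigma>\<bar> * ?r powr \<sigma> * 2 powr (J * \<bar>\<sigma>\<bar>)) powr p) * herz_sum \<sigma> \<gamma> p q g))"
    by (simp only: sum_constant ennreal_of_nat_eq_real_of_nat) (simp add: J_def add.commute)
  also have "\<dots> = ennreal (c powr (p / q) * J powr (p / q) * J * (2 powr \<bar>\<sigma>\<bar> * ?r powr \<sigma> * 2 powr (J * \<bar>\<sigma>\<bar>)) powr p)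
      * herz_sum \<sigma> \<gamma> p q g"
    using cJ by (simp add: ennreal_mult mult.assoc)
  also have "c powr (p / q) * J powr (p / q) * J * (2 powr \<bar>\<sigma>\<bar> * ?r powr \<sigma> * 2 powr (J * \<bar>\<sigma>\<bar>)) powr p =
    (2 powr \<bar>\<sigma>\<bar> * \<rho> powr (\<bar>\<gamma>\<bar> / q) * J powr (1 / q + 1 / p) * 2 powr (J * \<bar>\<sigma>\<bar>) *
      ?r powr (\<sigma> + (real CARD('n) + \<gamma>) / q)) powr p"
    using cJ p \<rho> by (simp add: c_def powr_mult powr_powr powr_add add_divide_distrib algebra_simps)
  finally show ?thesis by (simp add: J_def dilation_const_def)
qed

end

section \<open>Boundedness of the Hausdorff operator\<close>

lemma herz_sum_cmult:
  assumes [measurable]: "f \<in> borel_measurable borel" and "0 < q"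
  shows "herz_sum \<sigma> \<gamma> p q (\<lambda>x. c * f x) = epow c p * herz_sum \<sigma> \<gamma> p q f"
proof -
  have "shell_power \<gamma> q (\<lambda>x. c * f x) k = epow c q * shell_power \<gamma> q f k" for k
    unfolding shell_power_def
    by (subst nn_integral_cmult[symmetric]) (auto simp: epow_mult mult_ac)
  then show ?thesis
    unfolding herz_sum_def using \<open>0 < q\<close>
    by (subst nn_integral_cmult[symmetric]) (auto simp: epow_mult epow_epow mult_ac)
qed

text \<open>Countably many shells cover everything but the origin. This is how a norm estimate for
  the integral of absolute values shows that the operator is defined almost everywhere.\<close>

lemma herz_sum_finite_AE:
  assumes fin: "herz_sum \<sigma> \<gamma> p q G < top" and [measurable]: "G \<in> borel_measurable borel"
  shows "AE x in lborel. G x < top"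
proof -
  have "AE x in lborel. x \<in> dyadic_shell k \<longrightarrow> G x < top" for k
  proof -
    have "AE x in lborel. indicator (dyadic_shell k) x * (epow (G x) q * ennreal (norm x powr \<gamma>)) \<noteq> \<infinity>"
      by (rule nn_integral_PInf_AE) (use shell_power_finite[OF fin, of k] in \<open>auto simp: shell_power_def\<close>)
    then show ?thesis
      by eventually_elim (auto simp: mem_dyadic_shell_iff_log ennreal_mult_less_top less_top[symmetric] split: split_indicator_asm)
  qed
  then have "AE x in lborel. \<forall>k. x \<in> dyadic_shell k \<longrightarrow> G x < top"
    unfolding AE_all_countable by blast
  moreover have "AE x in lborel. x \<noteq> (0::'a)" by (rule AE_lborel_singleton)
  ultimately show ?thesis by eventually_elim (auto simp: mem_dyadic_shell_iff_log)
qed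

lemma borel_measurable_matrix_vector_mult [measurable (raw)]:
  fixes f :: "'c \<Rightarrow> real^'n^'m" and g :: "'c \<Rightarrow> real^'n"
  assumes "f \<in> borel_measurable N" "g \<in> borel_measurable N"
  shows "(\<lambda>z. f z *v g z) \<in> borel_measurable N"
proof (rule borel_measurable_continuous_Pair[OF assms])
  show "continuous_on UNIV (\<lambda>x::(real^'n^'m) \<times> (real^'n). fst x *v snd x)"
    unfolding matrix_vector_mult_def by (intro continuous_intros)
qed

text \<open>For almost every y, Hoelder and the dilation estimate bound the Herz sum of the slice,
  and Minkowski integrates these bounds. All data are Borel, with \<phi> in the role of |\<Phi>(y)|
  / |y|^n; \<open>r i\<close> is a separate function because ||B_i^(-1)|| itself is only matched
  almost everywhere.\<close>

lemma hausdorff_majorant: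
  fixes \<phi> :: "real^'n \<Rightarrow> ennreal" and B :: "nat \<Rightarrow> real^'n \<Rightarrow> real^'n^'n"
    and g :: "nat \<Rightarrow> real^'n \<Rightarrow> ennreal" and r :: "nat \<Rightarrow> real^'n \<Rightarrow> real"
  assumes I: "finite I" "I \<noteq> {}" and p: "1 \<le> p" and q: "1 \<le> q"
    and ps: "\<And>i. i \<in> I \<Longrightarrow> 1 \<le> ps i" "(\<Sum>i\<in>I. 1 / ps i) = 1 / p"
    and qs: "\<And>i. i \<in> I \<Longrightarrow> 1 \<le> qs i" "(\<Sum>i\<in>I. 1 / qs i) = 1 / q"
    and \<gamma>: "(\<Sum>i\<in>I. \<gamma>s i / qs i) = \<gamma> / q" and \<sigma>: "(\<Sum>i\<in>I. \<sigma>s i) = \<sigma>"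
    and [measurable]: "\<phi> \<in> borel_measurable borel" "\<And>i. i \<in> I \<Longrightarrow> B i \<in> borel_measurable borel"
      "\<And>i. i \<in> I \<Longrightarrow> g i \<in> borel_measurable borel" "\<And>i. i \<in> I \<Longrightarrow> r i \<in> borel_measurable borel"
    and \<rho>: "1 \<le> \<rho>" "\<rho> \<le> 2 ^ R"
    and good: "AE y in lborel. \<forall>i\<in>I. invertible (B i y) \<and> norm (B i y) * norm (matrix_inv (B i y)) \<le> \<rho> \<and>
      norm (matrix_inv (B i y)) = r i y"
  shows "herz_sum \<sigma> \<gamma> p q (\<lambda>x. \<integral>\<^sup>+y. \<phi> y * (\<Prod>i\<in>I. g i (B i y *v x)) \<partial>lborel) \<le>
    epow (ennreal (\<Prod>i\<in>I. dilation_const \<rho> R (\<sigma>s i) (\<gamma>s i) (ps i) (qs i)) *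
      (\<integral>\<^sup>+y. \<phi> y * ennreal (\<Prod>i\<in>I. r i y powr (\<sigma>s i + (real CARD('n) + \<gamma>s i) / qs i)) \<partial>lborel) *
      (\<Prod>i\<in>I. epow (herz_sum (\<sigma>s i) (\<gamma>s i) (ps i) (qs i) (g i)) (1 / ps i))) p"
proof -
  define N where "N i = herz_sum (\<sigma>s i) (\<gamma>s i) (ps i) (qs i) (g i)" for i
  define K where "K i = dilation_const \<rho> R (\<sigma>s i) (\<gamma>s i) (ps i) (qs i)" for i
  define e where "e i = \<sigma>s i + (real CARD('n) + \<gamma>s i) / qs i" for i
  have Kpos: "K i > 0" for i unfolding K_def by (rule dilation_const_pos) fact
  have pos: "0 < p" "0 < q" "\<And>i. i \<in> I \<Longrightarrow> 0 < ps i" "\<And>i. i \<in> I \<Longrightarrow> 0 < qs i"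
    using p q ps(1) qs(1) by force+
  define H where "H y = ennreal (\<Prod>i\<in>I. K i) * (\<phi> y * ennreal (\<Prod>i\<in>I. r i y powr e i)) * (\<Prod>i\<in>I. epow (N i) (1 / ps i))" for y
  have [measurable]: "H \<in> borel_measurable borel" unfolding H_def by measurable
  have "herz_sum \<sigma> \<gamma> p q (\<lambda>x. \<integral>\<^sup>+y. \<phi> y * (\<Prod>i\<in>I. g i (B i y *v x)) \<partial>lborel) \<le> epow (\<integral>\<^sup>+y. H y \<partial>lborel) p"
  proof (rule herz_sum_Minkowski)
    show "AE y in lborel. herz_sum \<sigma> \<gamma> p q (\<lambda>x. \<phi> y * (\<Prod>i\<in>I. g i (B i y *v x))) \<le> epow (H y) p"
      using good
    proof eventually_elim
      case (elim y)
      have "herz_sum \<sigma> \<gamma> p q (\<lambda>x. \<phi> y * (\<Prod>i\<in>I. g i (B i y *v x))) =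
          epow (\<phi> y) p * herz_sum \<sigma> \<gamma> p q (\<lambda>x. (\<Prod>i\<in>I. g i (B i y *v x)))"
        using pos by (intro herz_sum_cmult) measurable
      also have "\<dots> \<le> epow (\<phi> y) p * (\<Prod>i\<in>I. epow (herz_sum (\<sigma>s i) (\<gamma>s i) (ps i) (qs i) (\<lambda>x. g i (B i y *v x))) (p / ps i))"
        using pos I ps(2) qs(2) \<gamma> \<sigma> by (intro mult_left_mono herz_sum_Holder) auto
      also have "\<dots> \<le> epow (\<phi> y) p * (\<Prod>i\<in>I. epow (ennreal ((K i * r i y powr e i) powr ps i) * N i) (p / ps i))"
      proof (intro mult_left_mono prod_mono_ennreal epow_mono)
        fix i assume i: "i \<in> I"
        show "herz_sum (\<sigma>s i) (\<gamma>s i) (ps i) (qs i) (\<lambda>x. g i (B i y *v x)) \<le> ennreal ((K i * r i y powr e i) powr ps i) * N i"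
        proof -
          have "invertible (B i y)" "norm (B i y) * norm (matrix_inv (B i y)) \<le> \<rho>" "norm (matrix_inv (B i y)) = r i y"
            using elim i by auto
          with herz_sum_dilation[of "B i y" \<rho> "g i" R "ps i" "qs i" "\<sigma>s i" "\<gamma>s i"] i pos \<rho>
          show ?thesis by (simp add: K_def e_def N_def)
        qed
      qed (use pos in \<open>auto simp: less_imp_le\<close>)
      also have "(\<Prod>i\<in>I. epow (ennreal ((K i * r i y powr e i) powr ps i) * N i) (p / ps i)) =
          (\<Prod>i\<in>I. epow (ennreal (K i) * ennreal (r i y powr e i) * epow (N i) (1 / ps i)) p)"
        using pos Kpos less_imp_le[OF Kpos]
        by (intro prod.cong refl)
           (auto simp: epow_mult epow_epow powr_powr powr_mult ennreal_mult less_imp_neq[symmetric])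
      also have "epow (\<phi> y) p * \<dots> = epow (H y) p"
        using less_imp_le[OF Kpos]
        by (simp add: H_def epow_prod[symmetric] epow_mult[symmetric] prod.distrib prod_ennreal mult_ac)
      finally show ?case .
    qed
    show "(\<lambda>(x, y). \<phi> y * (\<Prod>i\<in>I. g i (B i y *v x))) \<in> borel_measurable (borel \<Otimes>\<^sub>M lborel)"
      by measurable
  qed (use p q in \<open>auto intro: lborel.sigma_finite_measure_axioms\<close>)
  also have "(\<integral>\<^sup>+y. H y \<partial>lborel) = ennreal (\<Prod>i\<in>I. K i) * (\<integral>\<^sup>+y. \<phi> y * ennreal (\<Prod>i\<in>I. r i y powr e i) \<partial>lborel) *
      (\<Prod>i\<in>I. epow (N i) (1 / ps i))"
    unfolding H_def by (subst nn_integral_multc, measurable, subst nn_integral_cmult) auto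
  finally show ?thesis by (simp add: K_def e_def N_def)
qed

text \<open>Coordinatewise reduction to real functions. Composites such as f_i(A_i(y) x) are readily
  seen to be jointly measurable for Borel data, which is why representatives are chosen.\<close>

lemma lebesgue_measurable_ex_borel:
  fixes f :: "'a::euclidean_space \<Rightarrow> 'b::euclidean_space"
  assumes [measurable]: "f \<in> borel_measurable lebesgue"
  obtains g where "g \<in> borel_measurable borel" "AE x in lborel. f x = g x"
proof -
  have "\<forall>b. \<exists>h. h \<in> borel_measurable lborel \<and> (AE x in lborel. f x \<bullet> b = h x)"
  proof
    fix b
    have "(\<lambda>x. f x \<bullet> b) \<in> borel_measurable lebesgue" by measurable
    from completion_ex_borel_measurable_real[OF this]
    show "\<exists>h. h \<in> borel_measurable lborel \<and> (AE x in lborel. f x \<bullet> b = h x)" by blast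
  qed
  from choice[OF this] obtain h
    where h: "\<forall>b. h b \<in> borel_measurable lborel \<and> (AE x in lborel. f x \<bullet> b = h b x)" by (elim exE)
  show thesis
  proof (rule that)
    show "(\<lambda>x. \<Sum>b\<in>Basis. h b x *\<^sub>R b) \<in> borel_measurable borel"
      using h by (intro borel_measurable_sum borel_measurable_scaleR) simp_all
    have "AE x in lborel. \<forall>b\<in>Basis. f x \<bullet> b = h b x"
      using h by (intro AE_finite_allI) simp_all
    then show "AE x in lborel. f x = (\<Sum>b\<in>Basis. h b x *\<^sub>R b)"
    proof eventually_elim
      case (elim x)
      then have "(\<Sum>b\<in>Basis. h b x *\<^sub>R b) = (\<Sum>b\<in>Basis. (f x \<bullet> b) *\<^sub>R b)" by simp
      then show ?case by (simp add: euclidean_representation)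
    qed
  qed
qed

lemma lebesgue_measurable_AE_cong:
  fixes f g :: "'a::euclidean_space \<Rightarrow> 'b::euclidean_space"
  assumes "f \<in> borel_measurable lebesgue" "AE x in lborel. f x = g x"
  shows "g \<in> borel_measurable lebesgue"
  using assms(1) by (rule borel_measurable_AE) (use assms(2) in \<open>simp add: AE_completion_iff\<close>)

text \<open>The essential supremum of a nonmeasurable function is \<open>top\<close>; hence a finite
  \<open>rho\<close> forces ||A_i|| ||A_i^(-1)|| to be measurable. Division by ||A_i||, nonzero
  almost everywhere, recovers ||A_i^(-1)||.\<close>

lemma rho_finite:
  fixes A :: "nat \<Rightarrow> real^'n \<Rightarrow> real^'n^'n"
  assumes inv: "ae_invertible_family m A" and rho: "rho m A < \<infinity>" and i: "i \<in> {1..m}"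
  shows "(\<lambda>y. norm (matrix_inv (A i y))) \<in> borel_measurable lebesgue"
    and "AE y in lborel. norm (A i y) * norm (matrix_inv (A i y)) \<le> enn2real (rho m A)"
proof -
  define h where "h y = ennreal (norm (A i y) * norm (matrix_inv (A i y)))" for y
  have le: "esssup lebesgue h \<le> rho m A"
    unfolding rho_def h_def using i by (intro SUP_upper)
  then have "esssup lebesgue h \<noteq> top" using rho by (auto simp: top_unique)
  then have h [measurable]: "h \<in> borel_measurable lebesgue" using esssup_non_measurable by blast
  have Am [measurable]: "A i \<in> borel_measurable lebesgue" and Ai: "AE y in lebesgue. invertible (A i y)"
    using inv i by (auto simp: ae_invertible_family_def)
  have "AE y in lborel. enn2real (h y) / norm (A i y) = norm (matrix_inv (A i y))"
    using Ai unfolding AE_completion_iff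
  proof eventually_elim
    case (elim y)
    then obtain A' where "A i y ** A' = mat 1" by (auto simp: invertible_def)
    moreover have "mat 1 \<noteq> (0 :: real^'n^'n)" by (auto simp: vec_eq_iff mat_def)
    ultimately have "A i y \<noteq> 0" by auto
    then show ?case by (simp add: h_def)
  qed
  then show "(\<lambda>y. norm (matrix_inv (A i y))) \<in> borel_measurable lebesgue"
    by (rule lebesgue_measurable_AE_cong[rotated]) measurable
  have "AE y in lborel. h y \<le> esssup lebesgue h"
    using esssup_AE[of h lebesgue] by (simp add: AE_completion_iff)
  then show "AE y in lborel. norm (A i y) * norm (matrix_inv (A i y)) \<le> enn2real (rho m A)"
  proof eventually_elim
    case (elim y)
    then have "h y \<le> rho m A" using le by (rule order_trans)
    then show ?case using rho by (cases "rho m A") (auto simp: h_def)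
  qed
qed

lemma locally_integrable_measurable:
  fixes f :: "'a::euclidean_space \<Rightarrow> 'b::{banach,second_countable_topology}"
  assumes "locally_integrable f"
  shows "f \<in> borel_measurable lebesgue"
proof (rule borel_measurable_LIMSEQ_metric)
  fix n :: nat
  have "set_integrable lebesgue (cball 0 (real n)) f"
    using assms by (simp add: locally_integrable_def)
  then show "(\<lambda>x. indicator (cball 0 (real n)) x *\<^sub>R f x) \<in> borel_measurable lebesgue"
    by (simp add: set_integrable_def borel_measurable_integrable)
next
  fix x :: 'a
  have "\<forall>\<^sub>F n in sequentially. indicator (cball 0 (real n)) x *\<^sub>R f x = f x"
    using eventually_ge_at_top[of "nat \<lceil>norm x\<rceil>"]
    by eventually_elim (auto simp: indicator_def nat_le_iff ceiling_le_iff)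
  then show "(\<lambda>n. indicator (cball 0 (real n)) x *\<^sub>R f x) \<longlonglongrightarrow> f x"
    by (rule tendsto_eventually)
qed

text \<open>The substitution inequality applied to the indicator of N. For a single matrix the bound
  called \<rho> may be any number that is large enough, here the maximum of 1 and its own condition
  number.\<close>

lemma AE_matrix_vector_notin_null:
  fixes M :: "real^'n^'n"
  assumes inv: "invertible M" and N: "N \<in> null_sets lborel"
  shows "AE x in lborel. M *v x \<notin> N"
proof -
  have [measurable]: "N \<in> sets borel" using N by auto
  have "(\<integral>\<^sup>+x. indicator N (M *v x) \<partial>lborel) \<le> ennreal (norm (matrix_inv M) ^ CARD('n)) * (\<integral>\<^sup>+x. indicator N x \<partial>lborel)"
    by (rule nn_integral_matrix_le[OF inv, of "max 1 (norm M * norm (matrix_inv M))"]) auto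
  also have "\<dots> = 0" using N by (simp add: null_sets_def)
  finally have "AE x in lborel. indicator N (M *v x) = (0::ennreal)"
    by (simp add: nn_integral_0_iff_AE)
  then show ?thesis by eventually_elim (auto split: split_indicator_asm)
qed

text \<open>All data are replaced by Borel representatives, and the integral G of the absolute
  values is estimated. Finiteness of the Herz sum of G gives absolute convergence for almost every
  x, and |T f| <= G then transfers the bound to the operator.\<close>

lemma hausdorff_op_bound:
  fixes \<Phi> :: "real^'n \<Rightarrow> complex" and A :: "nat \<Rightarrow> real^'n \<Rightarrow> real^'n^'n" and f :: "nat \<Rightarrow> real^'n \<Rightarrow> complex"
  assumes m: "1 \<le> m" and p: "1 \<le> p" and q: "1 \<le> q"
    and ps: "\<And>i. i \<in> {1..m} \<Longrightarrow> 1 \<le> ps i" "(\<Sum>i=1..m. 1 / ps i) = 1 / p"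
    and qs: "\<And>i. i \<in> {1..m} \<Longrightarrow> 1 \<le> qs i" "(\<Sum>i=1..m. 1 / qs i) = 1 / q"
    and \<gamma>: "(\<Sum>i=1..m. \<gamma>s i / qs i) = \<gamma> / q" and \<sigma>: "(\<Sum>i=1..m. \<sigma>s i) = \<sigma>"
    and \<Phi>: "\<Phi> \<in> borel_measurable lebesgue" and A: "ae_invertible_family m A" and rho: "rho m A < \<infinity>"
    and \<rho>: "1 \<le> \<rho>" "\<rho> \<le> 2 ^ R" "enn2real (rho m A) \<le> \<rho>"
    and f: "\<And>i. i \<in> {1..m} \<Longrightarrow> f i \<in> borel_measurable lebesgue"
    and fin: "\<And>i. i \<in> {1..m} \<Longrightarrow> herz_sum (\<sigma>s i) (\<gamma>s i) (ps i) (qs i) (nrm (f i)) < top"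
    and C: "C = (\<integral>\<^sup>+y. ennreal (cmod (\<Phi> y) / norm y ^ CARD('n) *
        (\<Prod>i=1..m. norm (matrix_inv (A i y)) powr (\<sigma>s i + (real CARD('n) + \<gamma>s i) / qs i))) \<partial>lborel)"
    and Cfin: "C < top"
  shows "AE x in lborel. hausdorff_def_at m \<Phi> A f x"
    and "hausdorff_op m \<Phi> A f \<in> borel_measurable lebesgue"
    and "herz_sum \<sigma> \<gamma> p q (nrm (hausdorff_op m \<Phi> A f)) \<le>
      epow (ennreal (\<Prod>i=1..m. dilation_const \<rho> R (\<sigma>s i) (\<gamma>s i) (ps i) (qs i)) * C *
        (\<Prod>i=1..m. epow (herz_sum (\<sigma>s i) (\<gamma>s i) (ps i) (qs i) (nrm (f i))) (1 / ps i))) p"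
proof -
  let ?I = "{1..m}"
  obtain \<phi> where \<phi> [measurable]: "\<phi> \<in> borel_measurable borel" and \<phi>_eq: "AE y in lborel. \<Phi> y = \<phi> y"
    using lebesgue_measurable_ex_borel[OF \<Phi>] by blast
  have "\<forall>i. \<exists>b. i \<in> ?I \<longrightarrow> b \<in> borel_measurable borel \<and> (AE y in lborel. A i y = b y)"
  proof (intro allI)
    fix i
    show "\<exists>b. i \<in> ?I \<longrightarrow> b \<in> borel_measurable borel \<and> (AE y in lborel. A i y = b y)"
    proof (cases "i \<in> ?I")
      case True
      then have "A i \<in> borel_measurable lebesgue" using A by (simp add: ae_invertible_family_def)
      from lebesgue_measurable_ex_borel[OF this] show ?thesis by blast
    qed blast
  qed
  from choice[OF this] obtain B where B [measurable]: "\<And>i. i \<in> ?I \<Longrightarrow> B i \<in> borel_measurable borel"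
    and B_eq: "\<And>i. i \<in> ?I \<Longrightarrow> AE y in lborel. A i y = B i y" by auto
  have "\<forall>i. \<exists>b. i \<in> ?I \<longrightarrow> b \<in> borel_measurable borel \<and> (AE y in lborel. f i y = b y)"
    using lebesgue_measurable_ex_borel[OF f] by blast
  from choice[OF this] obtain g where g [measurable]: "\<And>i. i \<in> ?I \<Longrightarrow> g i \<in> borel_measurable borel"
    and g_eq: "\<And>i. i \<in> ?I \<Longrightarrow> AE y in lborel. f i y = g i y" by auto
  have "\<forall>i. \<exists>b. i \<in> ?I \<longrightarrow> b \<in> borel_measurable borel \<and> (AE y in lborel. norm (matrix_inv (A i y)) = b y)"
    using lebesgue_measurable_ex_borel[OF rho_finite(1)[OF A rho]] by blast
  from choice[OF this] obtain r where r [measurable]: "\<And>i. i \<in> ?I \<Longrightarrow> r i \<in> borel_measurable borel"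
    and r_eq: "\<And>i. i \<in> ?I \<Longrightarrow> AE y in lborel. norm (matrix_inv (A i y)) = r i y" by auto
  have "AE y in lborel. \<forall>i\<in>?I. A i y = B i y \<and> norm (matrix_inv (A i y)) = r i y \<and> invertible (A i y) \<and>
      norm (A i y) * norm (matrix_inv (A i y)) \<le> \<rho>"
  proof (rule AE_finite_allI)
    fix i assume i: "i \<in> ?I"
    have "AE y in lborel. invertible (A i y)"
      using A i by (simp add: ae_invertible_family_def AE_completion_iff)
    then show "AE y in lborel. A i y = B i y \<and> norm (matrix_inv (A i y)) = r i y \<and> invertible (A i y) \<and>
      norm (A i y) * norm (matrix_inv (A i y)) \<le> \<rho>"
      using B_eq[OF i] r_eq[OF i] rho_finite(2)[OF A rho i]
      by eventually_elim (use \<rho>(3) in auto)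
  qed simp
  then have good: "AE y in lborel. \<Phi> y = \<phi> y \<and> (\<forall>i\<in>?I. A i y = B i y \<and> norm (matrix_inv (B i y)) = r i y \<and> invertible (B i y) \<and>
      norm (B i y) * norm (matrix_inv (B i y)) \<le> \<rho>)"
    using \<phi>_eq by eventually_elim auto
  define J where "J x y = \<phi> y / of_real (norm y ^ CARD('n)) * (\<Prod>i=1..m. g i (B i y *v x))" for x y
  have J_meas [measurable]: "(\<lambda>(x, y). J x y) \<in> borel_measurable (borel \<Otimes>\<^sub>M borel)"
    unfolding J_def by measurable
  have J_meas' [measurable]: "J x \<in> borel_measurable borel" for x
    using measurable_compose[OF measurable_Pair1' J_meas, of x] by simp
  \<comment> \<open>Let f_i = g_i off a null set N. For almost every y, B_i(y) is invertible and
    B_i(y) x avoids N for almost every x; Fubini turns this into a statement for almost every x and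
    almost every y.\<close>
  have "AE x in lborel. AE y in lborel. f i (B i y *v x) = g i (B i y *v x)" if i: "i \<in> ?I" for i
  proof -
    obtain N where N: "N \<in> null_sets lborel" "\<And>y. y \<notin> N \<Longrightarrow> f i y = g i y"
      using g_eq[OF i] by (auto elim!: AE_E simp: null_sets_def) (metis (mono_tags, lifting) mem_Collect_eq subsetD)
    have [measurable]: "N \<in> sets borel" using N by auto
    have "AE y in lborel. AE x in lborel. B i y *v x \<notin> N"
      using good by eventually_elim (use i N in \<open>auto intro: AE_matrix_vector_notin_null\<close>)
    then have "AE x in lborel. AE y in lborel. B i y *v x \<notin> N"
      using i by (subst lborel_pair.AE_commute) measurable
    then show ?thesis by eventually_elim (auto intro: N(2) elim: eventually_mono)
  qed
  then have "AE x in lborel. \<forall>i\<in>?I. AE y in lborel. f i (B i y *v x) = g i (B i y *v x)"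
    by (intro AE_finite_allI) auto
  then have eq: "AE x in lborel. AE y in lborel. hausdorff_integrand m \<Phi> A f x y = J x y"
  proof eventually_elim
    case (elim x)
    then have "AE y in lborel. \<forall>i\<in>?I. f i (B i y *v x) = g i (B i y *v x)"
      by (intro AE_finite_allI) auto
    then show ?case using good
      by eventually_elim (auto simp: hausdorff_integrand_def J_def intro!: prod.cong)
  qed
  define G where "G x = (\<integral>\<^sup>+y. ennreal (cmod (\<phi> y) / norm y ^ CARD('n)) * (\<Prod>i\<in>?I. ennreal (cmod (g i (B i y *v x)))) \<partial>lborel)" for x
  have [measurable]: "G \<in> borel_measurable borel" unfolding G_def by measurable
  have G_eq: "G x = (\<integral>\<^sup>+y. ennreal (cmod (J x y)) \<partial>lborel)" for x
    unfolding G_def J_def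
    by (intro nn_integral_cong) (simp add: norm_mult norm_divide norm_power prod_norm[symmetric] prod_ennreal ennreal_mult[symmetric] prod_nonneg)
  have C_eq: "C = (\<integral>\<^sup>+y. ennreal (cmod (\<phi> y) / norm y ^ CARD('n)) *
      ennreal (\<Prod>i\<in>?I. r i y powr (\<sigma>s i + (real CARD('n) + \<gamma>s i) / qs i)) \<partial>lborel)"
    unfolding C using good
    by (intro nn_integral_cong_AE, eventually_elim) (auto simp: ennreal_mult'[symmetric] intro!: prod.cong)
  have "herz_sum \<sigma> \<gamma> p q G \<le>
     epow (ennreal (\<Prod>i\<in>?I. dilation_const \<rho> R (\<sigma>s i) (\<gamma>s i) (ps i) (qs i)) * C *
      (\<Prod>i\<in>?I. epow (herz_sum (\<sigma>s i) (\<gamma>s i) (ps i) (qs i) (nrm (g i))) (1 / ps i))) p"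
    unfolding G_def C_eq
  proof (rule hausdorff_majorant)
    show "AE y in lborel. \<forall>i\<in>?I. invertible (B i y) \<and> norm (B i y) * norm (matrix_inv (B i y)) \<le> \<rho> \<and>
      norm (matrix_inv (B i y)) = r i y"
      using good by eventually_elim auto
  qed (use m p q ps qs \<gamma> \<sigma> \<rho> in auto)
  also have "(\<Prod>i\<in>?I. epow (herz_sum (\<sigma>s i) (\<gamma>s i) (ps i) (qs i) (nrm (g i))) (1 / ps i)) =
    (\<Prod>i\<in>?I. epow (herz_sum (\<sigma>s i) (\<gamma>s i) (ps i) (qs i) (nrm (f i))) (1 / ps i))"
  proof (intro prod.cong refl)
    fix i assume "i \<in> ?I"
    then have "AE x in lborel. nrm (g i) x = nrm (f i) x" using g_eq[of i] by (auto elim: eventually_mono)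
    from herz_sum_cong_AE[OF this]
    show "epow (herz_sum (\<sigma>s i) (\<gamma>s i) (ps i) (qs i) (nrm (g i))) (1 / ps i) =
      epow (herz_sum (\<sigma>s i) (\<gamma>s i) (ps i) (qs i) (nrm (f i))) (1 / ps i)" by simp
  qed
  finally have bound: "herz_sum \<sigma> \<gamma> p q G \<le>
     epow (ennreal (\<Prod>i\<in>?I. dilation_const \<rho> R (\<sigma>s i) (\<gamma>s i) (ps i) (qs i)) * C *
      (\<Prod>i\<in>?I. epow (herz_sum (\<sigma>s i) (\<gamma>s i) (ps i) (qs i) (nrm (f i))) (1 / ps i))) p" .
  have "(\<Prod>i\<in>?I. epow (herz_sum (\<sigma>s i) (\<gamma>s i) (ps i) (qs i) (nrm (f i))) (1 / ps i)) \<noteq> top"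
    using fin by (subst ennreal_prod_eq_top) (auto simp: less_top)
  then have "epow (ennreal (\<Prod>i\<in>?I. dilation_const \<rho> R (\<sigma>s i) (\<gamma>s i) (ps i) (qs i)) * C *
      (\<Prod>i\<in>?I. epow (herz_sum (\<sigma>s i) (\<gamma>s i) (ps i) (qs i) (nrm (f i))) (1 / ps i))) p < top"
    using Cfin by (simp add: ennreal_mult_less_top less_top)
  from le_less_trans[OF bound this] have Gfin: "AE x in lborel. G x < top"
    by (rule herz_sum_finite_AE) measurable
  show "AE x in lborel. hausdorff_def_at m \<Phi> A f x"
    using eq Gfin
  proof eventually_elim
    case (elim x)
    have "integrable lborel (J x)"
      using elim(2) by (simp add: integrable_iff_bounded G_eq)
    then have "integrable lebesgue (J x)" by (simp add: integrable_completion)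
    moreover have ae: "AE y in lborel. J x y = hausdorff_integrand m \<Phi> A f x y"
      using elim(1) by (auto elim: eventually_mono)
    moreover have "J x \<in> borel_measurable lebesgue" by (intro measurable_completion) simp
    ultimately show ?case unfolding hausdorff_def_at_def
      using lebesgue_measurable_AE_cong[of "J x" "hausdorff_integrand m \<Phi> A f x"]
      by (subst integrable_cong_AE[where g="J x"]) (auto simp: AE_completion_iff eq_commute)
  qed
  have op: "AE x in lborel. hausdorff_op m \<Phi> A f x = (\<integral>y. J x y \<partial>lborel)"
    using eq
  proof eventually_elim
    case (elim x)
    have ae: "AE y in lborel. J x y = hausdorff_integrand m \<Phi> A f x y"
      using elim by (auto elim: eventually_mono)
    have "J x \<in> borel_measurable lebesgue" by (intro measurable_completion) simp
    then have "hausdorff_op m \<Phi> A f x = (\<integral>y. J x y \<partial>lebesgue)"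
      unfolding hausdorff_op_def using ae lebesgue_measurable_AE_cong[of "J x" "hausdorff_integrand m \<Phi> A f x"]
      by (intro integral_cong_AE) (auto simp: AE_completion_iff eq_commute)
    then show ?case by (simp add: integral_completion)
  qed
  have Jint [measurable]: "(\<lambda>x. \<integral>y. J x y \<partial>lborel) \<in> borel_measurable borel"
    by (rule lborel.borel_measurable_lebesgue_integral) measurable
  \<comment> \<open>Off a null set the operator equals a Borel parameter integral; completeness of
    Lebesgue measure does the rest.\<close>
  show "hausdorff_op m \<Phi> A f \<in> borel_measurable lebesgue"
    by (rule lebesgue_measurable_AE_cong[of "\<lambda>x. \<integral>y. J x y \<partial>lborel"])
       (use op in \<open>auto intro!: measurable_completion simp: eq_commute\<close>)
  have "AE x in lborel. nrm (hausdorff_op m \<Phi> A f) x \<le> G x"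
    using op Gfin
  proof eventually_elim
    case (elim x)
    have "integrable lborel (J x)"
      using elim(2) by (simp add: integrable_iff_bounded G_eq)
    then show ?case
      unfolding elim(1) G_eq by (rule integral_norm_bound_ennreal)
  qed
  then have "herz_sum \<sigma> \<gamma> p q (nrm (hausdorff_op m \<Phi> A f)) \<le> herz_sum \<sigma> \<gamma> p q G"
    using p q by (intro herz_sum_mono) auto
  then show "herz_sum \<sigma> \<gamma> p q (nrm (hausdorff_op m \<Phi> A f)) \<le>
      epow (ennreal (\<Prod>i=1..m. dilation_const \<rho> R (\<sigma>s i) (\<gamma>s i) (ps i) (qs i)) * C *
        (\<Prod>i=1..m. epow (herz_sum (\<sigma>s i) (\<gamma>s i) (ps i) (qs i) (nrm (f i))) (1 / ps i))) p"
    using bound by (rule order_trans)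
qed

section \<open>From Herz sums back to operator norms\<close>

lemma multilinear_norm_le:
  assumes "multilinear_bound m D T X Y C"
  shows "multilinear_norm m D T X Y \<le> C"
  unfolding multilinear_norm_def
  by (rule cInf_lower) (use assms in \<open>auto simp: multilinear_bound_def bdd_below_def\<close>)

lemma multilinear_norm_ge:
  assumes "multilinear_bounded m D T X Y"
    and "\<And>C. multilinear_bound m D T X Y C \<Longrightarrow> b \<le> C"
  shows "b \<le> multilinear_norm m D T X Y"
  unfolding multilinear_norm_def
  by (rule cInf_greatest) (use assms in \<open>auto simp: multilinear_bounded_def\<close>)

lemma herz_set_herz_norm:
  fixes f :: "real^'n \<Rightarrow> complex"
  assumes "f \<in> herz_set (power_weight \<beta>) (power_weight \<gamma>) \<alpha> p q"
    and "0 < p" "0 < q" "\<beta> > - real CARD('n)"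
  shows "f \<in> borel_measurable lebesgue"
    and "herz_sum ((1 + \<beta> / real CARD('n)) * \<alpha>) \<gamma> p q (nrm f) < top"
    and "herz_norm (power_weight \<beta>) (power_weight \<gamma>) \<alpha> p q f = ball_integral TYPE(real^'n) \<beta> powr (\<alpha> / real CARD('n)) *
      enn2real (herz_sum ((1 + \<beta> / real CARD('n)) * \<alpha>) \<gamma> p q (nrm f)) powr (1 / p)"
proof -
  show m: "f \<in> borel_measurable lebesgue" using assms(1) by (simp add: herz_set_def)
  show "herz_sum ((1 + \<beta> / real CARD('n)) * \<alpha>) \<gamma> p q (nrm f) < top"
    using herz_set_iff[OF m, of p q \<beta> \<gamma> \<alpha>] assms by simp
  then show "herz_norm (power_weight \<beta>) (power_weight \<gamma>) \<alpha> p q f = ball_integral TYPE(real^'n) \<beta> powr (\<alpha> / real CARD('n)) *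
      enn2real (herz_sum ((1 + \<beta> / real CARD('n)) * \<alpha>) \<gamma> p q (nrm f)) powr (1 / p)"
    using herz_norm_eq[OF m, of p q \<beta> \<alpha> \<gamma>] assms by simp
qed

text \<open>The estimate for Herz sums, after a p-th root. The powers of
  \<open>ball_integral\<close> convert Herz sums into Herz norms: the one of the target space
  multiplies, those of the source spaces divide.\<close>

lemma hausdorff_bounded:
  fixes \<Phi> :: "real^'n \<Rightarrow> complex" and A :: "nat \<Rightarrow> real^'n \<Rightarrow> real^'n^'n"
  assumes m: "1 \<le> m"
    and \<beta>: "\<beta> > - real CARD('n)" "\<And>i. i \<in> {1..m} \<Longrightarrow> \<beta>s i > - real CARD('n)"
    and p: "1 \<le> p" and q: "1 \<le> q"
    and ps: "\<And>i. i \<in> {1..m} \<Longrightarrow> 1 \<le> ps i" "(\<Sum>i=1..m. 1 / ps i) = 1 / p"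
    and qs: "\<And>i. i \<in> {1..m} \<Longrightarrow> 1 \<le> qs i" "(\<Sum>i=1..m. 1 / qs i) = 1 / q"
    and \<gamma>: "(\<Sum>i=1..m. \<gamma>s i / qs i) = \<gamma> / q"
    and \<alpha>: "(\<Sum>i=1..m. (1 + \<beta>s i / real CARD('n)) * \<alpha>s i) = (1 + \<beta> / real CARD('n)) * \<alpha>"
    and \<Phi>: "\<Phi> \<in> borel_measurable lebesgue" and A: "ae_invertible_family m A" and rho: "rho m A < \<infinity>"
    and \<rho>: "1 \<le> \<rho>" "\<rho> \<le> 2 ^ R" "enn2real (rho m A) \<le> \<rho>"
    and fin: "hausdorff_const m \<Phi> A \<beta>s \<gamma>s \<alpha>s qs < \<infinity>"
  shows "multilinear_bound m (hausdorff_def_at m \<Phi> A) (hausdorff_op m \<Phi> A)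
      (\<lambda>i. herz_space (power_weight (\<beta>s i)) (power_weight (\<gamma>s i)) (\<alpha>s i) (ps i) (qs i))
      (herz_space (power_weight \<beta>) (power_weight \<gamma>) \<alpha> p q)
      (ball_integral TYPE(real^'n) \<beta> powr (\<alpha> / real CARD('n)) *
       (\<Prod>i=1..m. dilation_const \<rho> R ((1 + \<beta>s i / real CARD('n)) * \<alpha>s i) (\<gamma>s i) (ps i) (qs i) /
          ball_integral TYPE(real^'n) (\<beta>s i) powr (\<alpha>s i / real CARD('n))) *
       enn2real (hausdorff_const m \<Phi> A \<beta>s \<gamma>s \<alpha>s qs))"
proof -
  define W where "W = ball_integral TYPE(real^'n) \<beta> powr (\<alpha> / real CARD('n))"
  define Ws where "Ws i = ball_integral TYPE(real^'n) (\<beta>s i) powr (\<alpha>s i / real CARD('n))" for i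
  define \<sigma>s where "\<sigma>s i = (1 + \<beta>s i / real CARD('n)) * \<alpha>s i" for i
  define K where "K i = dilation_const \<rho> R (\<sigma>s i) (\<gamma>s i) (ps i) (qs i)" for i
  define C where "C = hausdorff_const m \<Phi> A \<beta>s \<gamma>s \<alpha>s qs"
  have W: "W > 0" using ball_integral_pos[of \<beta>, where 'a="real^'n"] \<beta> by (simp add: W_def)
  have Ws: "Ws i > 0" if "i \<in> {1..m}" for i
    using ball_integral_pos[of "\<beta>s i", where 'a="real^'n"] \<beta>(2)[OF that] by (simp add: Ws_def)
  have K: "K i > 0" for i unfolding K_def by (rule dilation_const_pos) fact
  have C_eq: "C = (\<integral>\<^sup>+y. ennreal (cmod (\<Phi> y) / norm y ^ CARD('n) *
        (\<Prod>i=1..m. norm (matrix_inv (A i y)) powr (\<sigma>s i + (real CARD('n) + \<gamma>s i) / qs i))) \<partial>lborel)"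
    by (simp add: C_def hausdorff_const_def nn_integral_completion \<sigma>s_def)
  obtain c where c: "C = ennreal c" "c \<ge> 0" using fin by (cases C) (auto simp: C_def)
  have "multilinear_bound m (hausdorff_def_at m \<Phi> A) (hausdorff_op m \<Phi> A)
      (\<lambda>i. herz_space (power_weight (\<beta>s i)) (power_weight (\<gamma>s i)) (\<alpha>s i) (ps i) (qs i))
      (herz_space (power_weight \<beta>) (power_weight \<gamma>) \<alpha> p q) (W * (\<Prod>i=1..m. K i / Ws i) * c)"
    unfolding multilinear_bound_def
  proof (intro conjI allI impI)
    show "0 \<le> W * (\<Prod>i=1..m. K i / Ws i) * c"
      using W Ws K c by (intro mult_nonneg_nonneg prod_nonneg) (auto simp: less_imp_le)
  next
    fix f :: "nat \<Rightarrow> real^'n \<Rightarrow> complex"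
    assume "\<forall>i\<in>{1..m}. f i \<in> fst (herz_space (power_weight (\<beta>s i)) (power_weight (\<gamma>s i)) (\<alpha>s i) (ps i) (qs i))"
    then have mem: "f i \<in> herz_set (power_weight (\<beta>s i)) (power_weight (\<gamma>s i)) (\<alpha>s i) (ps i) (qs i)" if "i \<in> {1..m}" for i
      using that by (simp add: herz_space_def)
    have pq: "0 < ps i" "0 < qs i" if "i \<in> {1..m}" for i using ps(1)[OF that] qs(1)[OF that] by auto
    note f = herz_set_herz_norm[OF mem pq \<beta>(2), folded \<sigma>s_def Ws_def]
    note bnd = hausdorff_op_bound[where m=m and \<sigma>s=\<sigma>s and \<sigma>="(1 + \<beta> / real CARD('n)) * \<alpha>", OF m p q ps qs \<gamma> _ \<Phi> A rho \<rho> _ _ C_eq,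
        where f=f, folded K_def]
    have \<sigma>: "(\<Sum>i=1..m. \<sigma>s i) = (1 + \<beta> / real CARD('n)) * \<alpha>" using \<alpha> by (simp add: \<sigma>s_def)
    have Cfin: "C < top" using c by simp
    let ?T = "hausdorff_op m \<Phi> A f"
    define t where "t i = enn2real (herz_sum (\<sigma>s i) (\<gamma>s i) (ps i) (qs i) (nrm (f i))) powr (1 / ps i)" for i
    have t: "epow (herz_sum (\<sigma>s i) (\<gamma>s i) (ps i) (qs i) (nrm (f i))) (1 / ps i) = ennreal (t i)" if "i \<in> {1..m}" for i
      using f(2)[OF that that that that] by (simp add: epow_def t_def)
    have def_at: "AE x in lborel. hausdorff_def_at m \<Phi> A f x"
      and Tm: "?T \<in> borel_measurable lebesgue"
      and Tb: "herz_sum ((1 + \<beta> / real CARD('n)) * \<alpha>) \<gamma> p q (nrm ?T) \<le>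
        epow (ennreal (\<Prod>i=1..m. K i) * C * (\<Prod>i=1..m. epow (herz_sum (\<sigma>s i) (\<gamma>s i) (ps i) (qs i) (nrm (f i))) (1 / ps i))) p"
      using bnd[OF _ _ \<sigma> _ _ Cfin] f(1,2) by auto
    show "AE x in lebesgue. hausdorff_def_at m \<Phi> A f x" using def_at by (simp add: AE_completion_iff)
    have "ennreal (\<Prod>i=1..m. K i) * C * (\<Prod>i=1..m. epow (herz_sum (\<sigma>s i) (\<gamma>s i) (ps i) (qs i) (nrm (f i))) (1 / ps i)) =
       ennreal ((\<Prod>i=1..m. K i) * c * (\<Prod>i=1..m. t i))"
      using c less_imp_le[OF K] by (simp add: t prod_ennreal t_def ennreal_mult prod_nonneg)
    moreover have nn: "(\<Prod>i=1..m. K i) * c * (\<Prod>i=1..m. t i) \<ge> 0"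
      using c less_imp_le[OF K] by (intro mult_nonneg_nonneg prod_nonneg) (auto simp: t_def)
    ultimately have Tb': "herz_sum ((1 + \<beta> / real CARD('n)) * \<alpha>) \<gamma> p q (nrm ?T) \<le> ennreal (((\<Prod>i=1..m. K i) * c * (\<Prod>i=1..m. t i)) powr p)"
      using Tb by simp
    then have "herz_sum ((1 + \<beta> / real CARD('n)) * \<alpha>) \<gamma> p q (nrm ?T) < top"
      by (rule le_less_trans) simp
    then have Tmem: "?T \<in> herz_set (power_weight \<beta>) (power_weight \<gamma>) \<alpha> p q"
      using herz_set_iff[OF Tm, of p q \<beta> \<gamma> \<alpha>] p q \<beta> by simp
    then show "?T \<in> fst (herz_space (power_weight \<beta>) (power_weight \<gamma>) \<alpha> p q)"
      by (simp add: herz_space_def)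
    have "herz_norm (power_weight \<beta>) (power_weight \<gamma>) \<alpha> p q ?T =
        W * enn2real (herz_sum ((1 + \<beta> / real CARD('n)) * \<alpha>) \<gamma> p q (nrm ?T)) powr (1 / p)"
      using herz_set_herz_norm(3)[OF Tmem] p q \<beta> by (simp add: W_def)
    also have "\<dots> \<le> W * (((\<Prod>i=1..m. K i) * c * (\<Prod>i=1..m. t i)) powr p) powr (1 / p)"
      using Tb' p W nn by (intro mult_left_mono powr_mono2 enn2real_leI) auto
    also have "\<dots> = W * ((\<Prod>i=1..m. K i) * c * (\<Prod>i=1..m. t i))"
      using p nn by (simp add: powr_powr)
    also have "(\<Prod>i=1..m. t i) = (\<Prod>i=1..m. herz_norm (power_weight (\<beta>s i)) (power_weight (\<gamma>s i)) (\<alpha>s i) (ps i) (qs i) (f i) / Ws i)"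
      using f(3) Ws by (intro prod.cong refl) (force simp: t_def)
    also have "W * ((\<Prod>i=1..m. K i) * c * \<dots>) = W * (\<Prod>i=1..m. K i / Ws i) * c *
        (\<Prod>i=1..m. herz_norm (power_weight (\<beta>s i)) (power_weight (\<gamma>s i)) (\<alpha>s i) (ps i) (qs i) (f i))"
      by (simp add: prod_dividef)
    finally show "snd (herz_space (power_weight \<beta>) (power_weight \<gamma>) \<alpha> p q) ?T \<le> W * (\<Prod>i=1..m. K i / Ws i) * c *
      (\<Prod>i=1..m. snd (herz_space (power_weight (\<beta>s i)) (power_weight (\<gamma>s i)) (\<alpha>s i) (ps i) (qs i)) (f i))"
      by (simp add: herz_space_def)
  qed
  moreover have "c = enn2real (hausdorff_const m \<Phi> A \<beta>s \<gamma>s \<alpha>s qs)" using c by (simp add: C_def[symmetric])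
  ultimately show ?thesis by (simp add: W_def Ws_def K_def \<sigma>s_def)
qed

section \<open>Necessity of the integral condition\<close>

text \<open>For S = {1..N} the support is 1 < |x| <= 2^N, giving the test functions; a shorter range
  of shells gives the lower bound for their image.\<close>

definition shell_power_fun :: "int set \<Rightarrow> real \<Rightarrow> 'a::euclidean_space \<Rightarrow> real"
  where "shell_power_fun S e x = indicator (\<Union>k\<in>S. dyadic_shell k) x * norm x powr - e"

lemma shell_power_fun_measurable [measurable]: "shell_power_fun S e \<in> borel_measurable borel"
proof -
  have [measurable]: "(\<Union>k\<in>S. dyadic_shell k) \<in> sets borel"
    by (intro sets.countable_UN'') auto
  show ?thesis unfolding shell_power_fun_def by measurable
qed

lemma shell_power_fun_nonneg: "0 \<le> shell_power_fun S e x"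
  by (simp add: shell_power_fun_def)

lemma shell_power_fun_eq:
  assumes "x \<in> dyadic_shell k"
  shows "shell_power_fun S e x = (if k \<in> S then norm x powr - e else 0)"
proof -
  have "x \<in> (\<Union>k\<in>S. dyadic_shell k) \<longleftrightarrow> k \<in> S" using assms by (auto simp: mem_dyadic_shell_iff_log)
  then show ?thesis by (simp add: shell_power_fun_def indicator_def del: UN_iff)
qed

text \<open>The exponent e is critical: every shell in S contributes the same amount, so the sum is
  proportional to the number of shells.\<close>

lemma herz_sum_shell_power_fun:
  assumes S: "finite S" and c: "0 \<le> c" and p: "0 < p" and q: "0 < q"
    and e: "e = \<sigma> + (real DIM('a) + \<gamma>) / q"
  shows "herz_sum \<sigma> \<gamma> p q (\<lambda>x::'a::euclidean_space. ennreal (c * shell_power_fun S e x)) =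
     ennreal (c powr p * real (card S) * shell_integral TYPE('a) (\<gamma> - e * q) powr (p / q))"
proof -
  let ?s = "shell_integral TYPE('a) (\<gamma> - e * q)"
  let ?F = "\<lambda>x::'a. ennreal (c * shell_power_fun S e x)"
  have s: "?s \<ge> 0" using shell_integral_pos[of "\<gamma> - e * q", where 'a='a] by simp
  have sp: "shell_power \<gamma> q ?F k = (if k \<in> S then ennreal (c powr q * (2 powr (- (real_of_int k * \<sigma> * q)) * ?s)) else 0)" for k
  proof -
    have "shell_power \<gamma> q ?F k = (\<integral>\<^sup>+x. (if k \<in> S then ennreal (c powr q) else 0) *
        (indicator (dyadic_shell k) x * ennreal (norm x powr (\<gamma> - e * q))) \<partial>(lborel :: 'a measure))"
      unfolding shell_power_def
    proof (intro nn_integral_cong)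
      fix x :: 'a
      show "indicator (dyadic_shell k) x * (epow (?F x) q * ennreal (norm x powr \<gamma>)) =
         (if k \<in> S then ennreal (c powr q) else 0) * (indicator (dyadic_shell k) x * ennreal (norm x powr (\<gamma> - e * q)))"
      proof (cases "x \<in> dyadic_shell k")
        case True
        then show ?thesis using c
          by (simp add: shell_power_fun_eq powr_mult powr_powr ennreal_mult[symmetric] powr_add[symmetric] mult.assoc)
      qed simp
    qed
    also have "\<dots> = (if k \<in> S then ennreal (c powr q) else 0) *
        ennreal (2 powr (real_of_int k * (real DIM('a) + (\<gamma> - e * q))) * ?s)"
      by (subst nn_integral_cmult) (simp_all add: nn_integral_shell)
    \<comment> \<open>The shell integral scales as 2^(-k \<sigma> q); its power p/q cancels the
      weight 2^(k \<sigma> p).\<close>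
    also have "real_of_int k * (real DIM('a) + (\<gamma> - e * q)) = - (real_of_int k * \<sigma> * q)"
      using q by (simp add: e field_simps)
    finally show ?thesis using s by (simp add: ennreal_mult)
  qed
  have "herz_sum \<sigma> \<gamma> p q ?F = (\<Sum>k\<in>S. ennreal (2 powr (real_of_int k * \<sigma> * p)) * epow (shell_power \<gamma> q ?F k) (p / q))"
    unfolding herz_sum_def using S by (intro nn_integral_count_space') (auto simp: sp)
  also have "\<dots> = (\<Sum>k\<in>S. ennreal (c powr p * ?s powr (p / q)))"
  proof (intro sum.cong refl)
    fix k assume k: "k \<in> S"
    have "2 powr (real_of_int k * \<sigma> * p) * (c powr q * (2 powr (- (real_of_int k * \<sigma> * q)) * ?s)) powr (p / q) =
      (2 powr (real_of_int k * \<sigma> * p) * 2 powr (- (real_of_int k * \<sigma> * p))) * (c powr p * ?s powr (p / q))"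
      using q s c by (simp add: powr_mult powr_powr mult.assoc)
    also have "\<dots> = c powr p * ?s powr (p / q)" by (simp add: powr_add[symmetric])
    finally show "ennreal (2 powr (real_of_int k * \<sigma> * p)) * epow (shell_power \<gamma> q ?F k) (p / q) = ennreal (c powr p * ?s powr (p / q))"
      using k s by (simp add: sp ennreal_mult[symmetric])
  qed
  also have "\<dots> = ennreal (c powr p * real (card S) * ?s powr (p / q))"
    by (simp add: ennreal_of_nat_eq_real_of_nat ennreal_mult[symmetric] mult_ac)
  finally show ?thesis .
qed

text \<open>The range of k keeps M x inside the support: |M x| >= |x| / ||M^(-1)|| > 2^(k-1-L) >= 1
  and |M x| <= \<rho> |x| / ||M^(-1)|| <= 2^(R+k+L) <= 2^N. On the support the powers of |M x| and
  |x| are comparable.\<close>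

lemma shell_power_fun_le_matrix:
  fixes M :: "real^'n^'n"
  assumes inv: "invertible M" and \<rho>: "norm M * norm (matrix_inv M) \<le> \<rho>" "1 \<le> \<rho>" "\<rho> \<le> 2 ^ R"
    and D: "2 powr - real L \<le> norm (matrix_inv M)" "norm (matrix_inv M) \<le> 2 powr real L"
    and x: "x \<in> dyadic_shell k" "int L + 1 \<le> k" "k \<le> int N - int L - int R"
  shows "\<rho> powr - \<bar>e\<bar> * norm (matrix_inv M) powr e * norm x powr - e \<le> shell_power_fun {1..int N} e (M *v x)"
proof -
  let ?r = "norm (matrix_inv M)" and ?z = "M *v x"
  have x0: "x \<noteq> 0" using x(1) by (simp add: mem_dyadic_shell_iff_log)
  have "2 powr real L \<le> 2 powr (real_of_int k - 1)" using x(2) by simp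
  also have "\<dots> < norm x" using x(1) by (simp add: mem_dyadic_shell)
  also have "\<dots> \<le> ?r * norm ?z" by (rule norm_le_norm_matrix_vector[OF inv \<rho>(1,2)])
  also have "\<dots> \<le> 2 powr real L * norm ?z" using D(2) by (intro mult_right_mono) auto
  finally have lo: "1 < norm ?z" by simp
  have "2 powr - real L * norm ?z \<le> ?r * norm ?z" using D(1) by (intro mult_right_mono) auto
  also have "\<dots> \<le> \<rho> * norm x" by (rule norm_matrix_vector_le[OF inv \<rho>(1,2)])
  also have "\<dots> \<le> 2 powr real R * 2 powr real_of_int k"
    using \<rho> x(1) by (intro mult_mono) (auto simp: powr_realpow mem_dyadic_shell)
  also have "\<dots> = 2 powr (real R + real_of_int k)" by (simp add: powr_add)
  also have "\<dots> \<le> 2 powr (- real L + real N)" using x(3) by simp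
  also have "\<dots> = 2 powr - real L * 2 powr real N" by (rule powr_add)
  finally have hi: "norm ?z \<le> 2 powr real N" by simp
  have "norm ?z > 0" using lo by linarith
  then have "0 < log 2 (norm ?z)" "log 2 (norm ?z) \<le> real N"
    using lo hi by (simp_all add: log_le_iff)
  then have "\<lceil>log 2 (norm ?z)\<rceil> \<in> {1..int N}" by (auto simp: ceiling_le_iff)
  moreover have "?z \<in> dyadic_shell \<lceil>log 2 (norm ?z)\<rceil>"
    using lo by (auto simp: mem_dyadic_shell_iff_log)
  ultimately have "shell_power_fun {1..int N} e ?z = norm ?z powr - e"
    by (simp add: shell_power_fun_eq)
  moreover have "\<rho> powr - \<bar>e\<bar> * ?r powr e * norm x powr - e \<le> norm ?z powr - e"
  proof -
    have "\<rho> powr - \<bar>e\<bar> * ?r powr e * norm x powr - e \<le>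
       \<rho> powr - \<bar>e\<bar> * ?r powr e * (\<rho> powr \<bar>- e\<bar> * ?r powr - e * norm ?z powr - e)"
      by (intro mult_left_mono norm_powr_matrix_vector[OF inv \<rho>(1,2) x0]) auto
    also have "\<dots> = (\<rho> powr - \<bar>e\<bar> * \<rho> powr \<bar>e\<bar>) * (?r powr e * ?r powr - e) * norm ?z powr - e"
      by simp
    also have "\<dots> = norm ?z powr - e"
      using \<rho>(2) norm_matrix_inv_pos[OF inv \<rho>(1,2)] by (simp add: powr_add[symmetric])
    finally show ?thesis .
  qed
  ultimately show ?thesis by simp
qed

text \<open>The integrand is a fixed sign s times its modulus, so nothing cancels and the modulus of
  the integral is the integral of the modulus.\<close>

lemma hausdorff_op_constant_sign:
  assumes sign: "real_of_constant_sign \<Phi>" and def_at: "hausdorff_def_at m \<Phi> A (\<lambda>i z. of_real (g i z)) x"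
    and g: "\<And>i z. 0 \<le> g i z"
  shows "ennreal (cmod (hausdorff_op m \<Phi> A (\<lambda>i z. of_real (g i z)) x)) =
    (\<integral>\<^sup>+y. ennreal (cmod (\<Phi> y) / norm y ^ CARD('n) * (\<Prod>i=1..m. g i (A i y *v (x::real^'n)))) \<partial>lborel)"
proof -
  let ?h = "hausdorff_integrand m \<Phi> A (\<lambda>i z. of_real (g i z)) x"
  have cm: "cmod (?h y) = cmod (\<Phi> y) / norm y ^ CARD('n) * (\<Prod>i=1..m. g i (A i y *v x))" for y
    using g by (simp add: hausdorff_integrand_def norm_mult norm_divide norm_power prod_norm[symmetric])
  obtain s :: real where s: "\<bar>s\<bar> = 1" "\<And>y. \<Phi> y = of_real (s * cmod (\<Phi> y))"
  proof (cases "\<forall>y. \<Phi> y \<in> \<real> \<and> 0 \<le> Re (\<Phi> y)")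
    case True
    then have "\<Phi> y = of_real (1 * cmod (\<Phi> y))" for y
      by (auto simp: complex_is_Real_iff complex_eq_iff cmod_def)
    then show ?thesis using that[of 1] by simp
  next
    case False
    then have *: "\<forall>y. \<Phi> y \<in> \<real> \<and> Re (\<Phi> y) \<le> 0" using sign by (auto simp: real_of_constant_sign_def)
    have "\<Phi> y = of_real (- 1 * cmod (\<Phi> y))" for y
      using *[rule_format, of y] by (auto simp: complex_is_Real_iff complex_eq_iff cmod_def)
    then show ?thesis using that[of "-1"] by simp
  qed
  have h: "?h y = of_real s * of_real (cmod (?h y))" for y
  proof -
    have "?h y = of_real (s * cmod (\<Phi> y)) / of_real (norm y ^ CARD('n)) * (\<Prod>i=1..m. of_real (g i (A i y *v x)))"
      unfolding s(2)[of y, symmetric] by (simp add: hausdorff_integrand_def)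
    then show ?thesis unfolding cm by simp
  qed
  have int: "integrable lebesgue ?h" using def_at by (simp add: hausdorff_def_at_def)
  have "hausdorff_op m \<Phi> A (\<lambda>i z. of_real (g i z)) x = (\<integral>y. of_real s * of_real (cmod (?h y)) \<partial>lebesgue)"
    unfolding hausdorff_op_def using h by (intro Bochner_Integration.integral_cong) auto
  also have "\<dots> = of_real s * of_real (\<integral>y. cmod (?h y) \<partial>lebesgue)"
    by (simp only: integral_mult_right_zero integral_complex_of_real)
  finally have "cmod (hausdorff_op m \<Phi> A (\<lambda>i z. of_real (g i z)) x) = (\<integral>y. cmod (?h y) \<partial>lebesgue)"
    using s(1) by (simp add: norm_mult)
  also have "ennreal \<dots> = (\<integral>\<^sup>+y. ennreal (cmod (?h y)) \<partial>lebesgue)"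
    using int by (intro nn_integral_eq_integral[symmetric]) auto
  finally show ?thesis by (simp add: nn_integral_completion cm)
qed

text \<open>The bounds are uniform in y, so one range of shells serves every y in the
  window.\<close>

definition inverse_norm_window :: "nat \<Rightarrow> (nat \<Rightarrow> real^'n \<Rightarrow> real^'n^'n) \<Rightarrow> nat \<Rightarrow> (real^'n) set"
  where "inverse_norm_window m A L =
    {y. \<forall>i\<in>{1..m}. 2 powr - real L \<le> norm (matrix_inv (A i y)) \<and> norm (matrix_inv (A i y)) \<le> 2 powr real L}"

lemma truncated_integrand_measurable:
  fixes \<Phi> :: "real^'n \<Rightarrow> complex" and A :: "nat \<Rightarrow> real^'n \<Rightarrow> real^'n^'n"
  assumes \<Phi>: "\<Phi> \<in> borel_measurable lebesgue" and A: "ae_invertible_family m A" and rho: "rho m A < \<infinity>"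
  shows "(\<lambda>y. ennreal (cmod (\<Phi> y) / norm y ^ CARD('n) * (\<Prod>i=1..m. norm (matrix_inv (A i y)) powr es i)) *
    indicator (inverse_norm_window m A L) y) \<in> borel_measurable lebesgue"
proof -
  have r_meas: "(\<lambda>y. norm (matrix_inv (A i y))) \<in> borel_measurable lebesgue" if "i \<in> {1..m}" for i
    by (rule rho_finite(1)[OF A rho that])
  have "norm \<in> borel_measurable (lebesgue :: (real^'n) measure)"
    by (intro measurable_completion) measurable
  then have h_meas: "(\<lambda>y. cmod (\<Phi> y) / norm y ^ CARD('n) * (\<Prod>i=1..m. norm (matrix_inv (A i y)) powr es i)) \<in> borel_measurable lebesgue"
    using \<Phi> r_meas by (intro borel_measurable_times borel_measurable_divide borel_measurable_prod) auto
  have D_meas: "inverse_norm_window m A L \<in> sets lebesgue"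
  proof -
    have window: "{y \<in> space lebesgue. a \<le> u y \<and> u y \<le> b} \<in> sets lebesgue"
      if [measurable]: "u \<in> borel_measurable lebesgue" for u :: "real^'n \<Rightarrow> real" and a b
      by measurable
    have "{y \<in> space lebesgue. \<forall>i\<in>{1..m}. 2 powr - real L \<le> norm (matrix_inv (A i y)) \<and> norm (matrix_inv (A i y)) \<le> 2 powr real L} \<in> sets lebesgue"
      by (rule sets.sets_Collect_finite_All[OF window[OF r_meas]]) simp_all
    then show ?thesis
      by (simp only: inverse_norm_window_def space_completion space_lborel space_borel UNIV_I simp_thms)
  qed
  show ?thesis
    by (intro borel_measurable_times_ennreal borel_measurable_indicator D_meas
        measurable_compose[OF h_meas measurable_ennreal])
qed

lemma inverse_norm_window_mono: "L \<le> L' \<Longrightarrow> inverse_norm_window m A L \<subseteq> inverse_norm_window m A L'"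
proof -
  assume "L \<le> L'"
  then have "2 powr - real L' \<le> 2 powr - real L" "2 powr real L \<le> 2 powr real L'" by simp_all
  then show ?thesis unfolding inverse_norm_window_def by (blast intro: order_trans)
qed

lemma mem_inverse_norm_window:
  assumes "\<And>i. i \<in> {1..m} \<Longrightarrow> norm (matrix_inv (A i y)) > 0"
  obtains L where "y \<in> inverse_norm_window m A L"
proof -
  let ?l = "\<lambda>i. \<bar>log 2 (norm (matrix_inv (A i y)))\<bar>"
  \<comment> \<open>The sum of all |log| terms dominates each of them, giving one L for all
    indices.\<close>
  have "y \<in> inverse_norm_window m A (nat \<lceil>\<Sum>i=1..m. ?l i\<rceil>)"
    unfolding inverse_norm_window_def
  proof (intro CollectI ballI)
    fix i assume i: "i \<in> {1..m}"
    let ?L = "nat \<lceil>\<Sum>i=1..m. ?l i\<rceil>"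
    have "?l i \<le> (\<Sum>i=1..m. ?l i)" using i by (intro member_le_sum) auto
    also have "\<dots> \<le> real ?L" by linarith
    finally have "- real ?L \<le> log 2 (norm (matrix_inv (A i y)))" "log 2 (norm (matrix_inv (A i y))) \<le> real ?L" by auto
    then show "2 powr - real ?L \<le> norm (matrix_inv (A i y)) \<and> norm (matrix_inv (A i y)) \<le> 2 powr real ?L"
      using assms[OF i] by (simp add: le_log_iff log_le_iff)
  qed
  then show thesis by (rule that)
qed

text \<open>Almost every y has all matrices invertible and so lies in some window; the windows
  increase with L, and the bound b is independent of L, so monotone convergence applies.\<close>

lemma nn_integral_le_truncated:
  fixes \<Phi> :: "real^'n \<Rightarrow> complex" and A :: "nat \<Rightarrow> real^'n \<Rightarrow> real^'n^'n"
  assumes \<Phi>: "\<Phi> \<in> borel_measurable lebesgue" and A: "ae_invertible_family m A" and rho: "rho m A < \<infinity>"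
    and le: "\<And>L. (\<integral>\<^sup>+y. ennreal (cmod (\<Phi> y) / norm y ^ CARD('n) * (\<Prod>i=1..m. norm (matrix_inv (A i y)) powr es i)) *
       indicator (inverse_norm_window m A L) y \<partial>lborel) \<le> b"
  shows "(\<integral>\<^sup>+y. ennreal (cmod (\<Phi> y) / norm y ^ CARD('n) * (\<Prod>i=1..m. norm (matrix_inv (A i y)) powr es i)) \<partial>lborel) \<le> b"
proof -
  define h where "h y = ennreal (cmod (\<Phi> y) / norm y ^ CARD('n) * (\<Prod>i=1..m. norm (matrix_inv (A i y)) powr es i))" for y
  let ?F = "\<lambda>L y. h y * indicator (inverse_norm_window m A L) y"
  have "AE y in lborel. \<forall>i\<in>{1..m}. invertible (A i y)"
    using A by (intro AE_finite_allI) (auto simp: ae_invertible_family_def AE_completion_iff)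
  then have "AE y in lebesgue. h y \<le> (SUP L. ?F L y)"
    unfolding AE_completion_iff
  proof eventually_elim
    case (elim y)
    have "norm (matrix_inv (A i y)) > 0" if "i \<in> {1..m}" for i
      using elim that by (intro norm_matrix_inv_pos[of _ "max 1 (norm (A i y) * norm (matrix_inv (A i y)))"]) auto
    then obtain L where "y \<in> inverse_norm_window m A L" by (rule mem_inverse_norm_window)
    then have "h y = ?F L y" by simp
    also have "\<dots> \<le> (SUP L. ?F L y)" by (rule SUP_upper) simp
    finally show ?case .
  qed
  then have "(\<integral>\<^sup>+y. h y \<partial>lebesgue) \<le> (\<integral>\<^sup>+y. (SUP L. ?F L y) \<partial>lebesgue)"
    by (rule nn_integral_mono_AE)
  also have "\<dots> = (SUP L. \<integral>\<^sup>+y. ?F L y \<partial>lebesgue)"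
  proof (rule nn_integral_monotone_convergence_SUP)
    show "incseq ?F"
    proof (intro incseq_SucI le_funI)
      fix L y
      show "?F L y \<le> ?F (Suc L) y"
        using inverse_norm_window_mono[of L "Suc L" m A] by (auto intro: mult_left_mono split: split_indicator)
    qed
    show "?F L \<in> borel_measurable lebesgue" for L
      unfolding h_def by (rule truncated_integrand_measurable[OF \<Phi> A rho])
  qed
  also have "\<dots> \<le> b" using le by (auto simp: nn_integral_completion h_def intro: SUP_least)
  finally show ?thesis by (simp add: nn_integral_completion h_def)
qed

text \<open>The real number j below the truncated integral stands in for it, because the integral
  might still be infinite. In K, the numerator collects the norms of the test functions and the
  denominator the lower bound for the image; 2^(1/p) pays for the shells lost at both ends. K does
  not involve L.\<close>

lemma hausdorff_truncated_le:
  fixes \<Phi> :: "real^'n \<Rightarrow> complex" and A :: "nat \<Rightarrow> real^'n \<Rightarrow> real^'n^'n" and L :: nat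
  assumes m: "1 \<le> m"
    and \<beta>: "\<beta> > - real CARD('n)" "\<And>i. i \<in> {1..m} \<Longrightarrow> \<beta>s i > - real CARD('n)"
    and p: "1 \<le> p" and q: "1 \<le> q"
    and ps: "\<And>i. i \<in> {1..m} \<Longrightarrow> 1 \<le> ps i" "(\<Sum>i=1..m. 1 / ps i) = 1 / p"
    and qs: "\<And>i. i \<in> {1..m} \<Longrightarrow> 1 \<le> qs i" "(\<Sum>i=1..m. 1 / qs i) = 1 / q"
    and \<gamma>: "(\<Sum>i=1..m. \<gamma>s i / qs i) = \<gamma> / q"
    and \<alpha>: "(\<Sum>i=1..m. (1 + \<beta>s i / real CARD('n)) * \<alpha>s i) = (1 + \<beta> / real CARD('n)) * \<alpha>"
    and \<Phi>: "\<Phi> \<in> borel_measurable lebesgue" and A: "ae_invertible_family m A" and rho: "rho m A < \<infinity>"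
    and \<rho>: "1 \<le> \<rho>" "\<rho> \<le> 2 ^ R" "enn2real (rho m A) \<le> \<rho>"
    and sign: "real_of_constant_sign \<Phi>"
    and bound: "multilinear_bound m (hausdorff_def_at m \<Phi> A) (hausdorff_op m \<Phi> A)
      (\<lambda>i. herz_space (power_weight (\<beta>s i)) (power_weight (\<gamma>s i)) (\<alpha>s i) (ps i) (qs i))
      (herz_space (power_weight \<beta>) (power_weight \<gamma>) \<alpha> p q) C"
  defines "es \<equiv> \<lambda>i. (1 + \<beta>s i / real CARD('n)) * \<alpha>s i + (real CARD('n) + \<gamma>s i) / qs i"
    and "e \<equiv> (1 + \<beta> / real CARD('n)) * \<alpha> + (real CARD('n) + \<gamma>) / q"
  assumes K: "K = 2 powr (1 / p) * (\<Prod>i=1..m. ball_integral TYPE(real^'n) (\<beta>s i) powr (\<alpha>s i / real CARD('n)) *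
       shell_integral TYPE(real^'n) (\<gamma>s i - es i * qs i) powr (1 / qs i)) /
       (ball_integral TYPE(real^'n) \<beta> powr (\<alpha> / real CARD('n)) * (\<Prod>i=1..m. \<rho> powr - \<bar>es i\<bar>) *
        shell_integral TYPE(real^'n) (\<gamma> - e * q) powr (1 / q))"
    and j: "0 \<le> j" "ennreal j \<le> (\<integral>\<^sup>+y. ennreal (cmod (\<Phi> y) / norm y ^ CARD('n) *
        (\<Prod>i=1..m. norm (matrix_inv (A i y)) powr es i)) *
        indicator (inverse_norm_window m A L) y \<partial>lborel)"
  shows "j \<le> K * C"
proof -
  \<comment> \<open>Of the N = 4L + 2R + 2 shells carrying the test functions, S keeps N - 2L - R =
    2L + R + 2, more than half.\<close>
  define N where "N = 2 * (2 * L + R + 1)"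
  define S where "S = {int L + 1..int N - int L - int R}"
  define g where "g i = (shell_power_fun {1..int N} (es i) :: real^'n \<Rightarrow> real)" for i
  define f where "f i z = complex_of_real (g i z)" for i z
  define W where "W = ball_integral TYPE(real^'n) \<beta> powr (\<alpha> / real CARD('n))"
  define Ws where "Ws i = ball_integral TYPE(real^'n) (\<beta>s i) powr (\<alpha>s i / real CARD('n))" for i
  define \<sigma>s where "\<sigma>s i = (1 + \<beta>s i / real CARD('n)) * \<alpha>s i" for i
  define \<sigma> where "\<sigma> = (1 + \<beta> / real CARD('n)) * \<alpha>"
  define s where "s = shell_integral TYPE(real^'n) (\<gamma> - e * q)"
  define ss where "ss i = shell_integral TYPE(real^'n) (\<gamma>s i - es i * qs i)" for i
  define \<kappa> where "\<kappa> = (\<Prod>i=1..m. \<rho> powr - \<bar>es i\<bar>)"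
  let ?I = "{1..m}"
  let ?D = "inverse_norm_window m A L"
  let ?h = "\<lambda>y. cmod (\<Phi> y) / norm y ^ CARD('n) * (\<Prod>i=1..m. norm (matrix_inv (A i y)) powr es i)"
  let ?T = "hausdorff_op m \<Phi> A f"
  have pq: "0 < ps i" "0 < qs i" if "i \<in> ?I" for i using ps(1)[OF that] qs(1)[OF that] by auto
  have pq0: "0 < p" "0 < q" using p q by auto
  have W: "W > 0" using ball_integral_pos[of \<beta>, where 'a="real^'n"] \<beta> by (simp add: W_def)
  have s: "s > 0" unfolding s_def by (rule shell_integral_pos)
  have ss: "ss i > 0" for i unfolding ss_def by (rule shell_integral_pos)
  have \<kappa>: "\<kappa> > 0" using \<rho> by (auto simp: \<kappa>_def intro!: prod_pos)
  \<comment> \<open>The exponents add up to the critical exponent of the target space; this uses the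
    balance conditions on the \<alpha>s, the \<gamma>s and the 1/q_i.\<close>
  have e: "e = (\<Sum>i=1..m. es i)"
  proof -
    have "(\<Sum>i=1..m. es i) = (\<Sum>i=1..m. \<sigma>s i) + (\<Sum>i=1..m. real CARD('n) * (1 / qs i)) + (\<Sum>i=1..m. \<gamma>s i / qs i)"
      by (simp add: es_def \<sigma>s_def sum.distrib add_divide_distrib)
    also have "(\<Sum>i=1..m. real CARD('n) * (1 / qs i)) = real CARD('n) * (1 / q)"
      by (simp only: sum_distrib_left[symmetric] qs(2))
    finally show ?thesis using \<alpha> \<gamma> by (simp add: e_def \<sigma>s_def add_divide_distrib)
  qed
  have f_eq: "f = (\<lambda>i z. complex_of_real (g i z))" by (simp add: f_def fun_eq_iff)
  have g_nonneg: "0 \<le> g i z" for i z by (simp add: g_def shell_power_fun_nonneg)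
  have f_meas: "f i \<in> borel_measurable lebesgue" for i
    unfolding f_def g_def by (intro measurable_completion) measurable
  have f_sum: "herz_sum (\<sigma>s i) (\<gamma>s i) (ps i) (qs i) (nrm (f i)) = ennreal (real N * ss i powr (ps i / qs i))" if "i \<in> ?I" for i
    using herz_sum_shell_power_fun[of "{1..int N}" 1 "ps i" "qs i" "es i" "\<sigma>s i" "\<gamma>s i", where 'a="real^'n"] pq[OF that]
    by (simp add: f_def g_def shell_power_fun_nonneg es_def \<sigma>s_def ss_def)
  have f_mem: "f i \<in> herz_set (power_weight (\<beta>s i)) (power_weight (\<gamma>s i)) (\<alpha>s i) (ps i) (qs i)" if "i \<in> ?I" for i
    using herz_set_iff[OF f_meas[of i], of "ps i" "qs i" "\<beta>s i" "\<gamma>s i" "\<alpha>s i"] pq[OF that] \<beta>(2)[OF that] f_sum[OF that]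
    by (simp add: \<sigma>s_def)
  have f_norm: "herz_norm (power_weight (\<beta>s i)) (power_weight (\<gamma>s i)) (\<alpha>s i) (ps i) (qs i) (f i) =
      Ws i * ss i powr (1 / qs i) * real N powr (1 / ps i)" if "i \<in> ?I" for i
  proof -
    have "herz_norm (power_weight (\<beta>s i)) (power_weight (\<gamma>s i)) (\<alpha>s i) (ps i) (qs i) (f i) =
      Ws i * (real N * ss i powr (ps i / qs i)) powr (1 / ps i)"
      using herz_set_herz_norm(3)[OF f_mem[OF that] pq[OF that] \<beta>(2)[OF that]] f_sum[OF that]
      by (simp add: \<sigma>s_def Ws_def)
    also have "(real N * ss i powr (ps i / qs i)) powr (1 / ps i) = ss i powr (1 / qs i) * real N powr (1 / ps i)"
      using pq[OF that] by (simp add: powr_mult powr_powr)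
    finally show ?thesis by simp
  qed
  \<comment> \<open>Since the 1/p_i add up to 1/p, the norms contribute exactly N^(1/p), the power
    that the image also produces up to a constant.\<close>
  have f_prod: "(\<Prod>i=1..m. herz_norm (power_weight (\<beta>s i)) (power_weight (\<gamma>s i)) (\<alpha>s i) (ps i) (qs i) (f i)) =
      (\<Prod>i=1..m. Ws i * ss i powr (1 / qs i)) * real N powr (1 / p)"
  proof -
    have "N \<noteq> 0" by (simp add: N_def)
    then show ?thesis using m ps(2)
      by (simp add: f_norm prod.distrib powr_sum[symmetric])
  qed
  from bound f_mem have def_at: "AE x in lborel. hausdorff_def_at m \<Phi> A f x"
    and T_mem: "?T \<in> herz_set (power_weight \<beta>) (power_weight \<gamma>) \<alpha> p q"
    and T_norm: "herz_norm (power_weight \<beta>) (power_weight \<gamma>) \<alpha> p q ?T \<le>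
      C * ((\<Prod>i=1..m. Ws i * ss i powr (1 / qs i)) * real N powr (1 / p))"
    unfolding multilinear_bound_def f_prod[symmetric] by (auto simp: herz_space_def AE_completion_iff)
  note hD_meas = truncated_integrand_measurable[OF \<Phi> A rho, of es L]
  have good: "AE y in lborel. \<forall>i\<in>?I. invertible (A i y) \<and> norm (A i y) * norm (matrix_inv (A i y)) \<le> \<rho>"
  proof (rule AE_finite_allI)
    fix i assume i: "i \<in> ?I"
    have "AE y in lborel. invertible (A i y)"
      using A i by (simp add: ae_invertible_family_def AE_completion_iff)
    then show "AE y in lborel. invertible (A i y) \<and> norm (A i y) * norm (matrix_inv (A i y)) \<le> \<rho>"
      using rho_finite(2)[OF A rho i] by eventually_elim (use \<rho>(3) in auto)
  qed simp
  \<comment> \<open>Outside the shells of S the left side is 0. On them every y in the window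
    satisfies the pointwise bound for all i, with total loss \<kappa> independent of y; the part of
    the integral outside the window is dropped.\<close>
  have "AE x in lborel. ennreal (j * \<kappa> * shell_power_fun S e x) \<le> nrm ?T x"
    using def_at
  proof eventually_elim
    case (elim x)
    show ?case
    proof (cases "\<exists>k\<in>S. x \<in> dyadic_shell k")
      case False
      then show ?thesis by (simp add: shell_power_fun_def)
    next
      case True
      then obtain k where k: "k \<in> S" "x \<in> dyadic_shell k" by blast
      have "j * \<kappa> * shell_power_fun S e x = (\<kappa> * norm x powr - e) * j"
        using k(1) by (simp add: shell_power_fun_eq[OF k(2)])
      then have "ennreal (j * \<kappa> * shell_power_fun S e x) = ennreal (\<kappa> * norm x powr - e) * ennreal j"
        using j(1) \<kappa> by (simp only: ennreal_mult mult_nonneg_nonneg powr_ge_zero less_imp_le)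
      also have "\<dots> \<le> ennreal (\<kappa> * norm x powr - e) * (\<integral>\<^sup>+y. ennreal (?h y) * indicator ?D y \<partial>lborel)"
        by (rule mult_left_mono[OF j(2)]) simp
      also have "\<dots> = (\<integral>\<^sup>+y. ennreal (\<kappa> * norm x powr - e) * (ennreal (?h y) * indicator ?D y) \<partial>lborel)"
        using nn_integral_cmult[OF hD_meas, of "ennreal (\<kappa> * norm x powr - e)"] unfolding nn_integral_completion
        by (rule sym)
      also have "\<dots> \<le> (\<integral>\<^sup>+y. ennreal (cmod (\<Phi> y) / norm y ^ CARD('n) * (\<Prod>i=1..m. g i (A i y *v x))) \<partial>lborel)"
      proof (rule nn_integral_mono_AE)
        show "AE y in lborel. ennreal (\<kappa> * norm x powr - e) * (ennreal (?h y) * indicator ?D y) \<le>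
          ennreal (cmod (\<Phi> y) / norm y ^ CARD('n) * (\<Prod>i=1..m. g i (A i y *v x)))"
          using good
        proof eventually_elim
          case (elim y)
          show ?case
          proof (cases "y \<in> ?D")
            case True
            have x0: "x \<noteq> 0" using k by (simp add: mem_dyadic_shell_iff_log)
            have "\<kappa> * norm x powr - e * (\<Prod>i=1..m. norm (matrix_inv (A i y)) powr es i) =
                (\<Prod>i=1..m. \<rho> powr - \<bar>es i\<bar> * norm (matrix_inv (A i y)) powr es i * norm x powr - es i)"
              using x0 m by (simp add: \<kappa>_def prod.distrib e powr_sum[symmetric] sum_negf)
            also have "\<dots> \<le> (\<Prod>i=1..m. g i (A i y *v x))"
            proof (intro prod_mono conjI)
              fix i assume i: "i \<in> ?I"
              show "\<rho> powr - \<bar>es i\<bar> * norm (matrix_inv (A i y)) powr es i * norm x powr - es i \<le> g i (A i y *v x)"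
                unfolding g_def
                by (rule shell_power_fun_le_matrix[where R=R and L=L and k=k])
                   (use elim i True \<rho> k in \<open>auto simp: S_def inverse_norm_window_def\<close>)
            qed auto
            finally have "cmod (\<Phi> y) / norm y ^ CARD('n) * (\<kappa> * norm x powr - e * (\<Prod>i=1..m. norm (matrix_inv (A i y)) powr es i)) \<le>
              cmod (\<Phi> y) / norm y ^ CARD('n) * (\<Prod>i=1..m. g i (A i y *v x))"
              by (rule mult_left_mono) auto
            then have "\<kappa> * norm x powr - e * ?h y \<le> cmod (\<Phi> y) / norm y ^ CARD('n) * (\<Prod>i=1..m. g i (A i y *v x))"
              by (simp add: mult_ac)
            then show ?thesis using True \<kappa> by (simp add: ennreal_mult[symmetric] prod_nonneg ennreal_leI)
          qed simp
        qed
      qed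
      also have "\<dots> = nrm ?T x"
        using hausdorff_op_constant_sign[OF sign elim[unfolded f_eq]] g_nonneg unfolding f_eq by simp
      finally show ?thesis .
    qed
  qed
  then have "herz_sum \<sigma> \<gamma> p q (\<lambda>x. ennreal (j * \<kappa> * shell_power_fun S e (x::real^'n))) \<le> herz_sum \<sigma> \<gamma> p q (nrm ?T)"
    using pq0 by (intro herz_sum_mono) auto
  moreover have "herz_sum \<sigma> \<gamma> p q (\<lambda>x. ennreal (j * \<kappa> * shell_power_fun S e (x::real^'n))) =
      ennreal ((j * \<kappa>) powr p * real (card S) * s powr (p / q))"
    using herz_sum_shell_power_fun[of S "j * \<kappa>" p q e \<sigma> \<gamma>, where 'a="real^'n"] pq0 j \<kappa>
    by (simp add: S_def e_def \<sigma>_def s_def)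
  ultimately have "ennreal ((j * \<kappa>) powr p * real (card S) * s powr (p / q)) \<le> herz_sum \<sigma> \<gamma> p q (nrm ?T)"
    by simp
  from enn2real_mono[OF this] herz_set_herz_norm(2)[OF T_mem pq0 \<beta>(1)]
  have "(j * \<kappa>) powr p * real (card S) * s powr (p / q) \<le> enn2real (herz_sum \<sigma> \<gamma> p q (nrm ?T))"
    by (simp add: \<sigma>_def)
  then have "W * ((j * \<kappa>) powr p * real (card S) * s powr (p / q)) powr (1 / p) \<le>
      W * enn2real (herz_sum \<sigma> \<gamma> p q (nrm ?T)) powr (1 / p)"
    using W p by (intro mult_left_mono powr_mono2) auto
  also have "\<dots> = herz_norm (power_weight \<beta>) (power_weight \<gamma>) \<alpha> p q ?T"
    using herz_set_herz_norm(3)[OF T_mem pq0 \<beta>(1)] by (simp add: W_def \<sigma>_def)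
  also note T_norm
  also have "((j * \<kappa>) powr p * real (card S) * s powr (p / q)) powr (1 / p) =
      j * \<kappa> * s powr (1 / q) * real (card S) powr (1 / p)"
    using pq0 j \<kappa> s by (simp add: powr_mult powr_powr)
  finally have main: "W * (j * \<kappa> * s powr (1 / q) * real (card S) powr (1 / p)) \<le>
      C * ((\<Prod>i=1..m. Ws i * ss i powr (1 / qs i)) * real N powr (1 / p))" .
  have "0 \<le> C" using bound by (simp add: multilinear_bound_def)
  have "real N \<le> 2 * real (card S)" by (simp add: S_def N_def)
  then have "real N powr (1 / p) \<le> (2 * real (card S)) powr (1 / p)"
    using p by (intro powr_mono2) auto
  then have "real N powr (1 / p) \<le> 2 powr (1 / p) * real (card S) powr (1 / p)" by (simp add: powr_mult)
  then have "C * ((\<Prod>i=1..m. Ws i * ss i powr (1 / qs i)) * real N powr (1 / p)) \<le>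
      C * ((\<Prod>i=1..m. Ws i * ss i powr (1 / qs i)) * (2 powr (1 / p) * real (card S) powr (1 / p)))"
    using \<open>0 \<le> C\<close> by (intro mult_left_mono prod_nonneg) (auto simp: Ws_def)
  \<comment> \<open>N^(1/p) has been traded for 2^(1/p) \<open>card S\<close>^(1/p), so the number
    of shells, and with it all dependence on L, cancels.\<close>
  with main have "(W * \<kappa> * s powr (1 / q) * j) * real (card S) powr (1 / p) \<le>
      (C * (2 powr (1 / p) * (\<Prod>i=1..m. Ws i * ss i powr (1 / qs i)))) * real (card S) powr (1 / p)"
    by (simp add: mult_ac)
  moreover have "real (card S) powr (1 / p) > 0" by (simp add: S_def N_def)
  ultimately have "W * \<kappa> * s powr (1 / q) * j \<le> C * (2 powr (1 / p) * (\<Prod>i=1..m. Ws i * ss i powr (1 / qs i)))"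
    by (simp only: mult_le_cancel_right_pos)
  moreover have "W * \<kappa> * s powr (1 / q) > 0" using W \<kappa> s by simp
  ultimately have "j \<le> C * (2 powr (1 / p) * (\<Prod>i=1..m. Ws i * ss i powr (1 / qs i))) / (W * \<kappa> * s powr (1 / q))"
    by (simp add: pos_le_divide_eq mult.commute)
  also have "\<dots> = K * C" by (simp add: K W_def Ws_def \<kappa>_def s_def ss_def)
  finally show ?thesis .
qed

theorem theorem3p3:
  fixes m :: nat
    and p q \<alpha> \<beta> \<gamma> :: real
    and ps qs \<alpha>s \<beta>s \<gamma>s :: "nat \<Rightarrow> real"
    and \<rho> :: ennreal
    and X :: "nat \<Rightarrow> (real^'n) fun_space"
    and Y :: "(real^'n) fun_space"
  assumes "1 \<le> m"
    and "\<beta> > - real CARD('n)" "\<gamma> > - real CARD('n)"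
    and "\<forall>i\<in>{1..m}. \<beta>s i > - real CARD('n) \<and> \<gamma>s i > - real CARD('n)"
    and "1 \<le> p" "1 \<le> q"
    and "\<forall>i\<in>{1..m}. 1 \<le> ps i \<and> 1 \<le> qs i"
    and "(\<Sum>i=1..m. 1 / ps i) = 1 / p"
    and "(\<Sum>i=1..m. 1 / qs i) = 1 / q"
    and "(\<Sum>i=1..m. \<gamma>s i / qs i) = \<gamma> / q"
    and "(\<Sum>i=1..m. (1 + \<beta>s i / real CARD('n)) * \<alpha>s i) = (1 + \<beta> / real CARD('n)) * \<alpha>"
    and "\<rho> < \<infinity>"
    and X_def: "X = (\<lambda>i. herz_space (power_weight (\<beta>s i)) (power_weight (\<gamma>s i)) (\<alpha>s i) (ps i) (qs i))"
    and Y_def: "Y = herz_space (power_weight \<beta>) (power_weight \<gamma>) \<alpha> p q"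
  shows
    "(\<exists>C>0. \<forall>(\<Phi> :: real^'n \<Rightarrow> complex) A.
        locally_integrable \<Phi> \<and> ae_invertible_family m A \<and> rho m A = \<rho> \<and>
        hausdorff_const m \<Phi> A \<beta>s \<gamma>s \<alpha>s qs < \<infinity> \<longrightarrow>
          multilinear_bounded m (hausdorff_def_at m \<Phi> A) (hausdorff_op m \<Phi> A) X Y \<and>
          ennreal (multilinear_norm m (hausdorff_def_at m \<Phi> A) (hausdorff_op m \<Phi> A) X Y)
            \<le> ennreal C * hausdorff_const m \<Phi> A \<beta>s \<gamma>s \<alpha>s qs) \<and>
     (\<exists>C>0. \<forall>(\<Phi> :: real^'n \<Rightarrow> complex) A.
        locally_integrable \<Phi> \<and> ae_invertible_family m A \<and> rho m A = \<rho> \<and>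
        real_of_constant_sign \<Phi> \<and>
        multilinear_bounded m (hausdorff_def_at m \<Phi> A) (hausdorff_op m \<Phi> A) X Y \<longrightarrow>
          hausdorff_const m \<Phi> A \<beta>s \<gamma>s \<alpha>s qs < \<infinity> \<and>
          hausdorff_const m \<Phi> A \<beta>s \<gamma>s \<alpha>s qs
            \<le> ennreal C * ennreal (multilinear_norm m (hausdorff_def_at m \<Phi> A) (hausdorff_op m \<Phi> A) X Y))"
proof -
  let ?n = "real CARD('n)"
  have Y_dim: "ball_integral TYPE(real^'n) \<beta> > 0"
    using ball_integral_pos[of \<beta>, where 'a="real^'n"] assms(2) by simp
  have X_dim: "ball_integral TYPE(real^'n) (\<beta>s i) > 0" if "i \<in> {1..m}" for i
    using ball_integral_pos[of "\<beta>s i", where 'a="real^'n"] assms(4) that by simp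
  have \<beta>s: "\<And>i. i \<in> {1..m} \<Longrightarrow> \<beta>s i > - ?n" and ps: "\<And>i. i \<in> {1..m} \<Longrightarrow> 1 \<le> ps i"
    and qs: "\<And>i. i \<in> {1..m} \<Longrightarrow> 1 \<le> qs i" using assms(4,7) by auto
  \<comment> \<open>The comparison estimates require a real bound that is at least 1. It and R
    depend on \<rho> alone, so the constants below are fixed before \<Phi> and A.\<close>
  define r where "r = max 1 (enn2real \<rho>)"
  obtain R :: nat where R: "r \<le> 2 ^ R" using real_arch_pow[of 2 r] by (auto intro: less_imp_le)
  have r: "1 \<le> r" "enn2real \<rho> \<le> r" by (auto simp: r_def)
  show ?thesis
  proof (intro conjI)
    define K where "K = ball_integral TYPE(real^'n) \<beta> powr (\<alpha> / ?n) *
       (\<Prod>i=1..m. dilation_const r R ((1 + \<beta>s i / ?n) * \<alpha>s i) (\<gamma>s i) (ps i) (qs i) /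
          ball_integral TYPE(real^'n) (\<beta>s i) powr (\<alpha>s i / ?n))"
    have "K > 0" unfolding K_def using Y_dim X_dim
      by (intro mult_pos_pos prod_pos divide_pos_pos dilation_const_pos r) force+
    moreover have "multilinear_bounded m (hausdorff_def_at m \<Phi> A) (hausdorff_op m \<Phi> A) X Y \<and>
          ennreal (multilinear_norm m (hausdorff_def_at m \<Phi> A) (hausdorff_op m \<Phi> A) X Y)
            \<le> ennreal K * hausdorff_const m \<Phi> A \<beta>s \<gamma>s \<alpha>s qs"
      if H: "locally_integrable \<Phi> \<and> ae_invertible_family m A \<and> rho m A = \<rho> \<and>
        hausdorff_const m \<Phi> A \<beta>s \<gamma>s \<alpha>s qs < \<infinity>" for \<Phi> :: "real^'n \<Rightarrow> complex" and A
    proof -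
      have b: "multilinear_bound m (hausdorff_def_at m \<Phi> A) (hausdorff_op m \<Phi> A) X Y
          (K * enn2real (hausdorff_const m \<Phi> A \<beta>s \<gamma>s \<alpha>s qs))"
        unfolding K_def X_def Y_def
        by (rule hausdorff_bounded[OF assms(1,2) \<beta>s assms(5,6) ps assms(8) qs assms(9,10,11)])
           (use H R r assms(12) locally_integrable_measurable in auto)
      have "ennreal (multilinear_norm m (hausdorff_def_at m \<Phi> A) (hausdorff_op m \<Phi> A) X Y) \<le>
          ennreal (K * enn2real (hausdorff_const m \<Phi> A \<beta>s \<gamma>s \<alpha>s qs))"
        by (rule ennreal_leI[OF multilinear_norm_le[OF b]])
      also have "\<dots> = ennreal K * hausdorff_const m \<Phi> A \<beta>s \<gamma>s \<alpha>s qs"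
        using H \<open>K > 0\<close> by (simp add: ennreal_mult less_top)
      finally show ?thesis using b by (auto simp: multilinear_bounded_def)
    qed
    ultimately show "\<exists>C>0. \<forall>(\<Phi> :: real^'n \<Rightarrow> complex) A.
        locally_integrable \<Phi> \<and> ae_invertible_family m A \<and> rho m A = \<rho> \<and>
        hausdorff_const m \<Phi> A \<beta>s \<gamma>s \<alpha>s qs < \<infinity> \<longrightarrow>
          multilinear_bounded m (hausdorff_def_at m \<Phi> A) (hausdorff_op m \<Phi> A) X Y \<and>
          ennreal (multilinear_norm m (hausdorff_def_at m \<Phi> A) (hausdorff_op m \<Phi> A) X Y)
            \<le> ennreal C * hausdorff_const m \<Phi> A \<beta>s \<gamma>s \<alpha>s qs"
      by blast
  next
    define es where "es i = (1 + \<beta>s i / ?n) * \<alpha>s i + (?n + \<gamma>s i) / qs i" for i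
    define e where "e = (1 + \<beta> / ?n) * \<alpha> + (?n + \<gamma>) / q"
    define K where "K = 2 powr (1 / p) * (\<Prod>i=1..m. ball_integral TYPE(real^'n) (\<beta>s i) powr (\<alpha>s i / ?n) *
       shell_integral TYPE(real^'n) (\<gamma>s i - es i * qs i) powr (1 / qs i)) /
       (ball_integral TYPE(real^'n) \<beta> powr (\<alpha> / ?n) * (\<Prod>i=1..m. r powr - \<bar>es i\<bar>) *
        shell_integral TYPE(real^'n) (\<gamma> - e * q) powr (1 / q))"
    have sh: "shell_integral TYPE(real^'n) a powr b > 0" for a b
      using shell_integral_pos[of a, where 'a="real^'n"] by simp
    have "K > 0" unfolding K_def using Y_dim X_dim r sh
      by (intro mult_pos_pos prod_pos divide_pos_pos) force+
    moreover have "hausdorff_const m \<Phi> A \<beta>s \<gamma>s \<alpha>s qs < \<infinity> \<and> hausdorff_const m \<Phi> A \<beta>s \<gamma>s \<alpha>s qs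
            \<le> ennreal K * ennreal (multilinear_norm m (hausdorff_def_at m \<Phi> A) (hausdorff_op m \<Phi> A) X Y)"
      if H: "locally_integrable \<Phi> \<and> ae_invertible_family m A \<and> rho m A = \<rho> \<and> real_of_constant_sign \<Phi> \<and>
        multilinear_bounded m (hausdorff_def_at m \<Phi> A) (hausdorff_op m \<Phi> A) X Y" for \<Phi> :: "real^'n \<Rightarrow> complex" and A
    proof -
      let ?C = "hausdorff_const m \<Phi> A \<beta>s \<gamma>s \<alpha>s qs"
      have \<Phi>: "\<Phi> \<in> borel_measurable lebesgue" using H locally_integrable_measurable by blast
      have A: "ae_invertible_family m A" and rho: "rho m A < \<infinity>" using H assms(12) by auto
      have le: "?C \<le> ennreal (K * C)"
        if C: "multilinear_bound m (hausdorff_def_at m \<Phi> A) (hausdorff_op m \<Phi> A) X Y C" for C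
        unfolding hausdorff_const_def nn_integral_completion es_def[symmetric]
      proof (rule nn_integral_le_truncated[OF \<Phi> A rho])
        fix L
        let ?J = "\<integral>\<^sup>+y. ennreal (cmod (\<Phi> y) / norm y ^ CARD('n) * (\<Prod>i=1..m. norm (matrix_inv (A i y)) powr es i)) *
          indicator (inverse_norm_window m A L) y \<partial>lborel"
        have j: "j \<le> K * C" if "0 \<le> j" "ennreal j \<le> ?J" for j
          using that unfolding es_def
          by (intro hausdorff_truncated_le[OF assms(1,2) \<beta>s assms(5,6) ps assms(8) qs assms(9,10,11) \<Phi> A rho r(1) R _ _ C[unfolded X_def Y_def] K_def[unfolded es_def e_def]])
             (use H r in auto)
        show "?J \<le> ennreal (K * C)"
        proof (cases ?J)
          \<comment> \<open>An infinite truncated integral would admit j = K C + 1, contradicting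
            the bound for j.\<close>
          case top
          have "0 \<le> K * C" using C \<open>K > 0\<close> by (simp add: multilinear_bound_def)
          then show ?thesis using j[of "K * C + 1"] top by simp
        next
          case (real a)
          then show ?thesis using j[of a] by (simp add: ennreal_leI)
        qed
      qed
      \<comment> \<open>A single admissible constant already makes \<C>_2 finite; the sharp
        comparison with the operator norm then takes the infimum over all admissible
        constants.\<close>
      obtain C0 where "multilinear_bound m (hausdorff_def_at m \<Phi> A) (hausdorff_op m \<Phi> A) X Y C0"
        using H by (auto simp: multilinear_bounded_def)
      from le_less_trans[OF le[OF this]] have fin: "?C < \<infinity>" by simp
      have "enn2real ?C / K \<le> multilinear_norm m (hausdorff_def_at m \<Phi> A) (hausdorff_op m \<Phi> A) X Y"
      proof (rule multilinear_norm_ge)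
        fix C assume C: "multilinear_bound m (hausdorff_def_at m \<Phi> A) (hausdorff_op m \<Phi> A) X Y C"
        have "0 \<le> K * C" using C \<open>K > 0\<close> by (simp add: multilinear_bound_def)
        then have "enn2real ?C \<le> K * C" using le[OF C] by (rule enn2real_leI)
        then show "enn2real ?C / K \<le> C" using \<open>K > 0\<close> by (simp add: pos_divide_le_eq mult.commute)
      qed (use H in blast)
      then have "enn2real ?C \<le> K * multilinear_norm m (hausdorff_def_at m \<Phi> A) (hausdorff_op m \<Phi> A) X Y"
        using \<open>K > 0\<close> by (simp add: pos_divide_le_eq mult.commute)
      then have "ennreal (enn2real ?C) \<le> ennreal (K * multilinear_norm m (hausdorff_def_at m \<Phi> A) (hausdorff_op m \<Phi> A) X Y)"
        by (rule ennreal_leI)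
      also have "\<dots> = ennreal K * ennreal (multilinear_norm m (hausdorff_def_at m \<Phi> A) (hausdorff_op m \<Phi> A) X Y)"
        using \<open>K > 0\<close> by (intro ennreal_mult') simp
      finally show ?thesis using fin by simp
    qed
    ultimately show "\<exists>C>0. \<forall>(\<Phi> :: real^'n \<Rightarrow> complex) A.
        locally_integrable \<Phi> \<and> ae_invertible_family m A \<and> rho m A = \<rho> \<and>
        real_of_constant_sign \<Phi> \<and>
        multilinear_bounded m (hausdorff_def_at m \<Phi> A) (hausdorff_op m \<Phi> A) X Y \<longrightarrow>
          hausdorff_const m \<Phi> A \<beta>s \<gamma>s \<alpha>s qs < \<infinity> \<and>
          hausdorff_const m \<Phi> A \<beta>s \<gamma>s \<alpha>s qs
            \<le> ennreal C * ennreal (multilinear_norm m (hausdorff_def_at m \<Phi> A) (hausdorff_op m \<Phi> A) X Y)"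
      by blast
  qed
qed

end
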